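(* Let $X$ be a real Lévy process with Lévy measure $\pi$, and let $Z$ be the Lévy process $X$ resurrected in the positive half-line, with absorption time $\zeta$. Then for all $x\ge 0$, all $t\ge 0$ and every nonnegative measurable function $f$, $$E_x\left(f(Z_t)\,\mathbf 1_{\{t<\zeta\}}\right)=\mathbb{E}_x\left(f(X_t)\exp\left(\int_0^t\bar{\pi}^-(-X_s)\,ds\right)\mathbf 1_{\{t<\tau\}}\right).$$
   Context: Let $X=(X_t)_{t\ge0}$ be a real-valued Lévy process (with infinite lifetime). $\mathbb{P}_x$ denotes the law under which $X$ is this Lévy process started from $X_0=x$, with expectation $\mathbb{E}_x$, and $\tau=\inf\{t\ge0:X_t\le0\}$ (with $\inf\emptyset=\infty$). $\pi$ is the Lévy measure of $X$ and $\bar{\pi}^{-}(x)=\pi((-\infty,x])$. Resurrected process. Fix $x\ge0$ and let $X^{(1)}$ be the Lévy process started from $x$. For $n\ge1$ let $\tau_n=\inf\{t\ge0:X^{(n)}_t\le0\}$. If $\tau_n=\infty$ set $X^{(n+1)}=X^{(n)}$. If $\tau_n<\infty$ set $X^{(n+1)}_t=X^{(n)}_t$ for $t<\tau_n$ and $X^{(n+1)}_t=X^{(n)}_t-(X^{(n)}_{\tau_n}-X^{(n)}_{\tau_n-})$ for $t\ge\tau_n$ (the jump at $\tau_n$ is removed; there is no jump at time $0$). The sequence $(\tau_n)$ is nondecreasing. The resurrected process is $Z_t=\lim_{n\to\infty}X^{(n)}_t\mathbf 1_{\{t<\tau_n\}}$, $t\ge0$; it is a nonnegative process started from $x$ and absorbed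 at $0$. Its absorption time is $\zeta=\inf\{t:Z_t=0\}=\lim_{n\to\infty}\tau_n\in[0,\infty]$. $P_x$ denotes the law of $Z$ (together with the times $\tau_n$) started from $x$, with expectation $E_x$. *)

theory Defs
  imports "HOL-Probability.Probability"
begin

text \<open>A path is a function \<^typ>\<open>real \<Rightarrow> real\<close> of which only the values at times \<open>t \<ge> 0\<close> matter.\<close>

definition cadlag :: "(real \<Rightarrow> real) \<Rightarrow> bool" where
  "cadlag w \<longleftrightarrow>
     (\<forall>t\<ge>0. (w \<longlongrightarrow> w t) (at_right t)) \<and>
     (\<forall>t>0. \<exists>l. (w \<longlongrightarrow> l) (at_left t))"

text \<open>There is no jump at time 0.\<close>

definition jump :: "(real \<Rightarrow> real) \<Rightarrow> real \<Rightarrow> real" where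
  "jump w t = (if t \<le> 0 then 0 else w t - Lim (at_left t) w)"

locale levy_process = prob_space M
  for M :: "'a measure" and X :: "real \<Rightarrow> 'a \<Rightarrow> real" +
  assumes random_variable_X: "t \<ge> 0 \<Longrightarrow> random_variable borel (X t)"
    and starts_at_0: "AE \<omega> in M. X 0 \<omega> = 0"
    and cadlag_paths: "AE \<omega> in M. cadlag (\<lambda>t. X t \<omega>)"
    and stationary_increments: "s \<ge> 0 \<Longrightarrow> h \<ge> 0 \<Longrightarrow>
          distr M borel (\<lambda>\<omega>. X (s + h) \<omega> - X s \<omega>) = distr M borel (X h)"
    and independent_increments: "\<And>(n::nat) t. 0 \<le> t 0 \<Longrightarrow> (\<And>i. i < n \<Longrightarrow> t i \<le> t (Suc i)) \<Longrightarrow>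
          indep_vars (\<lambda>_. borel) (\<lambda>i \<omega>. X (t (Suc i)) \<omega> - X (t i) \<omega>) {..<n}"

text \<open>
  The Levy measure: \<open>\<pi> A\<close> is the expected number, per unit of time, of nonzero jumps whose
  size lies in \<open>A\<close> (Cont and Tankov, Financial Modelling with Jump Processes, Definition 3.4).
\<close>

definition is_levy_measure :: "'a measure \<Rightarrow> (real \<Rightarrow> 'a \<Rightarrow> real) \<Rightarrow> real measure \<Rightarrow> bool" where
  "is_levy_measure M X \<pi> \<longleftrightarrow>
     sets \<pi> = sets borel \<and>
     (\<forall>A\<in>sets borel. emeasure \<pi> A =
        (\<integral>\<^sup>+\<omega>. emeasure (count_space UNIV)
                {t\<in>{0<..1}. jump (\<lambda>s. X s \<omega>) t \<noteq> 0 \<and> jump (\<lambda>s. X s \<omega>) t \<in> A} \<partial>M))"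

definition hitting_time :: "real set \<Rightarrow> (real \<Rightarrow> real) \<Rightarrow> ereal" where
  "hitting_time A w = (INF t\<in>{t. 0 \<le> t \<and> w t \<in> A}. ereal t)"

abbreviation first_passage :: "(real \<Rightarrow> real) \<Rightarrow> ereal" where
  "first_passage w \<equiv> hitting_time {..0} w"

text \<open>The jump at the first passage time, if that time is finite, is removed.\<close>

definition resurrect_once :: "(real \<Rightarrow> real) \<Rightarrow> real \<Rightarrow> real" where
  "resurrect_once w t =
     (if ereal t < first_passage w then w t
      else w t - jump w (real_of_ereal (first_passage w)))"

text \<open>
  The path obtained from \<open>w\<close> by removing \<open>n\<close> successive passage jumps is \<open>(resurrect_once ^^ n) w\<close>;
  thus \<open>n = 0\<close> is the path itself.
  For a cadlag path with \<open>w 0 \<ge> 0\<close> the sequence below is eventually constant at each time \<open>t \<ge> 0\<close>.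
\<close>

definition resurrected :: "(real \<Rightarrow> real) \<Rightarrow> real \<Rightarrow> real" where
  "resurrected w t =
     lim (\<lambda>n. (resurrect_once ^^ n) w t *
              indicator {s. ereal s < first_passage ((resurrect_once ^^ n) w)} t)"

definition absorption_time :: "(real \<Rightarrow> real) \<Rightarrow> ereal" where
  "absorption_time w = hitting_time {0} (resurrected w)"

definition exp_ennreal :: "ennreal \<Rightarrow> ennreal" where
  "exp_ennreal a = (if a = \<infinity> then \<infinity> else ennreal (exp (enn2real a)))"

definition lower_tail :: "real measure \<Rightarrow> real \<Rightarrow> ennreal" where
  "lower_tail \<pi> x = emeasure \<pi> {..x}"

end

theory Submission
  imports Defs
begin

text \<open>
  Let \<open>A\<^sub>n\<close> be the contribution to the left-hand side of the paths that are resurrected exactly \<open>n\<close> times up to time \<open>t\<close>.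
  A path is resurrected by removing the jump at its first passage time \<open>s\<close>, so \<open>A\<^sub>n\<^sub>+\<^sub>1\<close> is a sum over the jump times \<open>s\<close>
  of \<open>X\<close> of a functional of \<open>s\<close>, the jump \<open>y\<close>, and the path \<open>X\<^sup>(\<^sup>s\<^sup>)\<close> without this jump: \<open>A\<^sub>n\<close> is evaluated at \<open>X\<^sup>(\<^sup>s\<^sup>)\<close>, which has
  to be positive up to \<open>s\<close>, and \<open>y \<le> - X\<^sup>(\<^sup>s\<^sup>)\<^sub>s\<close>. By the Mecke formula, the expectation of such a sum is the same functional
  of \<open>(s, X, y)\<close> integrated with respect to \<open>ds\<close>, the law of \<open>X\<close>, and \<open>\<pi>(dy)\<close>; integration over \<open>y\<close> produces the factor \<open>\<pi>((-\<infinity>, -X\<^sub>s])\<close>.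
  After \<open>n\<close> such steps the \<open>n\<close>-th term of the exponential series remains. Everything is nonnegative, so
  no integrability is needed.

  The Mecke formula follows from independent increments alone. On a dyadic grid the increment over
  a cell is independent of the path without this increment; letting the mesh tend to \<open>0\<close> gives the formula for
  continuous test functions.
\<close>

subsection \<open>Cadlag paths\<close>

text \<open>The sum over all jump times takes the place of the strong Markov property at the first
  passage: the jump that ends the life of a path is singled out inside the summand, by positivity of
  the path without it and nonpositivity of the path with it. A statement about a fixed time
  \<open>s\<close>, integrated over \<open>s\<close>, thus replaces one about a random time. Two
  obstacles shape the details. Small jumps may be infinitely many; the formula is therefore proved
  for jumps below \<open>-d\<close> and times up to \<open>K\<close>, where the number of jumps has
  a finite mean, and the truncation is removed by monotone convergence. And positivity at all times
  is an uncountable condition; it is replaced by staying away from 0, which the dyadic values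
  decide. The two notions of first passage agree unless the path has left limit 0 at the end of its
  life and jumps there. That this almost surely never happens, even after any number of
  resurrections, is again a consequence of the Mecke formula: resurrection leads from the law of the
  path to an absolutely continuous one.\<close>

lemma cadlag_at_right:
  "cadlag w \<Longrightarrow> 0 \<le> t \<Longrightarrow> (w \<longlongrightarrow> w t) (at_right t)"
  by (simp add: cadlag_def)

lemma cadlag_at_left:
  assumes "cadlag w" "0 < t"
  shows "(w \<longlongrightarrow> w t - jump w t) (at_left t)"
proof -
  obtain l where "(w \<longlongrightarrow> l) (at_left t)"
    using assms by (auto simp: cadlag_def)
  moreover from this have "Lim (at_left t) w = l"
    by (intro tendsto_Lim) simp_all
  ultimately show ?thesis using assms by (simp add: jump_def)
qed

lemma jump_eqI:
  assumes "0 < t" "(w \<longlongrightarrow> l) (at_left t)"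
  shows "jump w t = w t - l"
  using assms tendsto_Lim[OF _ assms(2)] by (simp add: jump_def)

text \<open>Both one-sided limits with a common radius, as the compactness arguments below use them.
  At \<open>u = 0\<close> the second conclusion is vacuous.\<close>

lemma cadlag_near:
  assumes w: "cadlag w" and u: "0 \<le> u" and e: "0 < e"
  obtains \<eta> where "0 < \<eta>" "\<And>v. u \<le> v \<Longrightarrow> v < u + \<eta> \<Longrightarrow> \<bar>w v - w u\<bar> < e"
    "\<And>v. 0 \<le> v \<Longrightarrow> u - \<eta> < v \<Longrightarrow> v < u \<Longrightarrow> \<bar>w v - (w u - jump w u)\<bar> < e"
proof -
  have "\<forall>\<^sub>F v in at_right u. dist (w v) (w u) < e"
    using tendstoD[OF cadlag_at_right[OF w u] e] .
  then obtain b where b: "b > u" "\<And>v. u < v \<Longrightarrow> v < b \<Longrightarrow> \<bar>w v - w u\<bar> < e"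
    unfolding eventually_at_right_field dist_real_def by auto
  show ?thesis
  proof (cases "u = 0")
    case True
    show ?thesis
      by (rule that[of "b - u"]) (use b True e in \<open>auto, metis abs_zero diff_self less_eq_real_def\<close>)
  next
    case False
    then have "0 < u" using u by simp
    have "\<forall>\<^sub>F v in at_left u. dist (w v) (w u - jump w u) < e"
      using tendstoD[OF cadlag_at_left[OF w \<open>0 < u\<close>] e] .
    then obtain a where a: "a < u" "\<And>v. a < v \<Longrightarrow> v < u \<Longrightarrow> \<bar>w v - (w u - jump w u)\<bar> < e"
      unfolding eventually_at_left_field dist_real_def by auto
    show ?thesis
    proof (rule that[of "min (b - u) (u - a)"])
      show "\<bar>w v - w u\<bar> < e" if "u \<le> v" "v < u + min (b - u) (u - a)" for v
        using that b e by (cases "v = u") auto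
    qed (use a b in auto)
  qed
qed

text \<open>The left limit inherits the bound from the values before \<open>v\<close>, so both it
  and \<open>w v\<close> lie within \<open>e\<close> of \<open>c\<close>.\<close>

lemma abs_jump_le:
  assumes w: "cadlag w" and "0 \<le> a" "a < v" "v < b"
    and osc: "\<And>x. a < x \<Longrightarrow> x < b \<Longrightarrow> \<bar>w x - c\<bar> \<le> e"
  shows "\<bar>jump w v\<bar> \<le> 2 * e"
proof -
  have lim: "(w \<longlongrightarrow> w v - jump w v) (at_left v)"
    using cadlag_at_left[OF w] assms by simp
  have "\<forall>\<^sub>F x in at_left v. \<bar>w x - c\<bar> \<le> e"
    unfolding eventually_at_left_field using assms by (intro exI[of _ a]) auto
  then have "\<bar>w v - jump w v - c\<bar> \<le> e"
    by (intro tendsto_upperbound[OF tendsto_rabs[OF tendsto_diff[OF lim tendsto_const]]]) auto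
  moreover have "\<bar>w v - c\<bar> \<le> e" using assms by simp
  ultimately show ?thesis by linarith
qed

text \<open>Bisection: finiteness is additive over adjacent intervals, and near any \<open>u\<close>
  the path oscillates so little on either side that only \<open>u\<close> itself can carry a jump of
  size \<open>d\<close>.\<close>

lemma finite_big_jumps:
  assumes w: "cadlag w" and d: "0 < d"
  shows "finite {s\<in>{0<..K}. d \<le> \<bar>jump w s\<bar>}"
proof (cases "0 \<le> K")
  case True
  let ?F = "\<lambda>a b. finite {s\<in>{a<..b}. d \<le> \<bar>jump w s\<bar>}"
  \<comment> \<open>The restriction to subintervals of \<open>{0..K}\<close> is part of
    \<open>P\<close>, since the local step of \<open>Bolzano\<close> also meets intervals that stick
    out.\<close>
  define P where "P a b \<longleftrightarrow> (0 \<le> a \<and> a \<le> b \<and> b \<le> K \<longrightarrow> ?F a b)" for a b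
  from True have "P 0 K"
  proof (induction rule: Bolzano)
    case (trans a b c)
    have "{s\<in>{a<..c}. d \<le> \<bar>jump w s\<bar>} \<subseteq>
        {s\<in>{a<..b}. d \<le> \<bar>jump w s\<bar>} \<union> {s\<in>{b<..c}. d \<le> \<bar>jump w s\<bar>}" by auto
    then show ?case using trans by (auto simp: P_def intro: finite_subset)
  next
    case (local u)
    obtain \<eta> where \<eta>: "0 < \<eta>" "\<And>v. u \<le> v \<Longrightarrow> v < u + \<eta> \<Longrightarrow> \<bar>w v - w u\<bar> < d/4"
      "\<And>v. 0 \<le> v \<Longrightarrow> u - \<eta> < v \<Longrightarrow> v < u \<Longrightarrow> \<bar>w v - (w u - jump w u)\<bar> < d/4"
      using cadlag_near[OF w, of u "d/4"] local d by auto
    have small: "\<bar>jump w v\<bar> < d" if "v \<noteq> u" "u - \<eta> < v" "v < u + \<eta>" "0 < v" for v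
    proof (cases "v < u")
      case True
      then have "\<bar>jump w v\<bar> \<le> 2 * (d/4)"
        using that \<eta>(3) by (intro abs_jump_le[OF w, of "max 0 (u - \<eta>)" _ u "w u - jump w u"]) (auto intro: less_imp_le)
      with d show ?thesis by simp
    next
      case False
      then have "\<bar>jump w v\<bar> \<le> 2 * (d/4)"
        using that \<eta>(2) local by (intro abs_jump_le[OF w, of u _ "u + \<eta>" "w u"]) (auto intro: less_imp_le)
      with d show ?thesis by simp
    qed
    show ?case
      unfolding P_def
    proof (intro exI[of _ \<eta>] conjI allI impI \<eta>(1))
      fix a b assume ab: "a \<le> u \<and> u \<le> b \<and> b - a < \<eta>" "0 \<le> a \<and> a \<le> b \<and> b \<le> K"
      have "s = u" if "s \<in> {a<..b}" "d \<le> \<bar>jump w s\<bar>" for s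
        using small[of s] that ab by force
      then have "{s\<in>{a<..b}. d \<le> \<bar>jump w s\<bar>} \<subseteq> {u}" by auto
      then show "?F a b" by (rule finite_subset) simp
    qed
  qed
  then show ?thesis using True by (simp add: P_def)
qed simp

text \<open>By compactness, ever shorter counterexamples would accumulate at some \<open>u\<close>.
  If the interval lies on one side of \<open>u\<close>, both of its end values are close to the same
  one-sided limit. If it straddles \<open>u\<close>, its increment is within \<open>d\<close> of the
  jump at \<open>u\<close>, which by hypothesis exceeds \<open>-d\<close>.\<close>

lemma small_increments:
  assumes w: "cadlag w" and d: "0 < d"
  obtains \<delta> where "0 < \<delta>"
    "\<And>a b. 0 \<le> a \<Longrightarrow> a < b \<Longrightarrow> b \<le> K \<Longrightarrow> b - a < \<delta> \<Longrightarrow>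
      (\<And>s. a < s \<Longrightarrow> s \<le> b \<Longrightarrow> -d < jump w s) \<Longrightarrow> -(2*d) < w b - w a"
proof -
  let ?Q = "\<lambda>a b. 0 \<le> a \<and> a < b \<and> b \<le> K \<and> (\<forall>s. a < s \<and> s \<le> b \<longrightarrow> -d < jump w s) \<and> w b - w a \<le> -(2*d)"
  have "\<exists>\<delta>>0. \<forall>a b. b - a < \<delta> \<longrightarrow> \<not> ?Q a b"
  proof (rule ccontr)
    assume "\<not> ?thesis"
    then have "\<forall>n::nat. \<exists>a b. b - a < 1 / Suc n \<and> ?Q a b"
      by (metis of_nat_0_less_iff zero_less_Suc zero_less_divide_1_iff)
    then obtain a b where ab: "\<And>n::nat. b n - a n < 1 / Suc n" "\<And>n. ?Q (a n) (b n)" by metis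
    have "seq_compact {0..K}" by (simp add: compact_imp_seq_compact)
    moreover have "\<forall>n. a n \<in> {0..K}"
      using ab(2) by (meson atLeastAtMost_iff less_imp_le order_trans)
    ultimately obtain u r where u: "u \<in> {0..K}" "strict_mono (r::nat\<Rightarrow>nat)" "(a \<circ> r) \<longlonglongrightarrow> u"
      unfolding seq_compact_def by blast
    obtain \<eta> where \<eta>: "0 < \<eta>" "\<And>v. u \<le> v \<Longrightarrow> v < u + \<eta> \<Longrightarrow> \<bar>w v - w u\<bar> < d/2"
      "\<And>v. 0 \<le> v \<Longrightarrow> u - \<eta> < v \<Longrightarrow> v < u \<Longrightarrow> \<bar>w v - (w u - jump w u)\<bar> < d/2"
      using cadlag_near[OF w, of u "d/2"] u d by auto
    have "\<forall>\<^sub>F n in sequentially. dist (a (r n)) u < \<eta>/2"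
      using tendstoD[OF u(3), of "\<eta>/2"] \<eta> by simp
    moreover have "(\<lambda>n. 1 / real (Suc n)) \<longlonglongrightarrow> 0"
      by (rule LIMSEQ_Suc[OF lim_1_over_n])
    then have "\<forall>\<^sub>F n in sequentially. dist (1 / real (Suc n)) 0 < \<eta>/2"
      by (rule tendstoD) (use \<eta>(1) in simp)
    ultimately obtain n where n: "dist (a (r n)) u < \<eta>/2" "1 / real (Suc n) < \<eta>/2"
      using eventually_happens[OF eventually_conj]
      by (metis (no_types, lifting) abs_ge_self dist_real_def diff_zero order.strict_trans1 sequentially_bot)
    have "1 / real (Suc (r n)) \<le> 1 / real (Suc n)"
      using seq_suble[OF u(2), of n] by (simp add: divide_simps)
    then have B: "b (r n) - a (r n) < \<eta>/2" using ab(1)[of "r n"] n by linarith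
    have A: "\<bar>a (r n) - u\<bar> < \<eta>/2" using n by (simp add: dist_real_def)
    note Q = ab(2)[of "r n"]
    consider "u \<le> a (r n)" | "b (r n) < u" | "a (r n) < u" "u \<le> b (r n)" by linarith
    then have "-(2*d) < w (b (r n)) - w (a (r n))"
    proof cases
      case 1
      have "\<bar>w (a (r n)) - w u\<bar> < d/2" by (rule \<eta>(2)) (use 1 A \<eta>(1) in linarith)+
      moreover have "\<bar>w (b (r n)) - w u\<bar> < d/2" by (rule \<eta>(2)) (use 1 A B Q \<eta>(1) in linarith)+
      ultimately show ?thesis using d by linarith
    next
      case 2
      have "\<bar>w (a (r n)) - (w u - jump w u)\<bar> < d/2" by (rule \<eta>(3)) (use 2 A Q \<eta>(1) in linarith)+
      moreover have "\<bar>w (b (r n)) - (w u - jump w u)\<bar> < d/2" by (rule \<eta>(3)) (use 2 A Q \<eta>(1) in linarith)+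
      ultimately show ?thesis using d by linarith
    next
      case 3
      then have "-d < jump w u" using Q by simp
      moreover have "\<bar>w (a (r n)) - (w u - jump w u)\<bar> < d/2" by (rule \<eta>(3)) (use 3 A Q \<eta>(1) in linarith)+
      moreover have "\<bar>w (b (r n)) - w u\<bar> < d/2" by (rule \<eta>(2)) (use 3 A B \<eta>(1) in linarith)+
      ultimately show ?thesis using d by linarith
    qed
    with Q show False by simp
  qed
  then show ?thesis using that by (metis not_le)
qed

subsection \<open>Dyadic cells\<close>

text \<open>Cells are open on the left and closed on the right. The left end of the cell of
  \<open>s\<close> therefore tends to \<open>s\<close> strictly from below and the right end from
  above, so that the increment over the cell tends to the jump at \<open>s\<close> even if
  \<open>s\<close> is dyadic.\<close>

definition cell :: "nat \<Rightarrow> real \<Rightarrow> nat" where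
  "cell n s = nat (\<lceil>s * 2 ^ n\<rceil> - 1)"

definition dy :: "nat \<Rightarrow> nat \<Rightarrow> real" where
  "dy n k = real k / 2 ^ n"

lemma dy_nonneg [simp]: "0 \<le> dy n k" by (simp add: dy_def)

lemma dy_0 [simp]: "dy n 0 = 0" by (simp add: dy_def)

lemma dy_Suc: "dy n (Suc k) = dy n k + 1 / 2 ^ n"
  by (simp add: dy_def add_divide_distrib)

lemma dy_le_iff [simp]: "dy n k \<le> dy n l \<longleftrightarrow> k \<le> l"
  by (simp add: dy_def divide_le_cancel)

lemma dy_less_iff [simp]: "dy n k < dy n l \<longleftrightarrow> k < l"
  by (simp add: dy_def divide_less_cancel)

lemma dy_refine: "m \<le> n \<Longrightarrow> dy m i = dy n (i * 2 ^ (n - m))"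
  by (simp add: dy_def field_simps flip: power_add)

lemma cell_bounds:
  assumes "0 < s"
  shows "dy n (cell n s) < s" "s \<le> dy n (Suc (cell n s))"
proof -
  have "0 < \<lceil>s * 2 ^ n\<rceil>" using assms by simp
  then have c: "real (cell n s) = of_int \<lceil>s * 2 ^ n\<rceil> - 1"
    unfolding cell_def by simp
  show "dy n (cell n s) < s" "s \<le> dy n (Suc (cell n s))"
    unfolding dy_def of_nat_Suc c by (simp_all add: field_simps) linarith+
qed

lemma cell_eqI:
  assumes "dy n k < s" "s \<le> dy n (Suc k)"
  shows "cell n s = k"
proof -
  have "\<lceil>s * 2 ^ n\<rceil> = int k + 1"
    using assms by (intro ceiling_unique) (simp_all add: dy_def field_simps)
  then show ?thesis by (simp add: cell_def)
qed

lemma cell_less_iff: "0 < s \<Longrightarrow> k \<le> cell n s \<longleftrightarrow> dy n k < s"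
  using cell_bounds[of s n]
  by (metis dy_le_iff less_eq_Suc_le linorder_not_less order.strict_trans1 order_le_less_trans)

lemma half_power_tendsto: "(\<lambda>n. 1 / 2 ^ n :: real) \<longlonglongrightarrow> 0"
  using LIMSEQ_realpow_zero[of "1/2::real"] by (simp add: power_divide)

lemma dy_cell_tendsto:
  assumes "0 < s"
  shows "(\<lambda>n. dy n (cell n s)) \<longlonglongrightarrow> s" "(\<lambda>n. dy n (Suc (cell n s))) \<longlonglongrightarrow> s"
proof -
  have 1: "s - 1 / 2 ^ n \<le> dy n (cell n s)" for n
    using cell_bounds[OF assms, of n] by (simp add: dy_Suc)
  have 2: "dy n (Suc (cell n s)) \<le> s + 1 / 2 ^ n" for n
    using cell_bounds[OF assms, of n] by (simp add: dy_Suc)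
  have "(\<lambda>n. s - 1 / 2 ^ n) \<longlonglongrightarrow> s - 0" "(\<lambda>n. s + 1 / 2 ^ n) \<longlonglongrightarrow> s + 0"
    by (intro tendsto_intros half_power_tendsto)+
  then have lims: "(\<lambda>n. s - 1 / 2 ^ n) \<longlonglongrightarrow> s" "(\<lambda>n. s + 1 / 2 ^ n) \<longlonglongrightarrow> s"
    by simp_all
  show "(\<lambda>n. dy n (cell n s)) \<longlonglongrightarrow> s"
    by (rule tendsto_sandwich[OF always_eventually always_eventually lims(1) tendsto_const])
       (use 1 cell_bounds[OF assms] in \<open>auto simp: less_imp_le\<close>)
  show "(\<lambda>n. dy n (Suc (cell n s))) \<longlonglongrightarrow> s"
    by (rule tendsto_sandwich[OF always_eventually always_eventually tendsto_const lims(2)])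
       (use 2 cell_bounds[OF assms] in auto)
qed

lemma cadlag_tendsto_left:
  assumes "cadlag w" "0 < s" "a \<longlonglongrightarrow> s" "\<And>n. a n < s"
  shows "(\<lambda>n. w (a n)) \<longlonglongrightarrow> w s - jump w s"
  by (rule filterlim_compose[OF cadlag_at_left[OF assms(1,2)]])
     (use assms in \<open>auto simp: filterlim_at less_imp_neq\<close>)

lemma cadlag_tendsto_right:
  assumes "cadlag w" "0 \<le> s" "a \<longlonglongrightarrow> s" "\<And>n. s \<le> a n"
  shows "(\<lambda>n. w (a n)) \<longlonglongrightarrow> w s"
proof (rule metric_LIMSEQ_I)
  fix e :: real assume "0 < e"
  then obtain \<eta> where \<eta>: "0 < \<eta>" "\<And>v. s \<le> v \<Longrightarrow> v < s + \<eta> \<Longrightarrow> \<bar>w v - w s\<bar> < e"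
    using cadlag_near[OF assms(1,2)] by metis
  obtain N where "\<And>n. n \<ge> N \<Longrightarrow> dist (a n) s < \<eta>"
    using metric_LIMSEQ_D[OF assms(3) \<eta>(1)] by auto
  then have "s \<le> a n \<and> a n < s + \<eta>" if "n \<ge> N" for n
    using assms(4)[of n] that by (simp add: dist_real_def abs_less_iff) (metis add.commute diff_less_eq)
  then show "\<exists>N. \<forall>n\<ge>N. dist (w (a n)) (w s) < e"
    using \<eta>(2) by (intro exI[of _ N]) (simp add: dist_real_def)
qed

lemma cell_increment_tendsto:
  assumes "cadlag w" "0 < s"
  shows "(\<lambda>n. w (dy n (Suc (cell n s))) - w (dy n (cell n s))) \<longlonglongrightarrow> jump w s"
proof -
  have "(\<lambda>n. w (dy n (Suc (cell n s))) - w (dy n (cell n s))) \<longlonglongrightarrow> w s - (w s - jump w s)"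
    by (intro tendsto_diff cadlag_tendsto_right[OF assms(1)] cadlag_tendsto_left[OF assms]
          dy_cell_tendsto assms cell_bounds) (use assms in auto)
  then show ?thesis by simp
qed

text \<open>Two times in a common cell are less than one mesh apart. Applied to the finitely many
  large jumps, this leaves at most one of them in each cell.\<close>

lemma cell_inj_eventually:
  assumes "finite J" "J \<subseteq> {0<..}"
  shows "\<forall>\<^sub>F n in sequentially. inj_on (cell n) J"
proof -
  have "\<forall>\<^sub>F n in sequentially. \<forall>p\<in>J \<times> J. fst p \<noteq> snd p \<longrightarrow> cell n (fst p) \<noteq> cell n (snd p)"
  proof (intro eventually_ball_finite ballI)
    show "finite (J \<times> J)" using assms by simp
    fix p assume p: "p \<in> J \<times> J"
    show "\<forall>\<^sub>F n in sequentially. fst p \<noteq> snd p \<longrightarrow> cell n (fst p) \<noteq> cell n (snd p)"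
    proof (cases "fst p = snd p")
      case False
      then have "0 < \<bar>fst p - snd p\<bar>" by simp
      from order_tendstoD(2)[OF half_power_tendsto this]
      show ?thesis
      proof (eventually_elim, intro impI notI)
        fix n assume n: "1 / 2 ^ n < \<bar>fst p - snd p\<bar>" and eq: "cell n (fst p) = cell n (snd p)"
        have "0 < fst p" "0 < snd p" using p assms(2) by auto
        then show False
          using cell_bounds[of "fst p" n] cell_bounds[of "snd p" n] n
          unfolding eq dy_Suc by linarith
      qed
    qed simp
  qed
  then show ?thesis by eventually_elim (auto simp: inj_on_def)
qed

lemma riemann_sum_tendsto:
  fixes \<theta> :: "real \<Rightarrow> real" and g :: "real \<Rightarrow> real"
  assumes w: "cadlag w" and d: "0 < d" and g: "\<And>y. isCont g y" "\<And>y. -d \<le> y \<Longrightarrow> g y = 0"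
    and \<theta>: "\<And>s. 0 < s \<Longrightarrow> s \<le> real K \<Longrightarrow> (\<lambda>n. \<theta>n n (cell n s)) \<longlonglongrightarrow> \<theta> s"
  shows "(\<lambda>n. \<Sum>k<K * 2 ^ n. g (w (dy n (Suc k)) - w (dy n k)) * \<theta>n n k)
    \<longlonglongrightarrow> (\<Sum>s\<in>{s\<in>{0<..real K}. jump w s < -d}. g (jump w s) * \<theta> s)"
proof -
  \<comment> \<open>The threshold \<open>d/2\<close> leaves a margin: on a fine grid a cell that
    contains no time of \<open>J\<close> has an increment above \<open>-d\<close>, where
    \<open>g\<close> vanishes. The additional jumps between \<open>-d\<close> and
    \<open>-(d/2)\<close> do not survive in the limit, as \<open>g\<close> is 0 there.\<close>
  define J where "J = {s\<in>{0<..real K}. jump w s \<le> -(d/2)}"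
  have "finite J"
    unfolding J_def by (rule finite_subset[OF _ finite_big_jumps[OF w, of "d/2" "real K"]]) (use d in auto)
  have J0: "J \<subseteq> {0<..}" by (auto simp: J_def)
  obtain \<delta> where \<delta>: "0 < \<delta>"
    "\<And>a b :: real. 0 \<le> a \<Longrightarrow> a < b \<Longrightarrow> b \<le> K \<Longrightarrow> b - a < \<delta> \<Longrightarrow>
      (\<And>s. a < s \<Longrightarrow> s \<le> b \<Longrightarrow> -(d/2) < jump w s) \<Longrightarrow> -(2*(d/2)) < w b - w a"
    using small_increments[OF w, of "d/2" "real K"] d by (metis half_gt_zero)
  let ?f = "\<lambda>n k. g (w (dy n (Suc k)) - w (dy n k)) * \<theta>n n k"
  have "\<forall>\<^sub>F n in sequentially. (\<Sum>k<K * 2 ^ n. ?f n k) = (\<Sum>s\<in>J. ?f n (cell n s))"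
    using cell_inj_eventually[OF \<open>finite J\<close> J0] order_tendstoD(2)[OF half_power_tendsto \<delta>(1)]
  proof eventually_elim
    fix n assume inj: "inj_on (cell n) J" and n: "1 / 2 ^ n < \<delta>"
    have dyK: "dy n (K * 2 ^ n) = K" by (simp add: dy_def)
    have sub: "cell n ` J \<subseteq> {..<K * 2 ^ n}"
    proof safe
      fix s assume "s \<in> J"
      then have "0 < s" "s \<le> K" by (auto simp: J_def)
      then have "dy n (cell n s) < dy n (K * 2 ^ n)" using cell_bounds(1)[of s n] dyK by linarith
      then show "cell n s < K * 2 ^ n" by simp
    qed
    have zero: "?f n k = 0" if "k \<in> {..<K * 2 ^ n} - cell n ` J" for k
    proof -
      have "-(d/2) < jump w s" if s: "dy n k < s" "s \<le> dy n (Suc k)" for s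
      proof (rule ccontr)
        assume "\<not> ?thesis"
        moreover have "dy n (Suc k) \<le> dy n (K * 2 ^ n)"
          using \<open>k \<in> {..<K * 2 ^ n} - cell n ` J\<close> by (subst dy_le_iff) auto
        moreover have "0 < s" by (rule order.strict_trans1[OF dy_nonneg s(1)])
        ultimately have "s \<in> J" using s dyK unfolding J_def by (auto simp: not_less)
        with cell_eqI[OF s] \<open>k \<in> {..<K * 2 ^ n} - cell n ` J\<close> show False by auto
      qed
      moreover have "dy n (Suc k) \<le> K" using that unfolding dyK[symmetric] by (subst dy_le_iff) auto
      ultimately have "-(2*(d/2)) < w (dy n (Suc k)) - w (dy n k)"
        using n by (intro \<delta>(2)) (auto simp: dy_Suc)
      then show ?thesis using g(2) by simp
    qed
    have "(\<Sum>k<K * 2 ^ n. ?f n k) = (\<Sum>k\<in>cell n ` J. ?f n k)"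
      using sub zero by (intro sum.mono_neutral_right) auto
    also have "\<dots> = (\<Sum>s\<in>J. ?f n (cell n s))"
      by (subst sum.reindex[OF inj]) simp
    finally show "(\<Sum>k<K * 2 ^ n. ?f n k) = (\<Sum>s\<in>J. ?f n (cell n s))" .
  qed
  moreover have "(\<lambda>n. \<Sum>s\<in>J. ?f n (cell n s)) \<longlonglongrightarrow> (\<Sum>s\<in>J. g (jump w s) * \<theta> s)"
    by (intro tendsto_sum tendsto_mult isCont_tendsto_compose[OF g(1)] cell_increment_tendsto[OF w] \<theta>)
       (auto simp: J_def)
  moreover have "(\<Sum>s\<in>J. g (jump w s) * \<theta> s) = (\<Sum>s\<in>{s\<in>{0<..real K}. jump w s < -d}. g (jump w s) * \<theta> s)"
  proof (rule sum.mono_neutral_right[OF \<open>finite J\<close>])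
    show "\<forall>s\<in>J - {s \<in> {0<..real K}. jump w s < - d}. g (jump w s) * \<theta> s = 0"
      using g(2) by (metis (no_types, lifting) DiffE J_def linorder_not_less mem_Collect_eq mult_zero_left)
  qed (use d in \<open>auto simp: J_def\<close>)
  ultimately show ?thesis by (simp add: tendsto_cong)
qed

subsection \<open>Removing a jump\<close>

text \<open>Removal at an arbitrary time, not only at the first passage, so that one can sum over
  all jump times.\<close>

definition drop_jump :: "real \<Rightarrow> (real \<Rightarrow> real) \<Rightarrow> real \<Rightarrow> real" where
  "drop_jump s w u = w u - (if s \<le> u then jump w s else 0)"

lemma cadlag_drop_jump:
  assumes w: "cadlag w"
  shows "cadlag (drop_jump s w)"
  unfolding cadlag_def
proof (intro conjI allI impI)
  fix t :: real assume "0 \<le> t"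
  have "(w \<longlongrightarrow> w t) (at_right t)" using cadlag_at_right[OF w \<open>0 \<le> t\<close>] .
  moreover have "\<forall>\<^sub>F u in at_right t. (s \<le> u) = (s \<le> t)"
  proof (cases "s \<le> t")
    case True
    then show ?thesis unfolding eventually_at_right_field by (intro exI[of _ "t+1"]) auto
  next
    case False
    then show ?thesis unfolding eventually_at_right_field by (intro exI[of _ s]) auto
  qed
  then have "\<forall>\<^sub>F u in at_right t. drop_jump s w u = w u - (if s \<le> t then jump w s else 0)"
    by eventually_elim (simp add: drop_jump_def)
  ultimately show "(drop_jump s w \<longlongrightarrow> drop_jump s w t) (at_right t)"
    unfolding drop_jump_def[of s w t] by (subst tendsto_cong) (auto intro!: tendsto_intros)
next
  fix t :: real assume "0 < t"
  then obtain l where l: "(w \<longlongrightarrow> l) (at_left t)" using w by (auto simp: cadlag_def)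
  have "\<forall>\<^sub>F u in at_left t. (s \<le> u) = (s < t)"
  proof (cases "s < t")
    case True
    then show ?thesis unfolding eventually_at_left_field by (intro exI[of _ s]) auto
  next
    case False
    then show ?thesis unfolding eventually_at_left_field by (intro exI[of _ "t-1"]) auto
  qed
  then have ev: "\<forall>\<^sub>F u in at_left t. drop_jump s w u = w u - (if s < t then jump w s else 0)"
    by eventually_elim (simp add: drop_jump_def)
  show "\<exists>l. (drop_jump s w \<longlongrightarrow> l) (at_left t)"
    by (intro exI[of _ "l - (if s < t then jump w s else 0)"], subst tendsto_cong[OF ev]) (intro tendsto_intros l)
qed

lemma jump_uminus: "cadlag w \<Longrightarrow> jump (\<lambda>s. - w s) t = - jump w t"
  using jump_eqI[OF _ tendsto_minus[OF cadlag_at_left]] by (cases "0 < t") (auto simp: jump_def)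

lemma cadlag_uminus: "cadlag w \<Longrightarrow> cadlag (\<lambda>s. - w s)"
  unfolding cadlag_def using tendsto_minus by blast

lemma jump_add_const: "cadlag w \<Longrightarrow> jump (\<lambda>s. c + w s) t = jump w t"
  using jump_eqI[OF _ tendsto_add[OF tendsto_const cadlag_at_left]] by (cases "0 < t") (auto simp: jump_def)

lemma cadlag_add_const: "cadlag w \<Longrightarrow> cadlag (\<lambda>s. c + w s)"
  unfolding cadlag_def using tendsto_add[OF tendsto_const] by blast

subsection \<open>Convergence of expectations\<close>

text \<open>A second moment bound replaces uniform integrability; the truncations \<open>min (Y n) c\<close> are handled by
  dominated convergence.\<close>

lemma (in prob_space) expectation_tendsto_of_second_moment:
  fixes Y :: "nat \<Rightarrow> 'a \<Rightarrow> real"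
  assumes [measurable]: "\<And>n. Y n \<in> borel_measurable M"
    and nonneg: "\<And>n \<omega>. 0 \<le> Y n \<omega>"
    and lim: "\<And>\<omega>. \<omega> \<in> space M \<Longrightarrow> (\<lambda>n. Y n \<omega>) \<longlonglongrightarrow> Z \<omega>"
    and int: "\<And>n. integrable M (\<lambda>\<omega>. (Y n \<omega>)\<^sup>2)"
    and bound: "\<And>n. expectation (\<lambda>\<omega>. (Y n \<omega>)\<^sup>2) \<le> C"
  shows "integrable M Z" "(\<lambda>n. expectation (Y n)) \<longlonglongrightarrow> expectation Z"
proof -
  have Zm[measurable]: "Z \<in> borel_measurable M"
    by (rule borel_measurable_LIMSEQ_metric[OF _ lim]) auto
  have Z0: "0 \<le> Z \<omega>" if "\<omega> \<in> space M" for \<omega>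
    by (rule tendsto_lowerbound[OF lim[OF that]]) (auto simp: nonneg)
  have C0: "0 \<le> C" by (rule order_trans[OF _ bound[of 0]]) simp
  \<comment> \<open>Fatou's lemma: the limit satisfies the same second moment bound and can be
    truncated in the same way.\<close>
  have "(\<integral>\<^sup>+\<omega>. ennreal ((Z \<omega>)\<^sup>2) \<partial>M) = (\<integral>\<^sup>+\<omega>. liminf (\<lambda>n. ennreal ((Y n \<omega>)\<^sup>2)) \<partial>M)"
    by (intro nn_integral_cong lim_imp_Liminf[symmetric] tendsto_ennrealI tendsto_power lim) auto
  also have "\<dots> \<le> liminf (\<lambda>n. \<integral>\<^sup>+\<omega>. ennreal ((Y n \<omega>)\<^sup>2) \<partial>M)"
    by (intro nn_integral_liminf) auto
  also have "\<dots> \<le> liminf (\<lambda>n. ennreal C)"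
    by (intro Liminf_mono always_eventually allI) (subst nn_integral_eq_integral[OF int], auto intro!: ennreal_leI bound)
  also have "\<dots> = ennreal C" by (simp add: Liminf_const)
  finally have Z2: "(\<integral>\<^sup>+\<omega>. ennreal ((Z \<omega>)\<^sup>2) \<partial>M) \<le> ennreal C" .
  then have Z2i: "integrable M (\<lambda>\<omega>. (Z \<omega>)\<^sup>2)"
    by (intro integrableI_nonneg) (auto intro: le_less_trans)
  have Z2b: "expectation (\<lambda>\<omega>. (Z \<omega>)\<^sup>2) \<le> C"
    using Z2 nn_integral_eq_integral[OF Z2i] C0 by (simp add: ennreal_le_iff)
  have Yi: "integrable M (Y n)" for n
    using square_integrable_imp_integrable[OF _ int] by simp
  show Zi: "integrable M Z"
    using square_integrable_imp_integrable[OF _ Z2i] by simp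
  have trunc: "\<bar>expectation U - expectation (\<lambda>\<omega>. min (U \<omega>) c)\<bar> \<le> C / c"
    if U: "U \<in> borel_measurable M" "integrable M (\<lambda>\<omega>. (U \<omega>)\<^sup>2)" "expectation (\<lambda>\<omega>. (U \<omega>)\<^sup>2) \<le> C"
      "\<And>\<omega>. \<omega> \<in> space M \<Longrightarrow> 0 \<le> U \<omega>" and c: "0 < c" for U c
  proof -
    have Ui: "integrable M U" using square_integrable_imp_integrable[OF U(1,2)] .
    have mi: "integrable M (\<lambda>\<omega>. min (U \<omega>) c)" using Ui by (intro integrable_min) auto
    have "expectation U - expectation (\<lambda>\<omega>. min (U \<omega>) c) = expectation (\<lambda>\<omega>. U \<omega> - min (U \<omega>) c)"
      using Ui mi by simp
    \<comment> \<open>Truncation changes \<open>U\<close> only where it exceeds \<open>c\<close>,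
      and there \<open>U\<close> is at most \<open>U\<^sup>2 / c\<close>.\<close>
    also have "\<dots> \<le> expectation (\<lambda>\<omega>. (U \<omega>)\<^sup>2 / c)"
    proof (rule integral_mono)
      fix \<omega> assume "\<omega> \<in> space M"
      then have U0: "0 \<le> U \<omega>" by (rule U(4))
      show "U \<omega> - min (U \<omega>) c \<le> (U \<omega>)\<^sup>2 / c"
      proof (cases "U \<omega> \<le> c")
        case False
        then have "U \<omega> * c \<le> U \<omega> * U \<omega>" using U0 by (intro mult_left_mono) auto
        then have "U \<omega> \<le> (U \<omega>)\<^sup>2 / c" using c by (simp add: field_simps power2_eq_square)
        then show ?thesis using c False by simp
      qed (use c in simp)
    qed (use Ui mi U in auto)
    also have "\<dots> \<le> C / c" using U(3) c by (simp add: divide_right_mono)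
    finally have "expectation U - expectation (\<lambda>\<omega>. min (U \<omega>) c) \<le> C / c" .
    moreover have "expectation (\<lambda>\<omega>. min (U \<omega>) c) \<le> expectation U"
      by (intro integral_mono mi Ui) auto
    ultimately show ?thesis by simp
  qed
  show "(\<lambda>n. expectation (Y n)) \<longlonglongrightarrow> expectation Z"
  proof (rule LIMSEQ_I)
    fix e :: real assume e: "0 < e"
    \<comment> \<open>Each of the two truncation errors is at most \<open>C / c\<close>, which is
      less than \<open>e / 3\<close>; the summand 1 covers \<open>C = 0\<close>.\<close>
    define c where "c = 4 * (C + 1) / e"
    have c: "0 < c" using C0 e by (simp add: c_def)
    have Cc: "C / c < e / 3"
      using C0 e by (simp add: c_def field_simps) (intro add_nonneg_pos mult_nonneg_nonneg; simp)
    have "(\<lambda>n. expectation (\<lambda>\<omega>. min (Y n \<omega>) c)) \<longlonglongrightarrow> expectation (\<lambda>\<omega>. min (Z \<omega>) c)"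
    proof (rule integral_dominated_convergence[where w="\<lambda>_. c"])
      show "AE \<omega> in M. (\<lambda>n. min (Y n \<omega>) c) \<longlonglongrightarrow> min (Z \<omega>) c"
        by (intro AE_I2 tendsto_intros lim)
      show "AE \<omega> in M. norm (min (Y n \<omega>) c) \<le> c" for n
        using nonneg[of n] c by (simp add: min_def)
    qed auto
    then obtain N where N: "\<And>n. n \<ge> N \<Longrightarrow>
        \<bar>expectation (\<lambda>\<omega>. min (Y n \<omega>) c) - expectation (\<lambda>\<omega>. min (Z \<omega>) c)\<bar> < e / 3"
      using LIMSEQ_D[of _ _ "e/3"] e by (metis real_norm_def zero_less_divide_iff zero_less_numeral)
    show "\<exists>N. \<forall>n\<ge>N. norm (expectation (Y n) - expectation Z) < e"
    proof (intro exI[of _ N] allI impI)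
      fix n assume "n \<ge> N"
      have "\<bar>expectation (Y n) - expectation (\<lambda>\<omega>. min (Y n \<omega>) c)\<bar> \<le> C / c"
        by (rule trunc) (use int bound nonneg c in auto)
      moreover have "\<bar>expectation Z - expectation (\<lambda>\<omega>. min (Z \<omega>) c)\<bar> \<le> C / c"
        by (rule trunc) (use Z0 Z2i Z2b c in auto)
      ultimately show "norm (expectation (Y n) - expectation Z) < e"
        using N[OF \<open>n \<ge> N\<close>] Cc unfolding real_norm_def by linarith
    qed
  qed
qed

subsection \<open>Sums over the cells of a grid\<close>

text \<open>The path properties hold for every \<open>\<omega>\<close>, so that jump sums can be
  evaluated pointwise; the exceptional null set is dealt with at the end, in
  \<open>regular_version\<close>. The starting point is part of the process.\<close>

locale levy_paths = prob_space M
  for M :: "'a measure" and X :: "real \<Rightarrow> 'a \<Rightarrow> real" and x :: real +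
  assumes rv [measurable]: "t \<ge> 0 \<Longrightarrow> X t \<in> borel_measurable M"
    and start: "\<And>\<omega>. X 0 \<omega> = x"
    and paths: "\<And>\<omega>. cadlag (\<lambda>t. X t \<omega>)"
    and stationary: "s \<ge> 0 \<Longrightarrow> h \<ge> 0 \<Longrightarrow>
          distr M borel (\<lambda>\<omega>. X (s + h) \<omega> - X s \<omega>) = distr M borel (\<lambda>\<omega>. X h \<omega> - X 0 \<omega>)"
    and independent: "\<And>(n::nat) t. 0 \<le> t 0 \<Longrightarrow> (\<And>i. i < n \<Longrightarrow> t i \<le> t (Suc i)) \<Longrightarrow>
          indep_vars (\<lambda>_. borel) (\<lambda>i \<omega>. X (t (Suc i)) \<omega> - X (t i) \<omega>) {..<n}"
begin

definition incr :: "nat \<Rightarrow> nat \<Rightarrow> 'a \<Rightarrow> real" where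
  "incr n k \<omega> = X (dy n (Suc k)) \<omega> - X (dy n k) \<omega>"

definition jumps :: "real \<Rightarrow> real \<Rightarrow> 'a \<Rightarrow> real set" where
  "jumps d K \<omega> = {s\<in>{0<..K}. jump (\<lambda>t. X t \<omega>) s < -d}"

lemma incr_measurable [measurable]: "incr n k \<in> borel_measurable M"
  unfolding incr_def by (intro borel_measurable_diff rv) auto

lemma incr_distr: "distr M borel (incr n k) = distr M borel (incr n 0)"
  using stationary[of "dy n k" "1 / 2 ^ n"]
  by (simp add: incr_def[abs_def] dy_Suc)

lemma incr_indep: "indep_vars (\<lambda>_. borel) (incr n) {..<N}"
  unfolding incr_def[abs_def] by (rule independent) auto

lemma incr_expectation:
  fixes g :: "real \<Rightarrow> real"
  assumes [measurable]: "g \<in> borel_measurable borel"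
  shows "expectation (\<lambda>\<omega>. g (incr n k \<omega>)) = expectation (\<lambda>\<omega>. g (incr n 0 \<omega>))"
  using integral_distr[of "incr n k" M borel g] integral_distr[of "incr n 0" M borel g]
  by (simp add: incr_distr[of n k])

lemma X_eq_sum_incr: "X (dy n i) \<omega> = x + (\<Sum>k<i. incr n k \<omega>)"
  by (induction i) (simp_all add: start incr_def)

lemma finite_jumps: "0 < d \<Longrightarrow> finite (jumps d K \<omega>)"
  unfolding jumps_def
  by (rule finite_subset[OF _ finite_big_jumps[OF paths[of \<omega>]]]) auto

lemma expectation_prod_incr:
  fixes g :: "real \<Rightarrow> real"
  assumes [measurable]: "g \<in> borel_measurable borel" and b: "\<And>y. \<bar>g y\<bar> \<le> B"
  shows "expectation (\<lambda>\<omega>. \<Prod>k<N. g (incr n k \<omega>)) = expectation (\<lambda>\<omega>. g (incr n 0 \<omega>)) ^ N"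
    "integrable M (\<lambda>\<omega>. \<Prod>k<N. g (incr n k \<omega>))"
proof -
  have ind: "indep_vars (\<lambda>_. borel) (\<lambda>k \<omega>. g (incr n k \<omega>)) {..<N}"
    by (rule indep_vars_compose2[OF incr_indep]) simp
  have int: "integrable M (\<lambda>\<omega>. g (incr n k \<omega>))" for k
    by (rule integrable_const_bound[where B=B]) (auto simp: b)
  have "expectation (\<lambda>\<omega>. \<Prod>k<N. g (incr n k \<omega>)) = (\<Prod>k<N. expectation (\<lambda>\<omega>. g (incr n k \<omega>)))"
    by (rule indep_vars_lebesgue_integral[OF _ ind int]) simp
  also have "\<dots> = (\<Prod>k<N. expectation (\<lambda>\<omega>. g (incr n 0 \<omega>)))"
    by (subst incr_expectation) simp_all
  finally show "expectation (\<lambda>\<omega>. \<Prod>k<N. g (incr n k \<omega>)) = expectation (\<lambda>\<omega>. g (incr n 0 \<omega>)) ^ N" by simp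
  show "integrable M (\<lambda>\<omega>. \<Prod>k<N. g (incr n k \<omega>))"
    by (rule indep_vars_integrable[OF _ ind int]) simp
qed

end

section \<open>Moment bounds for test functions of the large downward jumps\<close>

locale jump_test = levy_paths +
  fixes g :: "real \<Rightarrow> real" and d :: real
  assumes g_cont: "\<And>y. isCont g y" and g0: "\<And>y. 0 \<le> g y" and g1: "\<And>y. g y \<le> 1"
    and d: "0 < d" and g_supp: "\<And>y. -d \<le> y \<Longrightarrow> g y = 0"
begin

lemma g_measurable [measurable]: "g \<in> borel_measurable borel"
  using g_cont by (intro borel_measurable_continuous_onI) (simp add: continuous_at_imp_continuous_on)

definition p :: "nat \<Rightarrow> real" where
  "p n = expectation (\<lambda>\<omega>. g (incr n 0 \<omega>))"

lemma p_nonneg: "0 \<le> p n"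
  unfolding p_def by (simp add: g0)

lemma g_incr_integrable [simp]: "integrable M (\<lambda>\<omega>. g (incr n k \<omega>))"
  by (rule integrable_const_bound[where B=1]) (auto simp: g0 g1)

text \<open>The number of large jumps has a finite mean: with \<open>S\<close> the sum over the jumps, \<open>E exp (-S) > 0\<close> is the
  limit of the \<open>K * 2^n\<close>-th powers of \<open>E exp (- g (incr n 0))\<close>.\<close>

lemma mean_sum_bounded: "\<exists>C. \<forall>n. real (K * 2 ^ n) * p n \<le> C"
proof -
  let ?R = "\<lambda>n \<omega>. \<Sum>k<K * 2 ^ n. g (incr n k \<omega>)"
  define S where "S \<omega> = (\<Sum>s\<in>jumps d K \<omega>. g (jump (\<lambda>t. X t \<omega>) s))" for \<omega>
  have lim: "(\<lambda>n. ?R n \<omega>) \<longlonglongrightarrow> S \<omega>" for \<omega>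
    using riemann_sum_tendsto[OF paths d g_cont g_supp, where \<theta>n="\<lambda>_ _. 1" and \<theta>="\<lambda>_. 1", of K \<omega>]
    by (simp add: incr_def S_def jumps_def)
  have [measurable]: "S \<in> borel_measurable M"
    by (rule borel_measurable_LIMSEQ_metric[OF _ lim]) measurable
  have S0: "0 \<le> S \<omega>" for \<omega> unfolding S_def by (simp add: sum_nonneg g0)
  have expl: "(\<lambda>n. expectation (\<lambda>\<omega>. exp (- ?R n \<omega>))) \<longlonglongrightarrow> expectation (\<lambda>\<omega>. exp (- S \<omega>))"
    by (rule integral_dominated_convergence[where w="\<lambda>_. 1"])
       (auto intro!: AE_I2 tendsto_intros lim simp: sum_nonneg g0)
  have pos: "0 < expectation (\<lambda>\<omega>. exp (- S \<omega>))"
  proof -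
    have "integrable M (\<lambda>\<omega>. exp (- S \<omega>))"
      by (rule integrable_const_bound[where B=1]) (auto simp: S0)
    then show ?thesis by (rule expectation_greater) simp
  qed
  have le: "expectation (\<lambda>\<omega>. exp (- ?R n \<omega>)) \<le> exp (- (real (K * 2 ^ n) * p n / 2))" for n
  proof -
    have "expectation (\<lambda>\<omega>. exp (- ?R n \<omega>)) = expectation (\<lambda>\<omega>. \<Prod>k<K * 2 ^ n. exp (- g (incr n k \<omega>)))"
      by (simp add: sum_negf[symmetric] exp_sum)
    also have "\<dots> = expectation (\<lambda>\<omega>. exp (- g (incr n 0 \<omega>))) ^ (K * 2 ^ n)"
      by (rule expectation_prod_incr[where B=1]) (auto simp: g0)
    also have "\<dots> \<le> exp (- (p n / 2)) ^ (K * 2 ^ n)"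
    proof (rule power_mono)
      \<comment> \<open>On \<open>[0,1]\<close>,
        \<open>exp (-y) \<le> 1 / (1 + y) \<le> 1 - y / 2\<close>; only the order of magnitude of
        the mean matters.\<close>
      have "expectation (\<lambda>\<omega>. exp (- g (incr n 0 \<omega>))) \<le> expectation (\<lambda>\<omega>. 1 - g (incr n 0 \<omega>) / 2)"
      proof (rule integral_mono)
        show "integrable M (\<lambda>\<omega>. exp (- g (incr n 0 \<omega>)))"
          by (rule integrable_const_bound[where B=1]) (auto simp: g0)
        fix \<omega>
        let ?y = "g (incr n 0 \<omega>)"
        have y: "0 \<le> ?y" "?y \<le> 1" by (auto simp: g0 g1)
        have "inverse (exp ?y) \<le> inverse (1 + ?y)"
          using exp_ge_add_one_self[of ?y] y by (intro le_imp_inverse_le) auto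
        also have "\<dots> \<le> 1 - ?y / 2"
        proof -
          have "1 \<le> (1 - ?y / 2) * (1 + ?y)"
            using mult_nonneg_nonneg[of ?y "1 - ?y"] y by (simp add: algebra_simps)
          then show ?thesis using y by (simp add: divide_simps)
        qed
        finally show "exp (- ?y) \<le> 1 - ?y / 2" by (simp add: exp_minus)
      qed simp
      also have "\<dots> = 1 - p n / 2" by (simp add: p_def prob_space)
      also have "\<dots> \<le> exp (- (p n / 2))" using exp_ge_add_one_self[of "-(p n / 2)"] by simp
      finally show "expectation (\<lambda>\<omega>. exp (- g (incr n 0 \<omega>))) \<le> exp (- (p n / 2))" .
    qed simp
    also have "\<dots> = exp (- (real (K * 2 ^ n) * p n / 2))"
      by (simp flip: exp_of_nat_mult)
    finally show ?thesis .
  qed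
  \<comment> \<open>Half of the positive limit, hence eventually a lower bound for the expectations;
    taking logarithms in \<open>le\<close> then bounds the mean.\<close>
  define \<alpha> where "\<alpha> = expectation (\<lambda>\<omega>. exp (- S \<omega>)) / 2"
  have \<alpha>: "0 < \<alpha>" using pos by (simp add: \<alpha>_def)
  have "\<forall>\<^sub>F n in sequentially. \<alpha> < expectation (\<lambda>\<omega>. exp (- ?R n \<omega>))"
    using order_tendstoD(1)[OF expl, of \<alpha>] pos by (simp add: \<alpha>_def)
  then have "\<forall>\<^sub>F n in sequentially. real (K * 2 ^ n) * p n \<le> - 2 * ln \<alpha>"
  proof eventually_elim
    fix n assume "\<alpha> < expectation (\<lambda>\<omega>. exp (- ?R n \<omega>))"
    then have "\<alpha> < exp (- (real (K * 2 ^ n) * p n / 2))" using le[of n] by linarith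
    then have "ln \<alpha> < - (real (K * 2 ^ n) * p n / 2)" using \<alpha> by (metis exp_less_cancel_iff exp_ln)
    then show "real (K * 2 ^ n) * p n \<le> - 2 * ln \<alpha>" by simp
  qed
  then obtain N where N: "\<And>n. n \<ge> N \<Longrightarrow> real (K * 2 ^ n) * p n \<le> - 2 * ln \<alpha>"
    by (auto simp: eventually_sequentially)
  show ?thesis
  proof (intro exI allI)
    fix n
    show "real (K * 2 ^ n) * p n \<le> max (- 2 * ln \<alpha>) (Max ((\<lambda>n. real (K * 2 ^ n) * p n) ` {..N}))"
    proof (cases "n \<ge> N")
      case True
      then show ?thesis using N[of n] by simp
    next
      case False
      then show ?thesis by (intro max.coboundedI2 Max_ge) auto
    qed
  qed
qed

text \<open>A square is at most \<open>2 * exp\<close>, and independence turns the exponential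
  moment into a power. Since \<open>exp y \<le> 1 + 2 * y\<close> on \<open>[0,1]\<close>, this
  power is controlled by the mean, which is bounded by the preceding lemma.\<close>

lemma sum_second_moment_bounded:
  "\<exists>C. \<forall>n. integrable M (\<lambda>\<omega>. (\<Sum>k<K * 2 ^ n. g (incr n k \<omega>))\<^sup>2) \<and>
     expectation (\<lambda>\<omega>. (\<Sum>k<K * 2 ^ n. g (incr n k \<omega>))\<^sup>2) \<le> C"
proof -
  let ?R = "\<lambda>n \<omega>. \<Sum>k<K * 2 ^ n. g (incr n k \<omega>)"
  obtain C where C: "\<And>n. real (K * 2 ^ n) * p n \<le> C" using mean_sum_bounded by blast
  have R: "integrable M (\<lambda>\<omega>. (?R n \<omega>)\<^sup>2) \<and> expectation (\<lambda>\<omega>. (?R n \<omega>)\<^sup>2) \<le> 2 * exp (2 * C)" for n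
  proof -
    have sq: "(?R n \<omega>)\<^sup>2 \<le> 2 * exp (?R n \<omega>)" for \<omega>
    proof -
      have "0 \<le> ?R n \<omega>" by (simp add: sum_nonneg g0)
      then show ?thesis using exp_lower_Taylor_quadratic[of "?R n \<omega>"] by linarith
    qed
    have ex: "(\<lambda>\<omega>. exp (?R n \<omega>)) = (\<lambda>\<omega>. \<Prod>k<K * 2 ^ n. exp (g (incr n k \<omega>)))"
      by (simp add: exp_sum)
    have m: "(\<lambda>y. exp (g y)) \<in> borel_measurable borel" "\<And>y. \<bar>exp (g y)\<bar> \<le> exp 1"
      by (auto simp: g1)
    have ei: "integrable M (\<lambda>\<omega>. exp (?R n \<omega>))"
      unfolding ex by (rule expectation_prod_incr(2)[OF m])
    have Ri: "integrable M (\<lambda>\<omega>. (?R n \<omega>)\<^sup>2)"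
      by (rule Bochner_Integration.integrable_bound[OF integrable_mult_right[OF ei, of 2]]) (auto simp: sq)
    have "expectation (\<lambda>\<omega>. (?R n \<omega>)\<^sup>2) \<le> expectation (\<lambda>\<omega>. 2 * exp (?R n \<omega>))"
      by (intro integral_mono Ri integrable_mult_right ei sq)
    also have "\<dots> = 2 * expectation (\<lambda>\<omega>. \<Prod>k<K * 2 ^ n. exp (g (incr n k \<omega>)))"
      by (simp add: exp_sum)
    also have "\<dots> = 2 * expectation (\<lambda>\<omega>. exp (g (incr n 0 \<omega>))) ^ (K * 2 ^ n)"
      by (simp only: expectation_prod_incr(1)[OF m])
    also have "\<dots> \<le> 2 * exp (2 * p n) ^ (K * 2 ^ n)"
    proof (intro mult_left_mono power_mono)
      have "expectation (\<lambda>\<omega>. exp (g (incr n 0 \<omega>))) \<le> expectation (\<lambda>\<omega>. 1 + 2 * g (incr n 0 \<omega>))"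
      proof (rule integral_mono)
        show "integrable M (\<lambda>\<omega>. exp (g (incr n 0 \<omega>)))"
          by (rule integrable_const_bound[where B="exp 1"]) (auto simp: g1)
        fix \<omega>
        let ?y = "g (incr n 0 \<omega>)"
        have y: "0 \<le> ?y" "?y \<le> 1" by (auto simp: g0 g1)
        then have "exp ?y \<le> 1 + ?y + ?y\<^sup>2" by (rule exp_bound)
        also have "?y\<^sup>2 \<le> ?y" using mult_left_mono[of ?y 1 ?y] y by (simp add: power2_eq_square)
        finally show "exp ?y \<le> 1 + 2 * ?y" by simp
      qed simp
      also have "\<dots> = 1 + 2 * p n" by (simp add: p_def prob_space)
      also have "\<dots> \<le> exp (2 * p n)" using exp_ge_add_one_self[of "2 * p n"] by simp
      finally show "expectation (\<lambda>\<omega>. exp (g (incr n 0 \<omega>))) \<le> exp (2 * p n)" .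
    qed simp_all
    also have "\<dots> = 2 * exp (2 * (real (K * 2 ^ n) * p n))"
      by (simp flip: exp_of_nat_mult add: mult_ac)
    also have "\<dots> \<le> 2 * exp (2 * C)" using C[of n] by simp
    finally show ?thesis using Ri by simp
  qed
  then show ?thesis by blast
qed

text \<open>Weights in \<open>[0,1]\<close> keep the grid sum below the unweighted one, so its
  second moments are bounded and the pathwise limit passes to expectations. The weights may depend
  on the path; this is where the path without its increment will enter.\<close>

lemma weighted_sum_expectation_tendsto:
  fixes \<theta>n :: "nat \<Rightarrow> nat \<Rightarrow> 'a \<Rightarrow> real" and \<theta> :: "real \<Rightarrow> 'a \<Rightarrow> real"
  assumes [measurable]: "\<And>n k. \<theta>n n k \<in> borel_measurable M"
    and \<theta>n: "\<And>n k \<omega>. 0 \<le> \<theta>n n k \<omega>" "\<And>n k \<omega>. \<theta>n n k \<omega> \<le> 1"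
    and \<theta>: "\<And>s \<omega>. 0 < s \<Longrightarrow> s \<le> real K \<Longrightarrow> (\<lambda>n. \<theta>n n (cell n s) \<omega>) \<longlonglongrightarrow> \<theta> s \<omega>"
  shows "integrable M (\<lambda>\<omega>. \<Sum>s\<in>jumps d K \<omega>. g (jump (\<lambda>t. X t \<omega>) s) * \<theta> s \<omega>)"
    "(\<lambda>n. \<Sum>k<K * 2 ^ n. expectation (\<lambda>\<omega>. g (incr n k \<omega>) * \<theta>n n k \<omega>))
       \<longlonglongrightarrow> expectation (\<lambda>\<omega>. \<Sum>s\<in>jumps d K \<omega>. g (jump (\<lambda>t. X t \<omega>) s) * \<theta> s \<omega>)"
proof -
  let ?Y = "\<lambda>n \<omega>. \<Sum>k<K * 2 ^ n. g (incr n k \<omega>) * \<theta>n n k \<omega>"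
  let ?R = "\<lambda>n \<omega>. \<Sum>k<K * 2 ^ n. g (incr n k \<omega>)"
  obtain C where C: "\<And>n. integrable M (\<lambda>\<omega>. (?R n \<omega>)\<^sup>2)" "\<And>n. expectation (\<lambda>\<omega>. (?R n \<omega>)\<^sup>2) \<le> C"
    using sum_second_moment_bounded by blast
  have lim: "(\<lambda>n. ?Y n \<omega>) \<longlonglongrightarrow> (\<Sum>s\<in>jumps d K \<omega>. g (jump (\<lambda>t. X t \<omega>) s) * \<theta> s \<omega>)" for \<omega>
    using riemann_sum_tendsto[where w="\<lambda>t. X t \<omega>" and \<theta>n="\<lambda>n k. \<theta>n n k \<omega>" and \<theta>="\<lambda>s. \<theta> s \<omega>",
        OF paths d g_cont g_supp \<theta>, of K]
    by (simp add: incr_def jumps_def)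
  have Y0: "0 \<le> ?Y n \<omega>" for n \<omega> by (intro sum_nonneg mult_nonneg_nonneg g0 \<theta>n)
  have YR: "?Y n \<omega> \<le> ?R n \<omega>" for n \<omega>
    by (intro sum_mono mult_left_le g0 \<theta>n)
  have sq: "(?Y n \<omega>)\<^sup>2 \<le> (?R n \<omega>)\<^sup>2" for n \<omega> by (intro power_mono YR Y0)
  have int: "integrable M (\<lambda>\<omega>. (?Y n \<omega>)\<^sup>2)" for n
    by (rule Bochner_Integration.integrable_bound[OF C(1)[of n]]) (auto simp: sq)
  have bd: "expectation (\<lambda>\<omega>. (?Y n \<omega>)\<^sup>2) \<le> C" for n
    by (rule order_trans[OF integral_mono[OF int C(1) sq] C(2)])
  note * = expectation_tendsto_of_second_moment[of ?Y, OF _ Y0 lim int bd]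
  show "integrable M (\<lambda>\<omega>. \<Sum>s\<in>jumps d K \<omega>. g (jump (\<lambda>t. X t \<omega>) s) * \<theta> s \<omega>)"
    by (rule *(1)) measurable
  have "expectation (?Y n) = (\<Sum>k<K * 2 ^ n. expectation (\<lambda>\<omega>. g (incr n k \<omega>) * \<theta>n n k \<omega>))" for n
  proof (rule Bochner_Integration.integral_sum)
    show "integrable M (\<lambda>\<omega>. g (incr n k \<omega>) * \<theta>n n k \<omega>)" for k
      by (rule integrable_const_bound[where B=1]) (auto simp: g0 g1 \<theta>n abs_mult intro!: mult_le_one)
  qed
  moreover have "(\<lambda>n. expectation (?Y n)) \<longlonglongrightarrow>
      expectation (\<lambda>\<omega>. \<Sum>s\<in>jumps d K \<omega>. g (jump (\<lambda>t. X t \<omega>) s) * \<theta> s \<omega>)"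
    by (rule *(2)) measurable
  ultimately show "(\<lambda>n. \<Sum>k<K * 2 ^ n. expectation (\<lambda>\<omega>. g (incr n k \<omega>) * \<theta>n n k \<omega>))
       \<longlonglongrightarrow> expectation (\<lambda>\<omega>. \<Sum>s\<in>jumps d K \<omega>. g (jump (\<lambda>t. X t \<omega>) s) * \<theta> s \<omega>)"
    by simp
qed

end

text \<open>Coding a path by its values at the dyadic times puts its law on a countable product.\<close>

definition dyp :: "nat \<times> nat \<Rightarrow> real" where
  "dyp q = dy (fst q) (snd q)"

type_synonym code = "nat \<times> nat \<Rightarrow> real"

definition enc :: "(real \<Rightarrow> real) \<Rightarrow> code" where
  "enc w q = w (dyp q)"

abbreviation path_space :: "code measure" where
  "path_space \<equiv> Pi\<^sub>M UNIV (\<lambda>_. borel)"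

abbreviation time_path :: "(real \<times> code) measure" where
  "time_path \<equiv> borel \<Otimes>\<^sub>M path_space"

lemma dyp_nonneg [simp]: "0 \<le> dyp q"
  by (simp add: dyp_def)

lemma dyp_refine: "fst q \<le> n \<Longrightarrow> dyp q = dy n (snd q * 2 ^ (n - fst q))"
  unfolding dyp_def by (rule dy_refine)

section \<open>The path without one increment: independence and limit\<close>

context jump_test
begin

text \<open>The path without its increment over one cell is independent of that increment, and it converges to
  the path without a jump when the cells shrink to the time of that jump.\<close>

definition flat :: "nat \<Rightarrow> nat \<Rightarrow> real \<Rightarrow> 'a \<Rightarrow> real" where
  "flat n k u \<omega> = X u \<omega> - (if dy n (Suc k) \<le> u then incr n k \<omega> else 0)"

lemma flat_measurable [measurable]: "flat n k (dyp q) \<in> borel_measurable M"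
  unfolding flat_def by (intro borel_measurable_diff rv) auto

text \<open>The level of \<open>q\<close> is at most \<open>n\<close>, so \<open>dyp q\<close> is a
  grid point and the value there is a sum of increments, from which the \<open>k\<close>-th is
  deleted.\<close>

lemma flat_eq:
  assumes "fst q \<le> n"
  shows "flat n k (dyp q) \<omega> = x + (\<Sum>l\<in>{..<snd q * 2 ^ (n - fst q)} - {k}. incr n l \<omega>)"
proof -
  let ?N = "snd q * 2 ^ (n - fst q)"
  have "(\<Sum>l<?N. incr n l \<omega>) =
      (\<Sum>l\<in>{..<?N} - {k}. incr n l \<omega>) + (if k < ?N then incr n k \<omega> else 0)"
    by (simp add: sum_diff1)
  then show ?thesis
    unfolding flat_def dyp_refine[OF assms] X_eq_sum_incr by (simp add: Suc_le_eq)
qed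

lemma expectation_g_incr: "expectation (\<lambda>\<omega>. g (incr n k \<omega>)) = p n"
  unfolding p_def by (rule incr_expectation) simp

text \<open>By \<open>flat_eq\<close> the product is a function of the increments with index
  different from \<open>k\<close>. The blocks \<open>{k}\<close> and \<open>?B\<close> are
  independent.\<close>

lemma expectation_flat_factor:
  fixes h :: "nat \<times> nat \<Rightarrow> real \<Rightarrow> real"
  assumes J: "finite J" "\<And>q. q \<in> J \<Longrightarrow> fst q \<le> n"
    and [measurable]: "\<And>q. h q \<in> borel_measurable borel" and h: "\<And>q y. 0 \<le> h q y" "\<And>q y. h q y \<le> 1"
  shows "expectation (\<lambda>\<omega>. g (incr n k \<omega>) * (\<Prod>q\<in>J. h q (flat n k (dyp q) \<omega>)))
    = p n * expectation (\<lambda>\<omega>. \<Prod>q\<in>J. h q (flat n k (dyp q) \<omega>))"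
proof -
  let ?I = "\<lambda>q. {..<snd q * 2 ^ (n - fst q)} - {k}"
  have "finite (insert k (\<Union>q\<in>J. ?I q))" using J by simp
  then obtain N where N: "insert k (\<Union>q\<in>J. ?I q) \<subseteq> {..<N}"
    by (meson finite_nat_set_iff_bounded lessThan_iff subset_iff)
  let ?B = "{..<N} - {k}"
  have sub: "?I q \<subseteq> ?B" if "q \<in> J" for q using N that by auto
  let ?G = "\<lambda>v. \<Prod>q\<in>J. h q (x + (\<Sum>l\<in>?I q. v l))"
  have G: "?G \<in> borel_measurable (PiM ?B (\<lambda>_. borel))"
    using sub by (intro borel_measurable_prod measurable_compose[OF _ assms(3)] borel_measurable_add
        borel_measurable_sum borel_measurable_const measurable_component_singleton) auto
  have ind: "indep_var (PiM {k} (\<lambda>_. borel)) (\<lambda>\<omega>. restrict (\<lambda>i. incr n i \<omega>) {k})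
      (PiM ?B (\<lambda>_. borel)) (\<lambda>\<omega>. restrict (\<lambda>i. incr n i \<omega>) ?B)"
    using N by (intro indep_var_restrict[OF incr_indep]) auto
  have "indep_var borel ((\<lambda>v. g (v k)) \<circ> (\<lambda>\<omega>. restrict (\<lambda>i. incr n i \<omega>) {k}))
      borel (?G \<circ> (\<lambda>\<omega>. restrict (\<lambda>i. incr n i \<omega>) ?B))"
    by (rule indep_var_compose[OF ind _ G]) measurable
  also have "(\<lambda>v. g (v k)) \<circ> (\<lambda>\<omega>. restrict (\<lambda>i. incr n i \<omega>) {k}) = (\<lambda>\<omega>. g (incr n k \<omega>))"
    by (simp add: fun_eq_iff)
  also have "?G \<circ> (\<lambda>\<omega>. restrict (\<lambda>i. incr n i \<omega>) ?B) = (\<lambda>\<omega>. \<Prod>q\<in>J. h q (flat n k (dyp q) \<omega>))"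
  proof (intro ext)
    fix \<omega>
    have "(\<Sum>l\<in>?I q. restrict (\<lambda>i. incr n i \<omega>) ?B l) = (\<Sum>l\<in>?I q. incr n l \<omega>)" if "q \<in> J" for q
      using sub[OF that] by (intro sum.cong) (auto simp: subset_iff)
    then show "(?G \<circ> (\<lambda>\<omega>. restrict (\<lambda>i. incr n i \<omega>) ?B)) \<omega> = (\<Prod>q\<in>J. h q (flat n k (dyp q) \<omega>))"
      using J(2) by (simp add: flat_eq cong: prod.cong)
  qed
  finally have iv: "indep_var borel (\<lambda>\<omega>. g (incr n k \<omega>)) borel (\<lambda>\<omega>. \<Prod>q\<in>J. h q (flat n k (dyp q) \<omega>))" .
  have "integrable M (\<lambda>\<omega>. \<Prod>q\<in>J. h q (flat n k (dyp q) \<omega>))"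
    by (rule integrable_const_bound[where B=1]) (auto simp: abs_prod h intro!: prod_le_1)
  from indep_var_lebesgue_integral[OF iv g_incr_integrable this] show ?thesis
    by (simp add: expectation_g_incr)
qed

text \<open>From the level of \<open>q\<close> on, the cell of \<open>s\<close> ends at or before
  the grid point \<open>dyp q\<close> exactly when \<open>s\<close> does, because cells are closed
  on the right.\<close>

lemma flat_tendsto:
  assumes "0 < s"
  shows "(\<lambda>n. flat n (cell n s) (dyp q) \<omega>) \<longlonglongrightarrow> drop_jump s (\<lambda>t. X t \<omega>) (dyp q)"
proof -
  have "\<forall>\<^sub>F n in sequentially. flat n (cell n s) (dyp q) \<omega> =
      X (dyp q) \<omega> - (if s \<le> dyp q then incr n (cell n s) \<omega> else 0)"
  proof (rule eventually_sequentiallyI[of "fst q"])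
    fix n assume "fst q \<le> n"
    have "dy n (Suc (cell n s)) \<le> dyp q \<longleftrightarrow> s \<le> dyp q"
      unfolding dyp_refine[OF \<open>fst q \<le> n\<close>] dy_le_iff Suc_le_eq not_le[symmetric] cell_less_iff[OF assms]
      by simp
    then show "flat n (cell n s) (dyp q) \<omega> =
      X (dyp q) \<omega> - (if s \<le> dyp q then incr n (cell n s) \<omega> else 0)"
      by (simp add: flat_def)
  qed
  moreover have "(\<lambda>n. X (dyp q) \<omega> - (if s \<le> dyp q then incr n (cell n s) \<omega> else 0))
      \<longlonglongrightarrow> drop_jump s (\<lambda>t. X t \<omega>) (dyp q)"
    unfolding drop_jump_def
    using cell_increment_tendsto[OF paths assms] by (auto simp: incr_def intro!: tendsto_intros)
  ultimately show ?thesis by (simp add: tendsto_cong)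
qed

text \<open>The mean contribution of the jumps per unit of time; by \<open>p_tendsto\<close> it is
  the limit of the rates \<open>2 ^ n * p n\<close>.\<close>

definition jump_mean :: real where
  "jump_mean = expectation (\<lambda>\<omega>. \<Sum>s\<in>jumps d 1 \<omega>. g (jump (\<lambda>t. X t \<omega>) s))"

lemma p_tendsto: "(\<lambda>n. 2 ^ n * p n) \<longlonglongrightarrow> jump_mean"
  using weighted_sum_expectation_tendsto(2)[where K=1 and \<theta>n="\<lambda>_ _ _. 1" and \<theta>="\<lambda>_ _. 1"]
  by (simp add: jump_mean_def expectation_g_incr)

lemma small_increment_tendsto:
  "(\<lambda>n. expectation (\<lambda>\<omega>. min 1 (L * \<bar>incr n 0 \<omega>\<bar>))) \<longlonglongrightarrow> 0" if "0 \<le> L"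
proof -
  have "(\<lambda>n. min 1 (L * \<bar>incr n 0 \<omega>\<bar>)) \<longlonglongrightarrow> min 1 (L * \<bar>X 0 \<omega> - X 0 \<omega>\<bar>)" for \<omega>
    unfolding incr_def dy_0
    using cadlag_tendsto_right[OF paths[of \<omega>], of 0 "\<lambda>n. dy n (Suc 0)"] half_power_tendsto
    by (intro tendsto_intros) (auto simp: dy_Suc)
  then have "(\<lambda>n. expectation (\<lambda>\<omega>. min 1 (L * \<bar>incr n 0 \<omega>\<bar>))) \<longlonglongrightarrow> expectation (\<lambda>\<omega>. 0)"
    using that by (intro integral_dominated_convergence[where w="\<lambda>_. 1"]) auto
  then show ?thesis by simp
qed

text \<open>The two paths differ by at most one increment, whose law does not depend on
  \<open>k\<close>. The error is therefore uniform over the cells, as it has to be: there are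
  \<open>K * 2 ^ n\<close> of them.\<close>

lemma flat_prod_close:
  fixes h :: "nat \<times> nat \<Rightarrow> real \<Rightarrow> real"
  assumes J: "finite J"
    and [measurable]: "\<And>q. h q \<in> borel_measurable borel" and h: "\<And>q y. 0 \<le> h q y" "\<And>q y. h q y \<le> 1"
    and lip: "\<And>q y z. \<bar>h q y - h q z\<bar> \<le> L * \<bar>y - z\<bar>" and L: "0 \<le> L"
  shows "\<bar>expectation (\<lambda>\<omega>. \<Prod>q\<in>J. h q (flat n k (dyp q) \<omega>)) - expectation (\<lambda>\<omega>. \<Prod>q\<in>J. h q (X (dyp q) \<omega>))\<bar>
    \<le> card J * expectation (\<lambda>\<omega>. min 1 (L * \<bar>incr n 0 \<omega>\<bar>))"
proof -
  let ?F = "\<lambda>\<omega>. \<Prod>q\<in>J. h q (flat n k (dyp q) \<omega>)" and ?X = "\<lambda>\<omega>. \<Prod>q\<in>J. h q (X (dyp q) \<omega>)"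
  have i: "integrable M ?F" "integrable M ?X"
    by (rule integrable_const_bound[where B=1], auto simp: abs_prod h intro!: prod_le_1)+
  have m: "integrable M (\<lambda>\<omega>. min 1 (L * \<bar>incr n k \<omega>\<bar>))"
    by (rule integrable_const_bound[where B=1]) (use L in auto)
  have pt: "\<bar>?F \<omega> - ?X \<omega>\<bar> \<le> card J * min 1 (L * \<bar>incr n k \<omega>\<bar>)" for \<omega>
  proof -
    have "\<bar>?F \<omega> - ?X \<omega>\<bar> \<le> (\<Sum>q\<in>J. \<bar>h q (flat n k (dyp q) \<omega>) - h q (X (dyp q) \<omega>)\<bar>)"
      using norm_prod_diff[of J "\<lambda>q. h q (flat n k (dyp q) \<omega>)" "\<lambda>q. h q (X (dyp q) \<omega>)"] h by simp
    also have "\<dots> \<le> (\<Sum>q\<in>J. min 1 (L * \<bar>incr n k \<omega>\<bar>))"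
    proof (rule sum_mono)
      fix q
      have "\<bar>h q (flat n k (dyp q) \<omega>) - h q (X (dyp q) \<omega>)\<bar> \<le> 1"
        using h[of q "flat n k (dyp q) \<omega>"] h[of q "X (dyp q) \<omega>"] by linarith
      moreover have "\<bar>h q (flat n k (dyp q) \<omega>) - h q (X (dyp q) \<omega>)\<bar> \<le> L * \<bar>flat n k (dyp q) \<omega> - X (dyp q) \<omega>\<bar>"
        by (rule lip)
      moreover have "L * \<bar>flat n k (dyp q) \<omega> - X (dyp q) \<omega>\<bar> \<le> L * \<bar>incr n k \<omega>\<bar>"
        using L by (intro mult_left_mono) (simp_all add: flat_def)
      ultimately show "\<bar>h q (flat n k (dyp q) \<omega>) - h q (X (dyp q) \<omega>)\<bar> \<le> min 1 (L * \<bar>incr n k \<omega>\<bar>)" by simp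
    qed
    finally show ?thesis by simp
  qed
  have "\<bar>expectation ?F - expectation ?X\<bar> = \<bar>expectation (\<lambda>\<omega>. ?F \<omega> - ?X \<omega>)\<bar>"
    using i by simp
  also have "\<dots> \<le> expectation (\<lambda>\<omega>. \<bar>?F \<omega> - ?X \<omega>\<bar>)" by (rule integral_abs_bound)
  also have "\<dots> \<le> expectation (\<lambda>\<omega>. card J * min 1 (L * \<bar>incr n k \<omega>\<bar>))"
    using i m by (intro integral_mono pt) auto
  also have "\<dots> = card J * expectation (\<lambda>\<omega>. min 1 (L * \<bar>incr n k \<omega>\<bar>))" by simp
  also have "expectation (\<lambda>\<omega>. min 1 (L * \<bar>incr n k \<omega>\<bar>)) = expectation (\<lambda>\<omega>. min 1 (L * \<bar>incr n 0 \<omega>\<bar>))"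
    by (rule incr_expectation) simp
  finally show ?thesis .
qed

text \<open>The same grid sum has two limits. Pathwise it becomes the sum over the jumps. In
  expectation, the increment splits off by independence, which leaves \<open>p n\<close> for each
  cell to the right of \<open>dyp a\<close>, and \<open>flat\<close> may be replaced by
  \<open>X\<close>.\<close>

lemma mecke_test:
  fixes h :: "nat \<times> nat \<Rightarrow> real \<Rightarrow> real"
  assumes J: "finite J"
    and h: "\<And>q y. 0 \<le> h q y" "\<And>q y. h q y \<le> 1"
    and lip: "\<And>q y z. \<bar>h q y - h q z\<bar> \<le> L * \<bar>y - z\<bar>" and L: "0 \<le> L"
  shows "integrable M (\<lambda>\<omega>. \<Sum>s\<in>jumps d K \<omega>. g (jump (\<lambda>t. X t \<omega>) s) *
      (of_bool (dyp a < s) * (\<Prod>q\<in>J. h q (drop_jump s (\<lambda>t. X t \<omega>) (dyp q)))))" (is ?int)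
    and "expectation (\<lambda>\<omega>. \<Sum>s\<in>jumps d K \<omega>. g (jump (\<lambda>t. X t \<omega>) s) *
      (of_bool (dyp a < s) * (\<Prod>q\<in>J. h q (drop_jump s (\<lambda>t. X t \<omega>) (dyp q)))))
     = max 0 (real K - dyp a) * jump_mean * expectation (\<lambda>\<omega>. \<Prod>q\<in>J. h q (X (dyp q) \<omega>))" (is ?eq)
proof -
  have hco: "continuous_on UNIV (h q)" for q
    by (rule lipschitz_on_continuous_on[of L], rule lipschitz_onI)
       (use lip L in \<open>auto simp: dist_real_def\<close>)
  have hc: "isCont (h q) y" for q y
    using hco by (simp add: continuous_on_eq_continuous_at)
  have hm[measurable]: "h q \<in> borel_measurable borel" for q
    by (rule borel_measurable_continuous_onI[OF hco])
  define F where "F n k \<omega> = (\<Prod>q\<in>J. h q (flat n k (dyp q) \<omega>))" for n k \<omega>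
  have [measurable]: "F n k \<in> borel_measurable M" for n k unfolding F_def by measurable
  have F: "0 \<le> F n k \<omega>" "F n k \<omega> \<le> 1" for n k \<omega>
    unfolding F_def by (auto simp: h intro!: prod_nonneg prod_le_1)
  \<comment> \<open>From the level of \<open>a\<close> on, \<open>dyp a \<le> dy n k\<close> is
    equivalent to \<open>dyp a < s\<close> for every \<open>s\<close> in the cell
    \<open>k\<close>.\<close>
  define \<theta>n where "\<theta>n n k \<omega> = of_bool (dyp a \<le> dy n k) * F n k \<omega>" for n k \<omega>
  have [measurable]: "\<theta>n n k \<in> borel_measurable M" for n k unfolding \<theta>n_def by measurable
  have \<theta>n01: "0 \<le> \<theta>n n k \<omega>" "\<theta>n n k \<omega> \<le> 1" for n k \<omega> using F by (auto simp: \<theta>n_def)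
  define \<theta> where "\<theta> s \<omega> = of_bool (dyp a < s) * (\<Prod>q\<in>J. h q (drop_jump s (\<lambda>t. X t \<omega>) (dyp q)))" for s \<omega>
  have lim: "(\<lambda>n. \<theta>n n (cell n s) \<omega>) \<longlonglongrightarrow> \<theta> s \<omega>" if "0 < s" for s \<omega>
  proof -
    have "\<forall>\<^sub>F n in sequentially. of_bool (dyp a \<le> dy n (cell n s)) = (of_bool (dyp a < s) :: real)"
      by (rule eventually_sequentiallyI[of "fst a"]) (simp add: dyp_refine cell_less_iff[OF that])
    then have "(\<lambda>n. of_bool (dyp a \<le> dy n (cell n s)) :: real) \<longlonglongrightarrow> of_bool (dyp a < s)"
      by (rule tendsto_eventually)
    then show ?thesis
      unfolding \<theta>n_def \<theta>_def F_def
      by (intro tendsto_mult tendsto_prod isCont_tendsto_compose[OF hc flat_tendsto[OF that]])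
  qed
  note W = weighted_sum_expectation_tendsto[of \<theta>n K \<theta>]
  have W1: ?int
    unfolding \<theta>_def[symmetric] by (rule W(1)) (use \<theta>n01 lim in auto)
  then show ?int .
  have W2: "(\<lambda>n. \<Sum>k<K * 2 ^ n. expectation (\<lambda>\<omega>. g (incr n k \<omega>) * \<theta>n n k \<omega>))
       \<longlonglongrightarrow> expectation (\<lambda>\<omega>. \<Sum>s\<in>jumps d K \<omega>. g (jump (\<lambda>t. X t \<omega>) s) * \<theta> s \<omega>)"
    by (rule W(2)) (use \<theta>n01 lim in auto)
  define c where "c = expectation (\<lambda>\<omega>. \<Prod>q\<in>J. h q (X (dyp q) \<omega>))"
  define \<epsilon> where "\<epsilon> n = expectation (\<lambda>\<omega>. min 1 (L * \<bar>incr n 0 \<omega>\<bar>))" for n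
  obtain C where C: "\<And>n. real (K * 2 ^ n) * p n \<le> C" using mean_sum_bounded by blast
  have \<epsilon>: "\<epsilon> \<longlonglongrightarrow> 0" unfolding \<epsilon>_def by (rule small_increment_tendsto[OF L])
  have \<epsilon>0: "0 \<le> \<epsilon> n" for n unfolding \<epsilon>_def using L by (intro Bochner_Integration.integral_nonneg) simp
  let ?S = "\<lambda>n. \<Sum>k<K * 2 ^ n. expectation (\<lambda>\<omega>. g (incr n k \<omega>) * \<theta>n n k \<omega>)"
  let ?A = "\<lambda>n. max 0 (real K - dyp a) * (2 ^ n * p n) * c"
  \<comment> \<open>Each of the \<open>K * 2 ^ n\<close> cells contributes an error of at most
    \<open>p n * (card J * \<epsilon> n)\<close>, and the number of cells times \<open>p n\<close>
    is at most \<open>C\<close>.\<close>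
  have close: "\<bar>?S n - ?A n\<bar> \<le> C * (card J * \<epsilon> n)" if n: "Max (insert (fst a) (fst ` J)) \<le> n" for n
  proof -
    have nJ: "fst q \<le> n" if "q \<in> J" for q using n J that by simp
    have na: "fst a \<le> n" using n J by simp
    have S: "?S n = (\<Sum>k<K * 2 ^ n. of_bool (dyp a \<le> dy n k) * (p n * expectation (F n k)))"
    proof (rule sum.cong)
      fix k
      have "expectation (\<lambda>\<omega>. g (incr n k \<omega>) * \<theta>n n k \<omega>) =
          of_bool (dyp a \<le> dy n k) * expectation (\<lambda>\<omega>. g (incr n k \<omega>) * F n k \<omega>)"
        by (simp add: \<theta>n_def)
      also have "expectation (\<lambda>\<omega>. g (incr n k \<omega>) * F n k \<omega>) = p n * expectation (F n k)"
        unfolding F_def by (rule expectation_flat_factor[OF J nJ hm h])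
      finally show "expectation (\<lambda>\<omega>. g (incr n k \<omega>) * \<theta>n n k \<omega>) =
          of_bool (dyp a \<le> dy n k) * (p n * expectation (F n k))" .
    qed simp
    define q where "q = snd a * 2 ^ (n - fst a)"
    have qa: "dyp a = real q / 2 ^ n" using dyp_refine[OF na] by (simp add: q_def dy_def)
    have "(\<Sum>k<K * 2 ^ n. of_bool (dyp a \<le> dy n k) :: real) = card {k\<in>{..<K * 2 ^ n}. q \<le> k}"
      unfolding dyp_refine[OF na] dy_le_iff q_def[symmetric]
      by (simp add: of_bool_def sum.If_cases Int_def)
    also have "{k\<in>{..<K * 2 ^ n}. q \<le> k} = {q..<K * 2 ^ n}" by auto
    also have "real (card {q..<K * 2 ^ n}) = 2 ^ n * max 0 (real K - dyp a)"
    proof (cases "q \<le> K * 2 ^ n")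
      case True
      then have "real q \<le> real K * 2 ^ n" using of_nat_mono[OF True, where 'a=real] by simp
      with True show ?thesis by (simp add: qa max_def of_nat_diff algebra_simps divide_le_eq)
    next
      case False
      then have "K * 2 ^ n \<le> q" by simp
      from of_nat_mono[OF this, where 'a=real] have "real K * 2 ^ n \<le> real q" by simp
      then have "real K \<le> real q / 2 ^ n" by (simp add: le_divide_eq)
      then have "max 0 (real K - dyp a) = 0" by (simp add: qa)
      with False show ?thesis by simp
    qed
    finally have cnt: "(\<Sum>k<K * 2 ^ n. of_bool (dyp a \<le> dy n k) :: real) = 2 ^ n * max 0 (real K - dyp a)" .
    have A: "?A n = (\<Sum>k<K * 2 ^ n. of_bool (dyp a \<le> dy n k) * (p n * c))"
      unfolding sum_distrib_right[symmetric] cnt by (simp only: mult_ac)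
    have "\<bar>?S n - ?A n\<bar> = \<bar>\<Sum>k<K * 2 ^ n. of_bool (dyp a \<le> dy n k) * (p n * (expectation (F n k) - c))\<bar>"
      unfolding S A sum_subtractf[symmetric] right_diff_distrib ..
    also have "\<dots> \<le> (\<Sum>k<K * 2 ^ n. p n * (card J * \<epsilon> n))"
    proof (rule order_trans[OF sum_abs sum_mono])
      fix k
      have "\<bar>expectation (F n k) - c\<bar> \<le> card J * \<epsilon> n"
        unfolding F_def c_def \<epsilon>_def by (rule flat_prod_close[OF J hm h lip L])
      then have "p n * \<bar>expectation (F n k) - c\<bar> \<le> p n * (card J * \<epsilon> n)"
        by (rule mult_left_mono[OF _ p_nonneg])
      moreover have "0 \<le> p n * (card J * \<epsilon> n)" using p_nonneg \<epsilon>0 by simp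
      ultimately show "\<bar>of_bool (dyp a \<le> dy n k) * (p n * (expectation (F n k) - c))\<bar> \<le> p n * (card J * \<epsilon> n)"
        by (simp add: abs_mult p_nonneg)
    qed
    also have "\<dots> = (real (K * 2 ^ n) * p n) * (card J * \<epsilon> n)" by simp
    also have "\<dots> \<le> C * (card J * \<epsilon> n)" using C \<epsilon>0 by (intro mult_right_mono) auto
    finally show ?thesis .
  qed
  have "(\<lambda>n. C * (card J * \<epsilon> n)) \<longlonglongrightarrow> 0"
    by (intro tendsto_mult_right_zero \<epsilon>)
  then have d0: "(\<lambda>n. ?S n - ?A n) \<longlonglongrightarrow> 0"
    by (rule Lim_null_comparison[rotated]) (rule eventually_sequentiallyI, simp only: real_norm_def, erule close)
  have "?A \<longlonglongrightarrow> max 0 (real K - dyp a) * jump_mean * c"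
    by (intro tendsto_intros p_tendsto)
  from tendsto_add[OF d0 this] have "?S \<longlonglongrightarrow> max 0 (real K - dyp a) * jump_mean * c" by simp
  from LIMSEQ_unique[OF W2 this] show ?eq by (simp add: \<theta>_def c_def)
qed

end

section \<open>From Lipschitz test functions to indicators of half-lines\<close>

definition ramp :: "nat \<Rightarrow> real \<Rightarrow> real" where
  "ramp l v = min 1 (real l * max 0 v)"

lemma ramp_bounds [simp]: "0 \<le> ramp l v" "ramp l v \<le> 1"
  by (simp_all add: ramp_def)

lemma ramp_lipschitz: "\<bar>ramp l v - ramp l w\<bar> \<le> real l * \<bar>v - w\<bar>"
proof -
  have "\<bar>ramp l v - ramp l w\<bar> \<le> \<bar>real l * max 0 v - real l * max 0 w\<bar>"
    unfolding ramp_def by linarith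
  also have "\<dots> = real l * \<bar>max 0 v - max 0 w\<bar>"
    by (simp add: right_diff_distrib[symmetric] abs_mult)
  also have "\<dots> \<le> real l * \<bar>v - w\<bar>" by (intro mult_left_mono) auto
  finally show ?thesis .
qed

lemma isCont_ramp: "isCont (\<lambda>y. ramp l (f y)) y" if "isCont f y"
  unfolding ramp_def using that by (intro continuous_intros)

lemma ramp_tendsto: "(\<lambda>l. ramp l v) \<longlonglongrightarrow> of_bool (0 < v)"
proof (cases "0 < v")
  case True
  have "\<forall>\<^sub>F l in sequentially. ramp l v = 1"
  proof (rule eventually_sequentiallyI[of "nat \<lceil>1 / v\<rceil>"])
    fix l assume "nat \<lceil>1 / v\<rceil> \<le> l"
    then have "1 / v \<le> real l" by linarith
    then show "ramp l v = 1" using True by (simp add: ramp_def divide_le_eq)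
  qed
  then show ?thesis using True by (simp add: tendsto_eventually)
qed (simp add: ramp_def max_def)

text \<open>One point of each dyadic level, above \<open>a\<close> and within one mesh of it: by
  right continuity these times determine the value of a path at \<open>a\<close>.\<close>

definition dyadic_above :: "real \<Rightarrow> nat \<Rightarrow> nat \<times> nat" where
  "dyadic_above a n = (n, nat (\<lfloor>a * 2 ^ n\<rfloor> + 1))"

lemma dyadic_above_bounds:
  assumes "0 \<le> a"
  shows "a < dyp (dyadic_above a n)" "dyp (dyadic_above a n) \<le> a + 1 / 2 ^ n"
proof -
  have "0 \<le> \<lfloor>a * 2 ^ n\<rfloor>" using assms by simp
  then have "real (nat (\<lfloor>a * 2 ^ n\<rfloor> + 1)) = of_int \<lfloor>a * 2 ^ n\<rfloor> + 1" by simp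
  then have e: "dyp (dyadic_above a n) = (of_int \<lfloor>a * 2 ^ n\<rfloor> + 1) / 2 ^ n"
    by (simp add: dyp_def dyadic_above_def dy_def)
  show "a < dyp (dyadic_above a n)"
    unfolding e using floor_correct[of "a * 2 ^ n"] by (simp add: less_divide_eq)
  show "dyp (dyadic_above a n) \<le> a + 1 / 2 ^ n"
    unfolding e using floor_correct[of "a * 2 ^ n"] by (simp add: divide_le_eq algebra_simps)
qed

lemma dyadic_above_tendsto: "0 \<le> a \<Longrightarrow> (\<lambda>n. dyp (dyadic_above a n)) \<longlonglongrightarrow> a"
proof -
  assume a: "0 \<le> a"
  have "(\<lambda>n. a + 1 / 2 ^ n) \<longlonglongrightarrow> a + 0" by (intro tendsto_intros half_power_tendsto)
  then have "(\<lambda>n. a + 1 / 2 ^ n) \<longlonglongrightarrow> a" by simp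
  from tendsto_sandwich[OF _ _ tendsto_const this]
  show "(\<lambda>n. dyp (dyadic_above a n)) \<longlonglongrightarrow> a"
    using dyadic_above_bounds[OF a] by (simp add: less_imp_le)
qed

context levy_paths
begin

lemma jump_test_ramp: "0 < d \<Longrightarrow> jump_test M X x (\<lambda>y. ramp l (- d - y)) d"
proof (intro jump_test.intro jump_test_axioms.intro levy_paths_axioms)
  show "isCont (\<lambda>y. ramp l (- d - y)) y" for y by (intro isCont_ramp continuous_intros)
  show "ramp l (- d - y) = 0" if "- d \<le> y" for y using that by (simp add: ramp_def)
qed simp_all

lemma ramp_sum_integrable:
  "0 < d \<Longrightarrow> integrable M (\<lambda>\<omega>. \<Sum>s\<in>jumps d (real K) \<omega>. ramp l (- d - jump (\<lambda>t. X t \<omega>) s))"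
  using jump_test.weighted_sum_expectation_tendsto(1)[OF jump_test_ramp[of d l],
      where K=K and \<theta>n="\<lambda>_ _ _. 1" and \<theta>="\<lambda>_ _. 1"] by simp

lemma ramp_sum_tendsto:
  "(\<lambda>l. \<Sum>s\<in>jumps d K \<omega>. ramp l (- d - jump (\<lambda>t. X t \<omega>) s)) \<longlonglongrightarrow> card (jumps d K \<omega>)"
proof -
  have "(\<lambda>l. \<Sum>s\<in>jumps d K \<omega>. ramp l (- d - jump (\<lambda>t. X t \<omega>) s)) \<longlonglongrightarrow>
      (\<Sum>s\<in>jumps d K \<omega>. of_bool (0 < - d - jump (\<lambda>t. X t \<omega>) s))"
    by (intro tendsto_sum ramp_tendsto)
  also have "(\<Sum>s\<in>jumps d K \<omega>. of_bool (0 < - d - jump (\<lambda>t. X t \<omega>) s) :: real) = (\<Sum>s\<in>jumps d K \<omega>. 1)"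
    by (intro sum.cong) (auto simp: jumps_def)
  finally show ?thesis by simp
qed

text \<open>Jumps below \<open>-d\<close> are dominated by a ramp with threshold
  \<open>-(d/2)\<close>, which has already reached 1 at \<open>-d\<close> as soon as
  \<open>2 / d \<le> l\<close>.\<close>

lemma card_jumps_integrable:
  fixes K :: nat
  assumes d: "0 < d"
  shows "integrable M (\<lambda>\<omega>. real (card (jumps d K \<omega>)))"
proof -
  obtain l :: nat where l: "2 / d \<le> real l" using real_arch_simple by blast
    have meas: "(\<lambda>\<omega>. real (card (jumps d K \<omega>))) \<in> borel_measurable M"
      by (rule borel_measurable_LIMSEQ_metric[OF _ ramp_sum_tendsto]) (use ramp_sum_integrable[OF d] in auto)
    have le: "AE \<omega> in M. norm (real (card (jumps d K \<omega>))) \<le>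
        norm (\<Sum>s\<in>jumps (d/2) K \<omega>. ramp l (- (d/2) - jump (\<lambda>t. X t \<omega>) s))"
    proof (rule AE_I2)
      fix \<omega>
      have "real (card (jumps d K \<omega>)) = (\<Sum>s\<in>jumps d K \<omega>. 1 :: real)" by simp
      also have "\<dots> \<le> (\<Sum>s\<in>jumps d K \<omega>. ramp l (- (d/2) - jump (\<lambda>t. X t \<omega>) s))"
      proof (rule sum_mono)
        fix s assume "s \<in> jumps d K \<omega>"
        then have "d / 2 \<le> - (d/2) - jump (\<lambda>t. X t \<omega>) s" by (simp add: jumps_def)
        then have "real l * (d / 2) \<le> real l * max 0 (- (d/2) - jump (\<lambda>t. X t \<omega>) s)"
          by (intro mult_left_mono max.coboundedI2) auto
        moreover have "1 \<le> real l * (d / 2)" using l d by (simp add: field_simps)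
        ultimately show "1 \<le> ramp l (- (d/2) - jump (\<lambda>t. X t \<omega>) s)"
          by (simp add: ramp_def)
      qed
      also have "\<dots> \<le> (\<Sum>s\<in>jumps (d/2) K \<omega>. ramp l (- (d/2) - jump (\<lambda>t. X t \<omega>) s))"
        using d by (intro sum_mono2 finite_jumps) (auto simp: jumps_def)
      finally show "norm (real (card (jumps d K \<omega>))) \<le>
        norm (\<Sum>s\<in>jumps (d/2) K \<omega>. ramp l (- (d/2) - jump (\<lambda>t. X t \<omega>) s))" by simp
    qed
  show ?thesis
    by (rule Bochner_Integration.integrable_bound[OF ramp_sum_integrable meas le]) (use d in simp)
qed

text \<open>\<open>mecke_test\<close> for ramps, in the limit of steep ramps. All the sums are
  dominated by the number of jumps, which is integrable.\<close>

lemma mecke_basic: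
  fixes r :: code and a :: real and K :: nat
  assumes d: "0 < d" and J: "finite J"
  defines "S \<equiv> \<lambda>\<omega>. \<Sum>s\<in>jumps d K \<omega>. of_bool (a < s) * (\<Prod>q\<in>J. of_bool (r q < drop_jump s (\<lambda>t. X t \<omega>) (dyp q)) :: real)"
  shows "integrable M S"
    and "expectation S = max 0 (real K - max 0 a) * expectation (\<lambda>\<omega>. card (jumps d 1 \<omega>))
       * prob {\<omega>\<in>space M. \<forall>q\<in>J. r q < X (dyp q) \<omega>}"
proof -
  \<comment> \<open>Jump times are positive, so a negative \<open>a\<close> imposes no condition and
    is replaced by the dyadic time 0.\<close>
  define al where "al l = (if a < 0 then (0,0) else dyadic_above a l)" for l
  have al_tendsto: "(\<lambda>l. dyp (al l)) \<longlonglongrightarrow> max 0 a"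
    using dyadic_above_tendsto[of a] by (cases "a < 0") (simp_all add: al_def dyp_def[of "(0,0)"])
  have al_ind: "(\<lambda>l. of_bool (dyp (al l) < s) :: real) \<longlonglongrightarrow> of_bool (a < s)" if "0 < s" for s
  proof (cases "a < s")
    case True
    then have "max 0 a < s" using that by simp
    from order_tendstoD(2)[OF al_tendsto this] True show ?thesis
      by (intro tendsto_eventually) (auto elim: eventually_mono)
  next
    case False
    then have "\<not> dyp (al l) < s" for l
      using that dyadic_above_bounds(1)[of a l] by (auto simp: al_def)
    then show ?thesis using False by simp
  qed
  define Sl where "Sl l K \<omega> = (\<Sum>s\<in>jumps d K \<omega>. ramp l (- d - jump (\<lambda>t. X t \<omega>) s) *
      (of_bool (dyp (al l) < s) * (\<Prod>q\<in>J. ramp l (drop_jump s (\<lambda>t. X t \<omega>) (dyp q) - r q))))" for l K \<omega>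
  define c where "c l = expectation (\<lambda>\<omega>. \<Prod>q\<in>J. ramp l (X (dyp q) \<omega> - r q))" for l
  define m where "m l = jump_test.jump_mean M X (\<lambda>y. ramp l (- d - y)) d" for l
  have step: "integrable M (Sl l K)" "expectation (Sl l K) = max 0 (real K - dyp (al l)) * m l * c l"
    for l
  proof -
    have lip: "\<bar>ramp l (y - r q) - ramp l (z - r q)\<bar> \<le> real l * \<bar>y - z\<bar>" for q y z
      using ramp_lipschitz[of l "y - r q" "z - r q"] by simp
    note * = jump_test.mecke_test[OF jump_test_ramp[OF d] J, where h="\<lambda>q y. ramp l (y - r q)" and L="real l",
        OF ramp_bounds lip]
    show "integrable M (Sl l K)" "expectation (Sl l K) = max 0 (real K - dyp (al l)) * m l * c l"
      unfolding Sl_def c_def m_def by (rule *(1), simp) (rule *(2), simp)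
  qed
  have ramp1: "ramp l (- d - jump (\<lambda>t. X t \<omega>) s) * (of_bool (P l) * (\<Prod>q\<in>J. ramp l (u q))) \<le> 1"
    "0 \<le> ramp l (- d - jump (\<lambda>t. X t \<omega>) s) * (of_bool (P l) * (\<Prod>q\<in>J. ramp l (u q)))" for l \<omega> s P u
    by (intro mult_le_one mult_nonneg_nonneg prod_le_1 prod_nonneg; simp)+
  have lim: "(\<lambda>l. Sl l K \<omega>) \<longlonglongrightarrow> S \<omega>" for \<omega>
  proof -
    have "(\<lambda>l. Sl l K \<omega>) \<longlonglongrightarrow> (\<Sum>s\<in>jumps d K \<omega>. of_bool (0 < - d - jump (\<lambda>t. X t \<omega>) s) *
        (of_bool (a < s) * (\<Prod>q\<in>J. of_bool (0 < drop_jump s (\<lambda>t. X t \<omega>) (dyp q) - r q))))"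
      unfolding Sl_def by (intro tendsto_sum tendsto_mult tendsto_prod ramp_tendsto al_ind) (auto simp: jumps_def)
    also have "(\<Sum>s\<in>jumps d K \<omega>. of_bool (0 < - d - jump (\<lambda>t. X t \<omega>) s) *
        (of_bool (a < s) * (\<Prod>q\<in>J. of_bool (0 < drop_jump s (\<lambda>t. X t \<omega>) (dyp q) - r q)))) = S \<omega>"
      unfolding S_def by (intro sum.cong) (auto simp: jumps_def)
    finally show ?thesis .
  qed
  have Sl_le: "\<bar>Sl l K \<omega>\<bar> \<le> card (jumps d K \<omega>)" for l \<omega>
  proof -
    have "Sl l K \<omega> \<le> (\<Sum>s\<in>jumps d K \<omega>. 1)" unfolding Sl_def by (intro sum_mono ramp1)
    moreover have "0 \<le> Sl l K \<omega>" unfolding Sl_def by (intro sum_nonneg ramp1)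
    ultimately show ?thesis by simp
  qed
  have Sm: "S \<in> borel_measurable M"
    by (rule borel_measurable_LIMSEQ_metric[OF _ lim]) (use step in auto)
  have conv: "integrable M S" "(\<lambda>l. expectation (Sl l K)) \<longlonglongrightarrow> expectation S"
    using integrable_dominated_convergence[OF Sm _ card_jumps_integrable[OF d], of "\<lambda>l. Sl l K" K]
      integral_dominated_convergence[OF Sm _ card_jumps_integrable[OF d], of "\<lambda>l. Sl l K" K]
      step lim Sl_le by auto
  show "integrable M S" by (rule conv)
  \<comment> \<open>The constants \<open>jump_mean\<close> tend to the mean number of jumps below
    \<open>-d\<close> in a unit of time; this is what will become a value of \<pi>.\<close>
  have m: "m \<longlonglongrightarrow> expectation (\<lambda>\<omega>. card (jumps d 1 \<omega>))"
  proof -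
    let ?s = "\<lambda>l \<omega>. \<Sum>s\<in>jumps d (real 1) \<omega>. ramp l (- d - jump (\<lambda>t. X t \<omega>) s)"
    have "(\<lambda>l. expectation (\<lambda>\<omega>. ?s l \<omega>))
        \<longlonglongrightarrow> expectation (\<lambda>\<omega>. card (jumps d (real 1) \<omega>))"
    proof (rule integral_dominated_convergence[OF _ _ card_jumps_integrable[OF d, of 1]])
      show "AE \<omega> in M. (\<lambda>l. ?s l \<omega>) \<longlonglongrightarrow> card (jumps d (real 1) \<omega>)"
        by (intro AE_I2 ramp_sum_tendsto)
      show "AE \<omega> in M. norm (?s l \<omega>) \<le> card (jumps d (real 1) \<omega>)" for l
      proof (rule AE_I2)
        fix \<omega>
        have "?s l \<omega> \<le> (\<Sum>s\<in>jumps d (real 1) \<omega>. 1)"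
          by (intro sum_mono) simp
        then show "norm (?s l \<omega>) \<le> card (jumps d (real 1) \<omega>)"
          by (simp add: sum_nonneg)
      qed
    qed (use ramp_sum_integrable[OF d, where K=1] card_jumps_integrable[OF d, of 1] in auto)
    then show ?thesis by (simp add: m_def[abs_def] jump_test.jump_mean_def[OF jump_test_ramp[OF d]])
  qed
  have [measurable]: "X (dyp q) \<in> borel_measurable M" for q by (intro rv) simp
  have c: "c \<longlonglongrightarrow> prob {\<omega>\<in>space M. \<forall>q\<in>J. r q < X (dyp q) \<omega>}"
  proof -
    have "c \<longlonglongrightarrow> expectation (\<lambda>\<omega>. \<Prod>q\<in>J. of_bool (0 < X (dyp q) \<omega> - r q))"
      unfolding c_def[abs_def]
    proof (rule integral_dominated_convergence[where w="\<lambda>_. 1"])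
      show "AE \<omega> in M. (\<lambda>l. \<Prod>q\<in>J. ramp l (X (dyp q) \<omega> - r q)) \<longlonglongrightarrow> (\<Prod>q\<in>J. of_bool (0 < X (dyp q) \<omega> - r q))"
        by (intro AE_I2 tendsto_prod ramp_tendsto)
    qed (auto simp: abs_prod ramp_def intro!: prod_le_1)
    also have "(\<lambda>\<omega>. \<Prod>q\<in>J. of_bool (0 < X (dyp q) \<omega> - r q)) = (\<lambda>\<omega>. indicator {\<omega>. \<forall>q\<in>J. r q < X (dyp q) \<omega>} \<omega> :: real)"
      using J by (intro ext) (auto simp: indicator_def of_bool_def prod_zero_iff intro!: prod.neutral)
    also have "expectation \<dots> = prob {\<omega>\<in>space M. \<forall>q\<in>J. r q < X (dyp q) \<omega>}"
      by (simp add: Int_def conj_commute)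
    finally show ?thesis .
  qed
  have "(\<lambda>l. max 0 (real K - dyp (al l)) * m l * c l) \<longlonglongrightarrow>
      max 0 (real K - max 0 a) * expectation (\<lambda>\<omega>. card (jumps d 1 \<omega>)) * prob {\<omega>\<in>space M. \<forall>q\<in>J. r q < X (dyp q) \<omega>}"
    by (intro tendsto_intros al_tendsto m c)
  with conv(2) show "expectation S = max 0 (real K - max 0 a) * expectation (\<lambda>\<omega>. card (jumps d 1 \<omega>))
       * prob {\<omega>\<in>space M. \<forall>q\<in>J. r q < X (dyp q) \<omega>}"
    unfolding step(2) by (rule LIMSEQ_unique)
qed

end

subsection \<open>The Mecke formula\<close>

type_synonym coded_jump = "(real \<times> code) \<times> real"

abbreviation jump_space :: "coded_jump measure" where
  "jump_space \<equiv> time_path \<Otimes>\<^sub>M borel"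

text \<open>The sets whose indicators occur in \<open>mecke_basic\<close>. They are stable under
  intersection and generate \<open>jump_space\<close>, so they determine finite measures of the same
  total mass.\<close>

definition orthant :: "real \<Rightarrow> (nat \<times> nat) set \<Rightarrow> code \<Rightarrow> real \<Rightarrow> coded_jump set" where
  "orthant a J r e = {z. a < fst (fst z) \<and> (\<forall>q\<in>J. r q < snd (fst z) q) \<and> snd z < - e}"

definition orthants :: "coded_jump set set" where
  "orthants = {orthant a J r e | a J r e. finite J}"

lemma Int_stable_orthants: "Int_stable orthants"
proof (rule Int_stableI)
  fix A B assume "A \<in> orthants" "B \<in> orthants"
  then obtain a J r e b I s f where A: "A = orthant a J r e" "finite J"
    and B: "B = orthant b I s f" "finite I" by (auto simp: orthants_def)
  let ?r = "\<lambda>q. if q \<in> J \<inter> I then max (r q) (s q) else if q \<in> J then r q else s q"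
  have "A \<inter> B = orthant (max a b) (J \<union> I) ?r (max e f)"
    unfolding A B orthant_def by (auto split: if_splits)
  then show "A \<inter> B \<in> orthants" using A B by (auto simp: orthants_def)
qed

text \<open>A constraint on a single coordinate is a countable union of orthants whose other
  thresholds run to minus infinity. Hence all coordinates, and with them the identity into the
  product, are measurable for the generated sigma-algebra.\<close>

lemma sets_jump_space: "sets jump_space \<subseteq> sigma_sets UNIV orthants"
proof -
  let ?S = "sigma UNIV orthants :: coded_jump measure"
  have orth: "orthant a J r e \<in> sets ?S" if "finite J" for a J r e
    using that by (auto simp: orthants_def intro!: sigma_sets.Basic)
  have big: "\<exists>m::nat. v < real m" "\<exists>m::nat. - real m < v" for v
    using reals_Archimedean2[of v] reals_Archimedean2[of "-v"] by (auto simp: minus_less_iff)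
  have "(\<lambda>z. fst (fst z)) \<in> borel_measurable ?S"
  proof (rule borel_measurableI_greater)
    fix a :: real
    have "{z \<in> space ?S. a < fst (fst z)} = (\<Union>m::nat. orthant a {} (\<lambda>_. 0) (- real m))"
      using big by (auto simp: orthant_def)
    then show "{z \<in> space ?S. a < fst (fst z)} \<in> sets ?S"
      by (simp only:) (intro sets.countable_UN'' orth; simp)
  qed
  moreover have "(\<lambda>z. snd (fst z)) \<in> measurable ?S path_space"
  proof (rule measurable_PiM_single')
    fix q :: "nat \<times> nat"
    show "(\<lambda>z. snd (fst z) q) \<in> borel_measurable ?S"
    proof (rule borel_measurableI_greater)
      fix a :: real
      have "{z \<in> space ?S. a < snd (fst z) q} = (\<Union>m::nat. \<Union>k::nat. orthant (- real k) {q} (\<lambda>_. a) (- real m))"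
        using big by (auto simp: orthant_def)
      then show "{z \<in> space ?S. a < snd (fst z) q} \<in> sets ?S"
      by (simp only:) (intro sets.countable_UN'' orth; simp)
    qed
  qed auto
  moreover have "snd \<in> borel_measurable ?S"
  proof (rule borel_measurableI_less)
    fix a :: real
    have "{z \<in> space ?S. snd z < a} = (\<Union>k::nat. orthant (- real k) {} (\<lambda>_. 0) (- a))"
      using big by (auto simp: orthant_def)
    then show "{z \<in> space ?S. snd z < a} \<in> sets ?S"
      by (simp only:) (intro sets.countable_UN'' orth; simp)
  qed
  ultimately have "(\<lambda>z. ((fst (fst z), snd (fst z)), snd z)) \<in> measurable ?S jump_space"
    by (intro measurable_Pair)
  then have id: "(\<lambda>z. z) \<in> measurable ?S jump_space" by simp
  show ?thesis
  proof
    fix A assume "A \<in> sets jump_space"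
    from measurable_sets[OF id this] show "A \<in> sigma_sets UNIV orthants" by simp
  qed
qed

lemma emeasure_density_indicator:
  assumes [measurable]: "A \<in> sets N" "B \<in> sets N"
  shows "emeasure (density N (indicator B)) A = emeasure N (A \<inter> B)"
proof -
  have "emeasure (density N (indicator B)) A = (\<integral>\<^sup>+x. indicator B x * indicator A x \<partial>N)"
    by (simp add: emeasure_density)
  also have "\<dots> = (\<integral>\<^sup>+x. indicator (A \<inter> B) x \<partial>N)"
    by (intro nn_integral_cong) (simp split: split_indicator)
  finally show ?thesis by simp
qed

locale levy_jumps = levy_paths +
  fixes \<pi> :: "real measure"
  assumes levy_measure: "is_levy_measure M X \<pi>"
begin

definition coded :: "'a \<Rightarrow> code" where
  "coded \<omega> = enc (\<lambda>t. X t \<omega>)"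

definition dropped :: "real \<Rightarrow> 'a \<Rightarrow> code" where
  "dropped s \<omega> = enc (drop_jump s (\<lambda>t. X t \<omega>))"

definition jumpX :: "real \<Rightarrow> 'a \<Rightarrow> real" where
  "jumpX s \<omega> = jump (\<lambda>t. X t \<omega>) s"

definition jump_sum :: "real \<Rightarrow> nat \<Rightarrow> (coded_jump \<Rightarrow> ennreal) \<Rightarrow> 'a \<Rightarrow> ennreal" where
  "jump_sum d K F \<omega> = (\<Sum>s\<in>jumps d K \<omega>. F ((s, dropped s \<omega>), jumpX s \<omega>))"

definition path_law :: "code measure" where
  "path_law = distr M path_space coded"

definition big_jump_law :: "real \<Rightarrow> real measure" where
  "big_jump_law d = density \<pi> (indicator {..<-d})"

text \<open>Truncation in time and in jump size makes this measure finite for \<open>0 < d\<close>,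
  as the passage to complements in \<open>mecke_set\<close> requires.\<close>

definition mecke_measure :: "real \<Rightarrow> nat \<Rightarrow> coded_jump measure" where
  "mecke_measure d K = (density lborel (indicator {0<..real K}) \<Otimes>\<^sub>M path_law) \<Otimes>\<^sub>M big_jump_law d"

lemma coded_measurable [measurable]: "coded \<in> measurable M path_space"
proof -
  have "(\<lambda>\<omega> q. X (dyp q) \<omega>) \<in> measurable M path_space"
    by (rule measurable_PiM_single') (auto intro: rv)
  then show ?thesis by (simp add: coded_def[abs_def] enc_def[abs_def])
qed

lemma sets_pi [simp, measurable_cong]: "sets \<pi> = sets borel"
  using levy_measure by (simp add: is_levy_measure_def)

lemma sets_path_law [simp, measurable_cong]: "sets path_law = sets path_space"
  by (simp add: path_law_def)

lemma sets_big_jump_law [simp, measurable_cong]: "sets (big_jump_law d) = sets borel"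
  by (simp add: big_jump_law_def)

lemma sets_mecke_measure [simp, measurable_cong]: "sets (mecke_measure d K) = sets jump_space"
  unfolding mecke_measure_def by (intro sets_pair_measure_cong) simp_all

lemma prob_space_path_law: "prob_space path_law"
  unfolding path_law_def by (rule prob_space_distr) simp

text \<open>The link between the definition of \<pi> and the constant that the grid limits produce.
  Half-lines are what the orthants ask of the jump.\<close>

lemma emeasure_pi_halfline:
  assumes "0 < d"
  shows "emeasure \<pi> {..<-d} = ennreal (expectation (\<lambda>\<omega>. card (jumps d 1 \<omega>)))"
proof -
  have "{t\<in>{0<..1}. jump (\<lambda>s. X s \<omega>) t \<noteq> 0 \<and> jump (\<lambda>s. X s \<omega>) t \<in> {..<-d}} = jumps d 1 \<omega>" for \<omega>
    using assms by (auto simp: jumps_def)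
  then have "emeasure \<pi> {..<-d} = (\<integral>\<^sup>+\<omega>. emeasure (count_space UNIV) (jumps d 1 \<omega>) \<partial>M)"
    using levy_measure by (simp add: is_levy_measure_def)
  also have "\<dots> = (\<integral>\<^sup>+\<omega>. ennreal (card (jumps d 1 \<omega>)) \<partial>M)"
    using finite_jumps[OF assms] by (intro nn_integral_cong) (simp add: ennreal_of_nat_eq_real_of_nat)
  also have "\<dots> = ennreal (expectation (\<lambda>\<omega>. card (jumps d 1 \<omega>)))"
    using card_jumps_integrable[OF assms, of 1] by (intro nn_integral_eq_integral) auto
  finally show ?thesis .
qed

lemma emeasure_big_jump_law: "A \<in> sets borel \<Longrightarrow> emeasure (big_jump_law d) A = emeasure \<pi> (A \<inter> {..<-d})"
  unfolding big_jump_law_def by (rule emeasure_density_indicator) simp_all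

lemma finite_big_jump_law: "0 < d \<Longrightarrow> finite_measure (big_jump_law d)"
  by (rule finite_measureI)
     (simp add: emeasure_big_jump_law emeasure_pi_halfline sets_eq_imp_space_eq[OF sets_big_jump_law])

lemma emeasure_mecke_Times:
  assumes d: "0 < d" and [measurable]: "A \<in> sets borel" "B \<in> sets path_space" "C \<in> sets borel"
  shows "emeasure (mecke_measure d K) ((A \<times> B) \<times> C)
    = emeasure lborel (A \<inter> {0<..real K}) * emeasure M {\<omega>\<in>space M. coded \<omega> \<in> B} * emeasure \<pi> (C \<inter> {..<-d})"
proof -
  interpret L: prob_space path_law by (rule prob_space_path_law)
  interpret D: finite_measure "big_jump_law d" by (rule finite_big_jump_law[OF d])
  have "emeasure (mecke_measure d K) ((A \<times> B) \<times> C) =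
      emeasure (density lborel (indicator {0<..real K})) A * emeasure path_law B * emeasure (big_jump_law d) C"
    unfolding mecke_measure_def by (simp add: D.emeasure_pair_measure_Times L.emeasure_pair_measure_Times)
  also have "emeasure (density lborel (indicator {0<..real K})) A = emeasure lborel (A \<inter> {0<..real K})"
    by (rule emeasure_density_indicator) simp_all
  also have "emeasure path_law B = emeasure M {\<omega>\<in>space M. coded \<omega> \<in> B}"
    by (simp add: path_law_def emeasure_distr vimage_def Int_def conj_commute)
  finally show ?thesis by (simp add: emeasure_big_jump_law)
qed

lemma mecke_orthant:
  fixes a e :: real and r :: code
  assumes d: "0 < d" and J: "finite J"
  defines "A \<equiv> orthant a J r e"
  shows "jump_sum d K (indicator A) \<in> borel_measurable M"
    "(\<integral>\<^sup>+\<omega>. jump_sum d K (indicator A) \<omega> \<partial>M) = emeasure (mecke_measure d K) A"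
proof -
  \<comment> \<open>The truncation \<open>-d\<close> and the threshold \<open>-e\<close> of the
    orthant combine; \<open>e\<close> may be negative.\<close>
  let ?d = "max d e"
  have d': "0 < ?d" using d by simp
  let ?b = "\<lambda>s \<omega>. of_bool (a < s) * (\<Prod>q\<in>J. of_bool (r q < drop_jump s (\<lambda>t. X t \<omega>) (dyp q)) :: real)"
  let ?S = "\<lambda>\<omega>. \<Sum>s\<in>jumps ?d K \<omega>. ?b s \<omega>"
  let ?P = "{\<omega>\<in>space M. \<forall>q\<in>J. r q < X (dyp q) \<omega>}" and ?L = "emeasure lborel ({a<..} \<inter> {0<..real K})"
  note B = mecke_basic[OF d' J, where a=a and r=r and K=K]
  have eq: "jump_sum d K (indicator A) \<omega> = ennreal (?S \<omega>)" for \<omega>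
  proof -
    have "jump_sum d K (indicator A) \<omega> = (\<Sum>s\<in>jumps ?d K \<omega>. indicator A ((s, dropped s \<omega>), jumpX s \<omega>))"
      unfolding jump_sum_def
      by (rule sum.mono_neutral_right[OF finite_jumps[OF d]])
         (auto simp: jumps_def A_def orthant_def jumpX_def indicator_def)
    also have "\<dots> = (\<Sum>s\<in>jumps ?d K \<omega>. ennreal (?b s \<omega>))"
    proof (rule sum.cong)
      fix s assume s: "s \<in> jumps ?d K \<omega>"
      have "(\<Prod>q\<in>J. of_bool (r q < drop_jump s (\<lambda>t. X t \<omega>) (dyp q)) :: real) =
          of_bool (\<forall>q\<in>J. r q < drop_jump s (\<lambda>t. X t \<omega>) (dyp q))"
        using J by (auto simp: of_bool_def prod_zero_iff intro!: prod.neutral)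
      then show "indicator A ((s, dropped s \<omega>), jumpX s \<omega>) =
          ennreal (?b s \<omega>)"
        using s by (auto simp: A_def orthant_def jumps_def jumpX_def dropped_def enc_def)
    qed simp
    also have "\<dots> = ennreal (?S \<omega>)" by (intro sum_ennreal mult_nonneg_nonneg prod_nonneg) auto
    finally show ?thesis .
  qed
  show "jump_sum d K (indicator A) \<in> borel_measurable M"
    unfolding eq using borel_measurable_integrable[OF B(1)] by measurable
  have "(\<integral>\<^sup>+\<omega>. jump_sum d K (indicator A) \<omega> \<partial>M) = ennreal (expectation ?S)"
    unfolding eq by (intro nn_integral_eq_integral B(1) AE_I2 sum_nonneg mult_nonneg_nonneg prod_nonneg) auto
  also have "\<dots> = ennreal (max 0 (real K - max 0 a)) * ennreal (expectation (\<lambda>\<omega>. card (jumps ?d 1 \<omega>)))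
       * emeasure M ?P"
    unfolding B(2) by (simp add: ennreal_mult' emeasure_eq_measure Bochner_Integration.integral_nonneg)
  also have "ennreal (expectation (\<lambda>\<omega>. card (jumps ?d 1 \<omega>))) = emeasure \<pi> {..<- ?d}"
    by (rule emeasure_pi_halfline[OF d', symmetric])
  also have "ennreal (max 0 (real K - max 0 a)) = ?L"
  proof -
    have "{a<..} \<inter> {0<..real K} = {max 0 a<..real K}" by auto
    then show ?thesis by (cases "max 0 a \<le> real K") auto
  qed
  also have "?L * emeasure \<pi> {..<- ?d} * emeasure M ?P
     = emeasure (mecke_measure d K) (({a<..} \<times> {z. \<forall>q\<in>J. r q < z q}) \<times> {..<- e})"
  proof -
    have 1: "{z. \<forall>q\<in>J. r q < z q} \<in> sets path_space"
    proof -
      have "{z\<in>space path_space. \<forall>q\<in>J. r q < z q} \<in> sets path_space"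
        using J by measurable
      then show ?thesis by (simp add: space_PiM)
    qed
    have 2: "{..<- e} \<inter> {..<-d} = {..<- ?d}" by auto
    show ?thesis
      by (subst emeasure_mecke_Times[OF d _ 1]) (simp_all add: 2 coded_def enc_def mult_ac)
  qed
  also have "({a<..} \<times> {z. \<forall>q\<in>J. r q < z q}) \<times> {..<- e} = A"
    unfolding A_def orthant_def by auto
  finally show "(\<integral>\<^sup>+\<omega>. jump_sum d K (indicator A) \<omega> \<partial>M) = emeasure (mecke_measure d K) A" .
qed

text \<open>Dynkin's argument, with measurability of the jump sum carried along in the
  induction.\<close>

lemma mecke_set:
  assumes d: "0 < d" and A: "A \<in> sets jump_space"
  shows "jump_sum d K (indicator A) \<in> borel_measurable M \<and>
    (\<integral>\<^sup>+\<omega>. jump_sum d K (indicator A) \<omega> \<partial>M) = emeasure (mecke_measure d K) A"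
proof -
  let ?S = "\<lambda>A. jump_sum d K (indicator A)" and ?m = "mecke_measure d K"
  have sub: "orthants \<subseteq> sets jump_space"
  proof
    fix B assume "B \<in> orthants"
    then obtain a J r e where B: "B = orthant a J r e" and [simp]: "finite J" by (auto simp: orthants_def)
    have "B = {z\<in>space jump_space. a < fst (fst z) \<and> (\<forall>q\<in>J. r q < snd (fst z) q) \<and> snd z < - e}"
      by (auto simp: B orthant_def space_pair_measure space_PiM)
    also have "\<dots> \<in> sets jump_space" by measurable
    finally show "B \<in> sets jump_space" .
  qed
  have sig: "sigma_sets UNIV orthants = sets jump_space"
  proof
    have "space jump_space = UNIV" by (auto simp: space_pair_measure space_PiM)
    then show "sigma_sets UNIV orthants \<subseteq> sets jump_space"
      using sets.sigma_sets_subset[OF sub] by simp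
  qed (rule sets_jump_space)
  have count: "?S UNIV \<omega> = ennreal (card (jumps d K \<omega>))" for \<omega>
    by (simp add: jump_sum_def ennreal_of_nat_eq_real_of_nat)
  have int_count: "(\<integral>\<^sup>+\<omega>. ?S UNIV \<omega> \<partial>M) = ennreal (expectation (\<lambda>\<omega>. card (jumps d K \<omega>)))"
    unfolding count by (intro nn_integral_eq_integral card_jumps_integrable d) auto
  \<comment> \<open>The whole space is not an orthant, but all counted jumps have positive times and
    sizes below \<open>-d\<close>, so an orthant gives the same sum and, by \<open>cover\<close>,
    the same mass.\<close>
  have whole: "?S UNIV = ?S (orthant 0 {} (\<lambda>_. 0) d)"
    unfolding jump_sum_def by (intro ext sum.cong) (auto simp: orthant_def jumps_def jumpX_def)

  have cover: "emeasure (?m) UNIV = emeasure (?m) (orthant 0 {} (\<lambda>_. 0) d)"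
  proof -

    have 2: "({0<..} \<times> UNIV) \<times> {..<-d} = orthant 0 {} (\<lambda>_. 0) d" by (auto simp: orthant_def)
    have 3: "UNIV \<in> sets path_space" using sets.top[of path_space] by (simp add: space_PiM)
    have 4: "{0<..} \<inter> {0<..real K} = {0<..real K}" by auto
    show ?thesis
      using emeasure_mecke_Times[OF d _ 3, of UNIV UNIV K] emeasure_mecke_Times[OF d _ 3, of "{0<..}" "{..<-d}" K]
      unfolding 2[symmetric] by (simp add: 4)
  qed
  have UNIV_eq: "?S UNIV \<in> borel_measurable M"
    "(\<integral>\<^sup>+\<omega>. ?S UNIV \<omega> \<partial>M) = emeasure (?m) UNIV"
    unfolding whole cover by (rule mecke_orthant[OF d]; simp)+
  have pow: "orthants \<subseteq> Pow UNIV" by simp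
  from A have "A \<in> sigma_sets UNIV orthants" by (simp add: sig)
  with Int_stable_orthants pow show ?thesis
  proof (induction rule: sigma_sets_induct_disjoint)
    case (basic A)
    then show ?case using mecke_orthant[OF d] by (auto simp: orthants_def)
  next
    case empty
    then show ?case by (simp add: jump_sum_def)
  next
    case (compl A)
    then have [measurable]: "A \<in> sets jump_space" and IH: "?S A \<in> borel_measurable M"
      "(\<integral>\<^sup>+\<omega>. ?S A \<omega> \<partial>M) = emeasure (?m) A" by (simp_all add: sig)
    \<comment> \<open>Complements are formed by subtraction, which in \<open>ennreal\<close> calls
      for finiteness: pointwise since the jumps are finitely many, in the integrals since their
      number is integrable.\<close>
    have le: "?S A \<omega> \<le> ?S UNIV \<omega>" for \<omega>
      unfolding jump_sum_def by (intro sum_mono) (simp add: indicator_def)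
    have fin: "?S A \<omega> < top" for \<omega>
      by (rule le_less_trans[OF le]) (simp only: count ennreal_less_top)
    have sum: "?S UNIV \<omega> = ?S (UNIV - A) \<omega> + ?S A \<omega>" for \<omega>
      unfolding jump_sum_def sum.distrib[symmetric] by (intro sum.cong) (auto simp: indicator_def)
    have diff: "?S (UNIV - A) = (\<lambda>\<omega>. ?S UNIV \<omega> - ?S A \<omega>)"
      unfolding sum using fin by (intro ext) (simp add: ennreal_add_diff_cancel_right less_top[symmetric])
    have "(\<integral>\<^sup>+\<omega>. ?S (UNIV - A) \<omega> \<partial>M)
        = (\<integral>\<^sup>+\<omega>. ?S UNIV \<omega> \<partial>M) - (\<integral>\<^sup>+\<omega>. ?S A \<omega> \<partial>M)"
      unfolding diff
    proof (rule nn_integral_diff[OF UNIV_eq(1) IH(1)])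
      have "(\<integral>\<^sup>+\<omega>. ?S A \<omega> \<partial>M) \<le> (\<integral>\<^sup>+\<omega>. ?S UNIV \<omega> \<partial>M)"
        by (intro nn_integral_mono le)
      also have "\<dots> < \<infinity>" unfolding int_count by simp
      finally show "(\<integral>\<^sup>+\<omega>. ?S A \<omega> \<partial>M) \<noteq> \<infinity>" by simp
    qed (use le in auto)
    also have "\<dots> = emeasure (?m) (UNIV - A)"
    proof -
      have "emeasure (?m) A \<le> emeasure (?m) UNIV"
        unfolding IH(2)[symmetric] UNIV_eq(2)[symmetric] by (intro nn_integral_mono le)
      also have "\<dots> < \<infinity>" unfolding UNIV_eq(2)[symmetric] int_count by simp
      finally have "emeasure (?m) A \<noteq> \<infinity>" by simp
      moreover have "space (?m) = UNIV"
        unfolding sets_eq_imp_space_eq[OF sets_mecke_measure] by (auto simp: space_pair_measure space_PiM)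
      ultimately show ?thesis
        using emeasure_compl[of A "?m"] by (simp only: IH UNIV_eq) simp
    qed
    finally show ?case unfolding diff using UNIV_eq(1) IH(1) by auto
  next
    case (union A)
    then have [measurable]: "A i \<in> sets jump_space" for i by (auto simp: sig)
    have eq: "?S (\<Union>i. A i) = (\<lambda>\<omega>. \<Sum>i. ?S (A i) \<omega>)"
    proof
      fix \<omega>
      have "?S (\<Union>i. A i) \<omega>
          = (\<Sum>s\<in>jumps d K \<omega>. \<Sum>i. indicator (A i) ((s, dropped s \<omega>), jumpX s \<omega>))"
        unfolding jump_sum_def by (simp add: suminf_indicator[OF union(1)])
      also have "\<dots> = (\<Sum>i. \<Sum>s\<in>jumps d K \<omega>. indicator (A i) ((s, dropped s \<omega>), jumpX s \<omega>))"
        by (rule suminf_sum[symmetric]) simp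
      finally show "?S (\<Union>i. A i) \<omega> = (\<Sum>i. ?S (A i) \<omega>)"
        by (simp add: jump_sum_def)
    qed
    have "(\<integral>\<^sup>+\<omega>. ?S (\<Union>i. A i) \<omega> \<partial>M) = (\<Sum>i. emeasure (?m) (A i))"
      unfolding eq using union.IH by (subst nn_integral_suminf) auto
    also have "\<dots> = emeasure (?m) (\<Union>i. A i)"
      by (rule suminf_emeasure) (use union(1) in auto)
    finally show ?case unfolding eq using union.IH by (auto intro!: borel_measurable_suminf_order)
  qed
qed

text \<open>What is bounded are the jumps, with times up to \<open>K\<close> and sizes below
  \<open>-d\<close>; the functional \<open>F\<close> may be unbounded.\<close>

lemma mecke_bounded:
  assumes d: "0 < d" and F: "F \<in> borel_measurable jump_space"
  shows "jump_sum d K F \<in> borel_measurable M \<and>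
    (\<integral>\<^sup>+\<omega>. jump_sum d K F \<omega> \<partial>M) = (\<integral>\<^sup>+z. F z \<partial>mecke_measure d K)"
  using F
proof induction
  case (cong f g)
  have "f = g" using cong(3) by (auto simp: space_pair_measure space_PiM)
  then show ?case using cong by simp
next
  case (set A)
  then show ?case using mecke_set[OF d set] by simp
next
  case (mult u c)
  have "jump_sum d K (\<lambda>z. c * u z) = (\<lambda>\<omega>. c * jump_sum d K u \<omega>)"
    by (simp add: jump_sum_def[abs_def] sum_distrib_left)
  moreover have "jump_sum d K u \<in> borel_measurable M" using mult by simp
  ultimately show ?case using mult by (auto simp: nn_integral_cmult)
next
  case (add u v)
  have "jump_sum d K (\<lambda>z. v z + u z) = (\<lambda>\<omega>. jump_sum d K v \<omega> + jump_sum d K u \<omega>)"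
    by (simp add: jump_sum_def[abs_def] sum.distrib)
  moreover have "jump_sum d K u \<in> borel_measurable M" "jump_sum d K v \<in> borel_measurable M" using add by simp_all
  ultimately show ?case using add by (auto simp: nn_integral_add)
next
  case (seq U)
  have incU: "incseq U" by fact
  have Um[measurable]: "U i \<in> borel_measurable jump_space" for i by fact
  have IH: "jump_sum d K (U i) \<in> borel_measurable M"
    "(\<integral>\<^sup>+\<omega>. jump_sum d K (U i) \<omega> \<partial>M) = (\<integral>\<^sup>+z. U i z \<partial>mecke_measure d K)" for i
    using seq.IH by simp_all
  have mono: "incseq (\<lambda>i. U i z)" for z using incU unfolding incseq_def le_fun_def by blast
  have eq: "jump_sum d K (SUP i. U i) = (\<lambda>\<omega>. SUP i. jump_sum d K (U i) \<omega>)"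
    unfolding jump_sum_def by (intro ext) (simp add: image_comp ennreal_SUP_sum[OF mono, symmetric])
  have inc: "incseq (\<lambda>i. jump_sum d K (U i))"
    using incU unfolding incseq_def le_fun_def jump_sum_def by (auto intro!: sum_mono)
  have "(\<integral>\<^sup>+\<omega>. jump_sum d K (SUP i. U i) \<omega> \<partial>M) = (SUP i. \<integral>\<^sup>+\<omega>. jump_sum d K (U i) \<omega> \<partial>M)"
    unfolding eq by (intro nn_integral_monotone_convergence_SUP inc IH)
  also have "\<dots> = (SUP i. \<integral>\<^sup>+z. U i z \<partial>mecke_measure d K)" by (simp add: IH)
  also have "\<dots> = (\<integral>\<^sup>+z. (SUP i. U i z) \<partial>mecke_measure d K)"
    by (intro nn_integral_monotone_convergence_SUP[symmetric] incU) auto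
  finally show ?case unfolding eq using IH(1) by (auto simp: image_comp)
qed


section \<open>Sums over all downward jumps\<close>

definition jump_total :: "(coded_jump \<Rightarrow> ennreal) \<Rightarrow> 'a \<Rightarrow> ennreal" where
  "jump_total F \<omega> = (\<integral>\<^sup>+s. F ((s, dropped s \<omega>), jumpX s \<omega>) * indicator {s. 0 < s \<and> jumpX s \<omega> < 0} s \<partial>count_space UNIV)"

lemma SUP_indicator_incseq:
  fixes c :: ennreal
  assumes "incseq A"
  shows "(SUP l. c * indicator (A l) z) = c * indicator (\<Union>l. A l) z"
proof (rule antisym)
  show "(SUP l. c * indicator (A l) z) \<le> c * indicator (\<Union>l. A l) z"
    by (intro SUP_least mult_left_mono) (auto simp: indicator_def)
  show "c * indicator (\<Union>l. A l) z \<le> (SUP l. c * indicator (A l) z)"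
  proof (cases "z \<in> (\<Union>l. A l)")
    case True
    then obtain l where "z \<in> A l" by auto
    then show ?thesis using True by (intro SUP_upper2[of l]) auto
  qed simp
qed

text \<open>One parameter releases both the time horizon and the jump threshold, so that a single
  monotone limit suffices.\<close>

definition jump_window :: "nat \<Rightarrow> (real \<times> real) set" where
  "jump_window l = {0<..real l} \<times> {..<- (1 / Suc l)}"

lemma incseq_jump_window: "incseq jump_window"
proof (rule incseq_SucI)
  fix n
  have "1 / real (Suc (Suc n)) \<le> 1 / real (Suc n)" by (simp add: field_simps)
  then show "jump_window n \<subseteq> jump_window (Suc n)"
    unfolding jump_window_def by (auto simp del: of_nat_Suc)
qed

lemma UN_jump_window: "(\<Union>l. jump_window l) = {0<..} \<times> {..<0}"
proof (intro equalityI subsetI)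
  fix p :: "real \<times> real" assume "p \<in> {0<..} \<times> {..<0}"
  then obtain s y where p: "p = (s, y)" and s: "0 < s" "0 < - y" by auto
  obtain l1 where l1: "s < real l1" using reals_Archimedean2 by blast
  obtain l2 where l2: "1 / Suc l2 < - y" using reals_Archimedean[OF s(2)] by (auto simp: inverse_eq_divide)
  have "1 / real (Suc (max l1 l2)) \<le> 1 / Suc l2" by (simp add: field_simps)
  then have "p \<in> jump_window (max l1 l2)" using l1 l2 s by (auto simp: jump_window_def p)
  then show "p \<in> (\<Union>l. jump_window l)" by blast
qed (auto simp: jump_window_def intro: less_trans)

lemma jump_total_eq_SUP: "jump_total F \<omega> = (SUP l. jump_sum (1 / Suc l) l F \<omega>)"
  and incseq_jump_sum: "incseq (\<lambda>l. jump_sum (1 / Suc l) l F)"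
proof -
  let ?J = "\<lambda>l \<omega>. jumps (1 / Suc l) (real l) \<omega>"
  have J: "?J l \<omega> = {s. (s, jumpX s \<omega>) \<in> jump_window l}" for l \<omega>
    by (auto simp: jumps_def jumpX_def jump_window_def)
  have inc: "incseq (\<lambda>l. ?J l \<omega>)" for \<omega>
    using incseq_jump_window unfolding J incseq_def by blast
  have sum: "jump_sum (1 / Suc l) l F \<omega> =
      (\<integral>\<^sup>+s. F ((s, dropped s \<omega>), jumpX s \<omega>) * indicator (?J l \<omega>) s \<partial>count_space UNIV)" for l \<omega>
    unfolding jump_sum_def
    by (subst nn_integral_count_space'[where A="?J l \<omega>"]) (auto simp: finite_jumps)
  show "incseq (\<lambda>l. jump_sum (1 / Suc l) l F)"
    unfolding incseq_def le_fun_def sum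
  proof (intro allI impI nn_integral_mono mult_left_mono)
    fix m n :: nat and \<omega> s assume "m \<le> n"
    then show "indicator (?J m \<omega>) s \<le> (indicator (?J n \<omega>) s :: ennreal)"
      using incseqD[OF inc] by (auto simp: indicator_def simp del: of_nat_Suc)
  qed simp
  have "(\<Union>l. ?J l \<omega>) = {s. (s, jumpX s \<omega>) \<in> (\<Union>l. jump_window l)}" unfolding J by auto
  then have U: "(\<Union>l. ?J l \<omega>) = {s. 0 < s \<and> jumpX s \<omega> < 0}" unfolding UN_jump_window by simp
  show "jump_total F \<omega> = (SUP l. jump_sum (1 / Suc l) l F \<omega>)"
    unfolding jump_total_def sum U[symmetric] SUP_indicator_incseq[OF inc, symmetric]
    by (rule nn_integral_monotone_convergence_SUP)
       (use inc[of \<omega>] in \<open>auto simp: incseq_def le_fun_def indicator_def\<close>)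
qed

lemma jump_total_measurable:
  "F \<in> borel_measurable jump_space \<Longrightarrow> jump_total F \<in> borel_measurable M"
  unfolding jump_total_eq_SUP[abs_def] using mecke_bounded[of "1 / Suc _" F] by (intro borel_measurable_SUP) auto

text \<open>Since \<pi> may have infinite mass near 0, measurability in the parameter is obtained
  from the finite law of the large jumps.\<close>

lemma window_measurable:
  assumes F: "F \<in> borel_measurable jump_space"
  shows "(\<lambda>p. \<integral>\<^sup>+y. F (p, y) * indicator (jump_window l) (fst p, y) \<partial>\<pi>) \<in> borel_measurable time_path"
proof -
  interpret D: finite_measure "big_jump_law (1 / Suc l)" by (rule finite_big_jump_law) simp
  have F'[measurable]: "F \<in> borel_measurable (time_path \<Otimes>\<^sub>M big_jump_law (1 / Suc l))"
    using F by (simp cong: measurable_cong_sets sets_pair_measure_cong)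
  have [measurable]: "(\<lambda>y. F (p, y)) \<in> borel_measurable \<pi>" for p
    using measurable_compose[OF measurable_Pair1' F, of p] 
    by (simp add: space_pair_measure space_PiM cong: measurable_cong_sets)
  have eq: "(\<integral>\<^sup>+y. F (p, y) * indicator (jump_window l) (fst p, y) \<partial>\<pi>)
     = (\<integral>\<^sup>+y. F (p, y) \<partial>big_jump_law (1 / Suc l)) * indicator {0<..real l} (fst p)" for p
  proof -
    have "(\<integral>\<^sup>+y. F (p, y) * indicator (jump_window l) (fst p, y) \<partial>\<pi>)
       = (\<integral>\<^sup>+y. (indicator {..<- (1 / Suc l)} y * F (p, y)) * indicator {0<..real l} (fst p) \<partial>\<pi>)"
      by (intro nn_integral_cong) (auto simp: jump_window_def indicator_def)
    also have "\<dots> = (\<integral>\<^sup>+y. indicator {..<- (1 / Suc l)} y * F (p, y) \<partial>\<pi>) * indicator {0<..real l} (fst p)"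
      by (rule nn_integral_multc) measurable
    finally show ?thesis
      unfolding big_jump_law_def by (simp add: nn_integral_density)
  qed
  show ?thesis
    unfolding eq using D.borel_measurable_nn_integral_fst[OF F'] by measurable
qed

lemma nn_integral_mecke_measure:
  assumes F[measurable]: "F \<in> borel_measurable jump_space"
  shows "(\<integral>\<^sup>+z. F z \<partial>mecke_measure (1 / Suc l) l)
    = (\<integral>\<^sup>+s. \<integral>\<^sup>+\<omega>. \<integral>\<^sup>+y. F ((s, coded \<omega>), y) * indicator (jump_window l) (s, y) \<partial>\<pi> \<partial>M \<partial>lborel)"
proof -
  let ?H = "\<lambda>s \<omega>. \<integral>\<^sup>+y. F ((s, coded \<omega>), y) * indicator (jump_window l) (s, y) \<partial>\<pi>"
  let ?d = "1 / real (Suc l)"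
  let ?T = "density lborel (indicator {0<..real l})"
  interpret L: prob_space path_law by (rule prob_space_path_law)
  interpret D: finite_measure "big_jump_law ?d" by (rule finite_big_jump_law) simp
  have F'[measurable]: "F \<in> borel_measurable ((?T \<Otimes>\<^sub>M path_law) \<Otimes>\<^sub>M big_jump_law ?d)"
    using F by (simp cong: measurable_cong_sets sets_pair_measure_cong)
  let ?G = "\<lambda>p. \<integral>\<^sup>+y. F (p, y) \<partial>big_jump_law ?d"
  have G: "?G \<in> borel_measurable (?T \<Otimes>\<^sub>M path_law)"
    by (rule D.borel_measurable_nn_integral_fst[OF F'])
  have G'[measurable]: "?G \<in> borel_measurable time_path"
    using G by (simp cong: measurable_cong_sets sets_pair_measure_cong)
  have Fy[measurable]: "(\<lambda>y. F (p, y)) \<in> borel_measurable \<pi>" for p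
    using measurable_compose[OF measurable_Pair1' F, of p] 
    by (simp add: space_pair_measure space_PiM cong: measurable_cong_sets)
  have "(\<integral>\<^sup>+z. F z \<partial>mecke_measure ?d l) = (\<integral>\<^sup>+p. ?G p \<partial>(?T \<Otimes>\<^sub>M path_law))"
    unfolding mecke_measure_def by (rule D.nn_integral_fst[OF F', symmetric])
  also have "\<dots> = (\<integral>\<^sup>+s. \<integral>\<^sup>+w. ?G (s, w) \<partial>path_law \<partial>?T)"
    by (rule L.nn_integral_fst[OF G, symmetric])
  also have "\<dots> = (\<integral>\<^sup>+s. indicator {0<..real l} s * (\<integral>\<^sup>+w. ?G (s, w) \<partial>path_law) \<partial>lborel)"
    by (subst nn_integral_density) (use L.borel_measurable_nn_integral_fst[OF G] in \<open>simp_all cong: measurable_cong_sets\<close>)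
  also have "\<dots> = (\<integral>\<^sup>+s. \<integral>\<^sup>+\<omega>. ?H s \<omega> \<partial>M \<partial>lborel)"
  proof (rule nn_integral_cong)
    fix s :: real
    have Gs[measurable]: "(\<lambda>w. ?G (s, w)) \<in> borel_measurable path_space"
      by (rule measurable_compose[OF _ G']) measurable
    have "indicator {0<..real l} s * (\<integral>\<^sup>+w. ?G (s, w) \<partial>path_law) = indicator {0<..real l} s * (\<integral>\<^sup>+\<omega>. ?G (s, coded \<omega>) \<partial>M)"
    proof -
      have "(\<lambda>w. ?G (s, w)) \<in> borel_measurable (distr M path_space coded)"
        using Gs by (simp only: measurable_distr_eq1)
      from nn_integral_distr[OF coded_measurable this] show ?thesis unfolding path_law_def by simp
    qed
    also have "\<dots> = (\<integral>\<^sup>+\<omega>. indicator {0<..real l} s * ?G (s, coded \<omega>) \<partial>M)"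
      using measurable_compose[OF coded_measurable Gs] by (simp add: nn_integral_cmult)
    also have "\<dots> = (\<integral>\<^sup>+\<omega>. ?H s \<omega> \<partial>M)"
    proof (rule nn_integral_cong)
      fix \<omega>
      have "indicator {0<..real l} s * ?G (s, coded \<omega>) =
          indicator {0<..real l} s * (\<integral>\<^sup>+y. indicator {..<-?d} y * F ((s, coded \<omega>), y) \<partial>\<pi>)"
        unfolding big_jump_law_def by (subst nn_integral_density) auto
      also have "\<dots> = (\<integral>\<^sup>+y. indicator {0<..real l} s * (indicator {..<-?d} y * F ((s, coded \<omega>), y)) \<partial>\<pi>)"
        by (rule nn_integral_cmult[symmetric]) measurable
      also have "\<dots> = ?H s \<omega>"
        by (intro nn_integral_cong) (auto simp: jump_window_def indicator_def)
      finally show "indicator {0<..real l} s * ?G (s, coded \<omega>) =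
        ?H s \<omega>" .
    qed
    finally show "indicator {0<..real l} s * (\<integral>\<^sup>+w. ?G (s, w) \<partial>path_law) =
      (\<integral>\<^sup>+\<omega>. ?H s \<omega> \<partial>M)" .
  qed
  finally show ?thesis .
qed

text \<open>Monotone convergence, once for each of the three integrals; the order of integration
  remains that of the finite truncations.\<close>

theorem mecke_formula:
  assumes F[measurable]: "F \<in> borel_measurable jump_space"
  shows "(\<integral>\<^sup>+\<omega>. jump_total F \<omega> \<partial>M)
    = (\<integral>\<^sup>+s. \<integral>\<^sup>+\<omega>. \<integral>\<^sup>+y. F ((s, coded \<omega>), y) * indicator ({0<..} \<times> {..<0}) (s, y) \<partial>\<pi> \<partial>M \<partial>lborel)"
proof -
  let ?I = "\<lambda>l p. \<integral>\<^sup>+y. F (p, y) * indicator (jump_window l) (fst p, y) \<partial>\<pi>"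
  have Im[measurable]: "?I l \<in> borel_measurable time_path" for l
    by (rule window_measurable[OF F])
  have le: "F z * indicator (jump_window l) p \<le> F z * indicator (jump_window m) p" if "l \<le> m" for l m z p
    using incseq_jump_window that by (intro mult_left_mono) (auto simp: incseq_def indicator_def)
  have Fy[measurable]: "(\<lambda>y. F (p, y)) \<in> borel_measurable \<pi>" for p
    using measurable_compose[OF measurable_Pair1' F, of p] 
    by (simp add: space_pair_measure space_PiM cong: measurable_cong_sets)
  have [measurable]: "(\<lambda>y. indicator (jump_window l) (s, y) :: ennreal) \<in> borel_measurable \<pi>" for l s
  proof -
    have "(\<lambda>y. indicator (jump_window l) (s, y) :: ennreal) \<in> borel_measurable borel"
      unfolding jump_window_def indicator_times fst_conv snd_conv by measurable
    then show ?thesis by (simp cong: measurable_cong_sets)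
  qed
  have I\<omega>[measurable]: "(\<lambda>\<omega>. ?I l (s, coded \<omega>)) \<in> borel_measurable M" for l s
    by (rule measurable_compose[OF _ Im]) measurable
  have Ism: "(\<lambda>p. ?I l (fst p, coded (snd p))) \<in> borel_measurable (borel \<Otimes>\<^sub>M M)" for l
  proof -
    have "(\<lambda>p. (fst p, coded (snd p))) \<in> measurable (borel \<Otimes>\<^sub>M M) time_path" by measurable
    from measurable_compose[OF this Im] show ?thesis .
  qed
  have Is: "(\<lambda>s. \<integral>\<^sup>+\<omega>. ?I l (s, coded \<omega>) \<partial>M) \<in> borel_measurable lborel" for l
    using borel_measurable_nn_integral_fst[OF Ism] by simp
  have "(\<integral>\<^sup>+\<omega>. jump_total F \<omega> \<partial>M) = (SUP l. \<integral>\<^sup>+\<omega>. jump_sum (1 / Suc l) l F \<omega> \<partial>M)"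
    unfolding jump_total_eq_SUP
    by (rule nn_integral_monotone_convergence_SUP[OF incseq_jump_sum]) (use mecke_bounded[OF _ F] in simp)
  also have "\<dots> = (SUP l. \<integral>\<^sup>+s. \<integral>\<^sup>+\<omega>. ?I l (s, coded \<omega>) \<partial>M \<partial>lborel)"
    using mecke_bounded[OF _ F] by (simp add: nn_integral_mecke_measure del: of_nat_Suc)
  also have "\<dots> = (\<integral>\<^sup>+s. (SUP l. \<integral>\<^sup>+\<omega>. ?I l (s, coded \<omega>) \<partial>M) \<partial>lborel)"
    by (rule nn_integral_monotone_convergence_SUP[symmetric])
       (auto simp: incseq_def le_fun_def intro!: nn_integral_mono le Is[simplified])
  also have "\<dots> = (\<integral>\<^sup>+s. \<integral>\<^sup>+\<omega>. (SUP l. ?I l (s, coded \<omega>)) \<partial>M \<partial>lborel)"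
    by (intro nn_integral_cong nn_integral_monotone_convergence_SUP[symmetric])
       (auto simp: incseq_def le_fun_def intro!: nn_integral_mono le I\<omega>[simplified])
  also have "\<dots> = (\<integral>\<^sup>+s. \<integral>\<^sup>+\<omega>. \<integral>\<^sup>+y. (SUP l. F ((s, coded \<omega>), y) * indicator (jump_window l) (s, y)) \<partial>\<pi> \<partial>M \<partial>lborel)"
    by (intro nn_integral_cong, simp only: fst_conv, intro nn_integral_monotone_convergence_SUP[symmetric])
       (auto simp: incseq_def le_fun_def intro!: le)
  also have "\<dots> = (\<integral>\<^sup>+s. \<integral>\<^sup>+\<omega>. \<integral>\<^sup>+y. F ((s, coded \<omega>), y) * indicator ({0<..} \<times> {..<0}) (s, y) \<partial>\<pi> \<partial>M \<partial>lborel)"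
    by (simp only: SUP_indicator_incseq[OF incseq_jump_window] UN_jump_window)
  finally show ?thesis .
qed

text \<open>The jump variable is integrated out: the condition that the jump is at most
  \<open>-v\<close> produces the tail of \<pi>. As \<open>v\<close> is positive wherever
  \<open>B\<close> does not vanish, such a jump is automatically downward.\<close>

lemma mecke_kill:
  assumes B[measurable]: "B \<in> borel_measurable time_path"
    and v[measurable]: "v \<in> borel_measurable time_path"
    and pos: "\<And>p. B p \<noteq> 0 \<Longrightarrow> 0 < v p"
  shows "(\<integral>\<^sup>+\<omega>. (\<integral>\<^sup>+s. B (s, dropped s \<omega>) *
      indicator {s. 0 < s \<and> jumpX s \<omega> \<le> - v (s, dropped s \<omega>)} s \<partial>count_space UNIV) \<partial>M)
    = (\<integral>\<^sup>+s. \<integral>\<^sup>+\<omega>. B (s, coded \<omega>) * lower_tail \<pi> (- v (s, coded \<omega>)) * indicator {0<..} s \<partial>M \<partial>lborel)"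
proof -
  define F :: "coded_jump \<Rightarrow> ennreal" where "F z = B (fst z) * indicator {..- v (fst z)} (snd z)" for z
  have Fm: "F \<in> borel_measurable jump_space"
  proof -
    have "F = (\<lambda>z. B (fst z) * indicator {z. snd z \<le> - v (fst z)} z)"
      by (simp add: F_def fun_eq_iff indicator_def)
    also have "\<dots> \<in> borel_measurable jump_space"
    proof (intro borel_measurable_times_ennreal borel_measurable_indicator)
      have "{z \<in> space jump_space. snd z \<le> - v (fst z)} \<in> sets jump_space" by measurable
      then show "{z. snd z \<le> - v (fst z)} \<in> sets jump_space" by (simp add: space_pair_measure space_PiM)
    qed measurable
    finally show ?thesis .
  qed
  have "B (s, dropped s \<omega>) * indicator {s. 0 < s \<and> jumpX s \<omega> \<le> - v (s, dropped s \<omega>)} s =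
      F ((s, dropped s \<omega>), jumpX s \<omega>) * indicator {s. 0 < s \<and> jumpX s \<omega> < 0} s" for s \<omega>
    using pos[of "(s, dropped s \<omega>)"] by (cases "B (s, dropped s \<omega>) = 0") (auto simp: F_def indicator_def)
  then have "(\<integral>\<^sup>+\<omega>. (\<integral>\<^sup>+s. B (s, dropped s \<omega>) *
      indicator {s. 0 < s \<and> jumpX s \<omega> \<le> - v (s, dropped s \<omega>)} s \<partial>count_space UNIV) \<partial>M)
      = (\<integral>\<^sup>+\<omega>. jump_total F \<omega> \<partial>M)"
    by (simp add: jump_total_def)
  also have "\<dots> = (\<integral>\<^sup>+s. \<integral>\<^sup>+\<omega>. \<integral>\<^sup>+y. F ((s, coded \<omega>), y) * indicator ({0<..} \<times> {..<0}) (s, y) \<partial>\<pi> \<partial>M \<partial>lborel)"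
    by (rule mecke_formula[OF Fm])
  also have "\<dots> = (\<integral>\<^sup>+s. \<integral>\<^sup>+\<omega>. B (s, coded \<omega>) * lower_tail \<pi> (- v (s, coded \<omega>)) * indicator {0<..} s \<partial>M \<partial>lborel)"
  proof (intro nn_integral_cong)
    fix s :: real and \<omega>
    let ?p = "(s, coded \<omega>)"
    have "(\<integral>\<^sup>+y. F (?p, y) * indicator ({0<..} \<times> {..<0}) (s, y) \<partial>\<pi>)
        = (\<integral>\<^sup>+y. (B ?p * indicator {0<..} s) * indicator {..- v ?p} y \<partial>\<pi>)"
      using pos[of ?p] by (intro nn_integral_cong) (cases "B ?p = 0", auto simp: F_def indicator_def)
    also have "\<dots> = (B ?p * indicator {0<..} s) * lower_tail \<pi> (- v ?p)"
      unfolding lower_tail_def by (subst nn_integral_cmult_indicator) auto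
    finally show "(\<integral>\<^sup>+y. F (?p, y) * indicator ({0<..} \<times> {..<0}) (s, y) \<partial>\<pi>)
      = B ?p * lower_tail \<pi> (- v ?p) * indicator {0<..} s" by (simp add: mult_ac)
  qed
  finally show ?thesis .
qed

text \<open>The expected number of jump times \<open>s\<close> at which \<open>s\<close> and the
  path without its jump hit \<open>B\<close> is 0 by the formula, so almost surely there is none.
  All statements about exceptional paths are reduced to this one.\<close>

lemma mecke_null:
  assumes B[measurable]: "B \<in> sets time_path"
    and null: "AE s in lborel. AE \<omega> in M. (s, coded \<omega>) \<notin> B"
  shows "AE \<omega> in M. \<forall>s>0. jumpX s \<omega> < 0 \<longrightarrow> (s, dropped s \<omega>) \<notin> B"
proof -
  define F :: "coded_jump \<Rightarrow> ennreal" where "F z = indicator B (fst z)" for z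
  have Fm: "F \<in> borel_measurable jump_space" unfolding F_def by measurable
  have "(\<integral>\<^sup>+\<omega>. jump_total F \<omega> \<partial>M) = (\<integral>\<^sup>+s. \<integral>\<^sup>+\<omega>. \<integral>\<^sup>+y. F ((s, coded \<omega>), y) * indicator ({0<..} \<times> {..<0}) (s, y) \<partial>\<pi> \<partial>M \<partial>lborel)"
    by (rule mecke_formula[OF Fm])
  also have "\<dots> = (\<integral>\<^sup>+s. \<integral>\<^sup>+\<omega>. 0 \<partial>M \<partial>(lborel :: real measure))"
  proof (rule nn_integral_cong_AE)
    show "AE s in lborel. (\<integral>\<^sup>+\<omega>. \<integral>\<^sup>+y. F ((s, coded \<omega>), y) * indicator ({0<..} \<times> {..<0}) (s, y) \<partial>\<pi> \<partial>M) = (\<integral>\<^sup>+\<omega>. 0 \<partial>M)"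
      using null
    proof eventually_elim
      fix s assume "AE \<omega> in M. (s, coded \<omega>) \<notin> B"
      then show "(\<integral>\<^sup>+\<omega>. \<integral>\<^sup>+y. F ((s, coded \<omega>), y) * indicator ({0<..} \<times> {..<0}) (s, y) \<partial>\<pi> \<partial>M) = (\<integral>\<^sup>+\<omega>. 0 \<partial>M)"
        by (intro nn_integral_cong_AE) (auto simp: F_def)
    qed
  qed
  finally have "(\<integral>\<^sup>+\<omega>. jump_total F \<omega> \<partial>M) = 0" by simp
  then have "AE \<omega> in M. jump_total F \<omega> = 0"
    using jump_total_measurable[OF Fm] by (simp add: nn_integral_0_iff_AE)
  then show ?thesis
  proof eventually_elim
    fix \<omega> assume "jump_total F \<omega> = 0"
    then have "AE s in count_space UNIV. F ((s, dropped s \<omega>), jumpX s \<omega>) * indicator {s. 0 < s \<and> jumpX s \<omega> < 0} s = 0"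
      unfolding jump_total_def by (subst (asm) nn_integral_0_iff_AE) auto
    then show "\<forall>s>0. jumpX s \<omega> < 0 \<longrightarrow> (s, dropped s \<omega>) \<notin> B"
      by (auto simp: AE_count_space F_def indicator_def split: if_splits)
  qed
qed

end

subsection \<open>Coded paths\<close>

text \<open>Limits along a fixed dyadic sequence, hence jointly measurable in time and code. On
  codes of cadlag paths they recover the path and, for \<open>left_val\<close>, its left limits;
  elsewhere \<open>lim\<close> may be arbitrary.\<close>

definition val :: "code \<Rightarrow> real \<Rightarrow> real" where
  "val z s = lim (\<lambda>m. z (dyadic_above s m))"

definition left_val :: "code \<Rightarrow> real \<Rightarrow> real" where
  "left_val z s = lim (\<lambda>m. z (m, cell m s))"

text \<open>A uniform lower bound instead of positivity at each time: it passes from dyadic times to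
  their limits, whereas a strict inequality would not. It also rules out a left limit 0.\<close>

definition positive_upto :: "(real \<Rightarrow> real) \<Rightarrow> real \<Rightarrow> bool" where
  "positive_upto w s \<longleftrightarrow> (\<exists>e>0. \<forall>u. 0 \<le> u \<and> u \<le> s \<longrightarrow> e \<le> w u)"

text \<open>The value at \<open>s\<close> has to be required separately, as dyadic times up to
  \<open>s\<close> approach \<open>s\<close> only from the left.\<close>

definition alive :: "code \<Rightarrow> real \<Rightarrow> bool" where
  "alive z s \<longleftrightarrow> (\<exists>k::nat. (\<forall>q. dyp q \<le> s \<longrightarrow> 1 / Suc k \<le> z q) \<and> 1 / Suc k \<le> val z s)"

text \<open>The length of the initial interval on which the path stays away from \<open>0\<close>.
  Written as an integral, its measurability is part of Fubini's theorem.\<close>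

definition life :: "code \<Rightarrow> ennreal" where
  "life z = (\<integral>\<^sup>+s. indicator {s. 0 \<le> s \<and> alive z s} s \<partial>lborel)"

text \<open>The default 0 makes \<open>revive\<close> the identity when the life is empty or
  infinite; in particular nothing is removed at time 0.\<close>

definition gap :: "code \<Rightarrow> real" where
  "gap z = (if life z = 0 \<or> life z = \<infinity> then 0
     else val z (enn2real (life z)) - left_val z (enn2real (life z)))"

definition revive :: "code \<Rightarrow> code" where
  "revive z q = z q - (if ennreal (dyp q) < life z then 0 else gap z)"

text \<open>Only for regular paths does \<^const>\<open>life\<close> agree with the first passage time:
  it excludes paths which jump away from a left limit \<open>0\<close>.\<close>

definition regular :: "code \<Rightarrow> bool" where
  "regular z \<longleftrightarrow> (0 < life z \<and> life z < \<infinity> \<and> left_val z (enn2real (life z)) = 0 \<longrightarrow> gap z = 0)"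

lemma val_measurable [measurable]: "(\<lambda>p. val (snd p) (fst p)) \<in> borel_measurable time_path"
  unfolding val_def
proof (rule borel_measurable_lim_metric)
  fix m
  have "(\<lambda>p. dyadic_above (fst p) m) \<in> measurable time_path (count_space UNIV)"
    unfolding dyadic_above_def by measurable
  then show "(\<lambda>p. snd p (dyadic_above (fst p) m)) \<in> borel_measurable time_path"
    by (rule measurable_compose_countable[rotated]) measurable
qed

lemma left_val_measurable [measurable]: "(\<lambda>p. left_val (snd p) (fst p)) \<in> borel_measurable time_path"
  unfolding left_val_def
proof (rule borel_measurable_lim_metric)
  fix m
  have "(\<lambda>p. (m, cell m (fst p))) \<in> measurable time_path (count_space UNIV)"
    unfolding cell_def by measurable
  then show "(\<lambda>p. snd p (m, cell m (fst p))) \<in> borel_measurable time_path"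
    by (rule measurable_compose_countable[rotated]) measurable
qed

lemma alive_measurable [measurable]: "Measurable.pred time_path (\<lambda>p. alive (snd p) (fst p))"
  unfolding alive_def by measurable

lemma pair_path_measurable:
  assumes "f \<in> borel_measurable time_path" "g \<in> borel_measurable N" "h \<in> measurable N path_space"
  shows "(\<lambda>x. f (g x, h x)) \<in> borel_measurable N"
  by (rule measurable_compose[OF measurable_Pair[OF assms(2,3)] assms(1)])

lemma alive_compose [measurable]:
  assumes [measurable]: "g \<in> borel_measurable N" "h \<in> measurable N path_space"
  shows "Measurable.pred N (\<lambda>x. alive (h x) (g x))"
  using measurable_compose[OF measurable_Pair[OF assms] alive_measurable] by simp

lemma val_compose [measurable]:
  assumes [measurable]: "g \<in> borel_measurable N" "h \<in> measurable N path_space"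
  shows "(\<lambda>x. val (h x) (g x)) \<in> borel_measurable N"
  using pair_path_measurable[OF val_measurable assms] by simp

lemma left_val_compose [measurable]:
  assumes [measurable]: "g \<in> borel_measurable N" "h \<in> measurable N path_space"
  shows "(\<lambda>x. left_val (h x) (g x)) \<in> borel_measurable N"
  using pair_path_measurable[OF left_val_measurable assms] by simp

lemma life_measurable [measurable]: "life \<in> borel_measurable path_space"
proof -
  have "(\<lambda>p. indicator {p. 0 \<le> snd p \<and> alive (fst p) (snd p)} p :: ennreal) \<in> borel_measurable (path_space \<Otimes>\<^sub>M lborel)"
  proof (rule borel_measurable_indicator)
    have "{p \<in> space (path_space \<Otimes>\<^sub>M lborel). 0 \<le> snd p \<and> alive (fst p) (snd p)} \<in> sets (path_space \<Otimes>\<^sub>M (lborel :: real measure))"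
      by measurable
    then show "{p. 0 \<le> snd p \<and> alive (fst p) (snd p)} \<in> sets (path_space \<Otimes>\<^sub>M lborel)"
      by (simp add: space_pair_measure space_PiM)
  qed
  from lborel.borel_measurable_nn_integral_fst[OF this] show ?thesis
    by (simp add: life_def[abs_def] indicator_def)
qed

lemma gap_measurable [measurable]: "gap \<in> borel_measurable path_space"
  unfolding gap_def[abs_def] by measurable

lemma revive_measurable [measurable]: "revive \<in> measurable path_space path_space"
proof -
  have "(\<lambda>z q. z q - (if ennreal (dyp q) < life z then 0 else gap z)) \<in> measurable path_space path_space"
    by (rule measurable_PiM_single') auto
  then show ?thesis by (simp add: revive_def[abs_def])
qed

lemma regular_measurable [measurable]: "Measurable.pred path_space regular"
  unfolding regular_def[abs_def] by measurable

subsection \<open>Coding of cadlag paths\<close>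

lemma val_enc:
  assumes "cadlag w" "0 \<le> s"
  shows "val (enc w) s = w s"
  unfolding val_def enc_def
  by (intro limI cadlag_tendsto_right[OF assms] dyadic_above_tendsto less_imp_le dyadic_above_bounds assms)

lemma left_val_enc:
  assumes "cadlag w" "0 < s"
  shows "left_val (enc w) s = w s - jump w s"
  unfolding left_val_def enc_def dyp_def fst_conv snd_conv
  by (intro limI cadlag_tendsto_left[OF assms] dy_cell_tendsto cell_bounds assms)

lemma alive_enc:
  assumes w: "cadlag w" and s: "0 \<le> s"
  shows "alive (enc w) s \<longleftrightarrow> positive_upto w s"
proof
  assume "alive (enc w) s"
  then obtain k :: nat where k: "\<And>q. dyp q \<le> s \<Longrightarrow> 1 / Suc k \<le> w (dyp q)" "1 / Suc k \<le> w s"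
    unfolding alive_def by (auto simp: val_enc[OF w s] enc_def)
  have "1 / Suc k \<le> w u" if "0 \<le> u" "u \<le> s" for u
  proof (cases "u = s")
    case False
    then have "u < s" using that by simp
    have "(\<lambda>n. w (dyp (dyadic_above u n))) \<longlonglongrightarrow> w u"
      by (intro cadlag_tendsto_right[OF w] dyadic_above_tendsto less_imp_le dyadic_above_bounds that)
    moreover have "\<forall>\<^sub>F n in sequentially. 1 / Suc k \<le> w (dyp (dyadic_above u n))"
      using order_tendstoD(2)[OF dyadic_above_tendsto[OF \<open>0 \<le> u\<close>] \<open>u < s\<close>]
      by eventually_elim (intro k, simp)
    ultimately show ?thesis by (rule tendsto_lowerbound) simp
  qed (use k in simp)
  then show "positive_upto w s"
    unfolding positive_upto_def by (intro exI[of _ "1 / Suc k"]) auto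
next
  assume "positive_upto w s"
  then obtain e where e: "0 < e" "\<And>u. 0 \<le> u \<Longrightarrow> u \<le> s \<Longrightarrow> e \<le> w u" by (auto simp: positive_upto_def)
  obtain k where k: "1 / Suc k < e" using reals_Archimedean[OF e(1)] by (auto simp: inverse_eq_divide)
  have "1 / Suc k \<le> w u" if "0 \<le> u" "u \<le> s" for u using e(2)[OF that] k by linarith
  then show "alive (enc w) s"
    unfolding alive_def using s by (intro exI[of _ k]) (auto simp: val_enc[OF w s] enc_def)
qed

lemma positive_upto_mono: "positive_upto w s \<Longrightarrow> u \<le> s \<Longrightarrow> positive_upto w u"
  unfolding positive_upto_def by (meson order_trans)

lemma positive_upto_pos: "positive_upto w s \<Longrightarrow> 0 \<le> u \<Longrightarrow> u \<le> s \<Longrightarrow> 0 < w u"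
  unfolding positive_upto_def by (meson less_le_trans)

lemma positive_upto_cong:
  "(\<And>u. 0 \<le> u \<Longrightarrow> u \<le> s \<Longrightarrow> v u = w u) \<Longrightarrow> positive_upto v s \<longleftrightarrow> positive_upto w s"
  by (auto simp: positive_upto_def)

text \<open>By right continuity the path stays above \<open>e / 2\<close> a little longer. The set
  of good times is thus open to the right, and the end of a life is never one of them.\<close>

lemma positive_upto_extend:
  assumes w: "cadlag w" and s: "0 \<le> s" and "positive_upto w s"
  obtains s' where "s < s'" "positive_upto w s'"
proof -
  obtain e where e: "0 < e" "\<And>u. 0 \<le> u \<Longrightarrow> u \<le> s \<Longrightarrow> e \<le> w u"
    using assms(3) by (auto simp: positive_upto_def)
  obtain \<eta> where \<eta>: "0 < \<eta>" "\<And>v. s \<le> v \<Longrightarrow> v < s + \<eta> \<Longrightarrow> \<bar>w v - w s\<bar> < e / 2"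
    using cadlag_near[OF w s, of "e/2"] e by (metis half_gt_zero)
  have "e / 2 \<le> w u" if "0 \<le> u" "u \<le> s + \<eta> / 2" for u
  proof (cases "u \<le> s")
    case True
    then show ?thesis using e(2)[of u] e(1) that by simp
  next
    case False
    then have "\<bar>w u - w s\<bar> < e / 2" using that \<eta> by (intro \<eta>(2)) auto
    then show ?thesis using e(2)[of s] s by linarith
  qed
  then have "positive_upto w (s + \<eta> / 2)"
    unfolding positive_upto_def using e(1) by (intro exI[of _ "e/2"]) auto
  then show ?thesis using that[of "s + \<eta>/2"] \<eta>(1) by simp
qed

text \<open>Close to \<open>T\<close> the path is near its positive left limit; up to some earlier
  time \<open>u\<close> the bound for \<open>u\<close> applies. Together they give one bound on all
  of \<open>[0, T)\<close>.\<close>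

lemma positive_before:
  assumes w: "cadlag w" and T: "0 < T" and pos: "\<And>u. 0 \<le> u \<Longrightarrow> u < T \<Longrightarrow> positive_upto w u"
    and l: "0 < w T - jump w T"
  obtains e where "0 < e" "\<And>u. 0 \<le> u \<Longrightarrow> u < T \<Longrightarrow> e \<le> w u"
proof -
  define l where "l = w T - jump w T"
  obtain \<eta> where \<eta>: "0 < \<eta>" "\<And>v. 0 \<le> v \<Longrightarrow> T - \<eta> < v \<Longrightarrow> v < T \<Longrightarrow> \<bar>w v - l\<bar> < l / 2"
    using cadlag_near[OF w, of T "l/2"] T l unfolding l_def by (metis half_gt_zero less_imp_le)
  define u where "u = max 0 (T - \<eta> / 2)"
  have u: "0 \<le> u" "u < T" using T \<eta> by (auto simp: u_def)
  obtain e where e: "0 < e" "\<And>v. 0 \<le> v \<Longrightarrow> v \<le> u \<Longrightarrow> e \<le> w v"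
    using pos[OF u] by (auto simp: positive_upto_def)
  show ?thesis
  proof (rule that[of "min e (l / 2)"])
    show "0 < min e (l / 2)" using e l by (simp add: l_def)
    fix v assume v: "0 \<le> v" "v < T"
    show "min e (l / 2) \<le> w v"
    proof (cases "v \<le> u")
      case True
      then show ?thesis using e(2)[OF v(1)] by simp
    next
      case False
      then have "T - \<eta> < v" using \<eta>(1) by (simp add: u_def)
      then have "\<bar>w v - l\<bar> < l / 2" by (rule \<eta>(2)[OF v(1) _ v(2)])
      then have "l / 2 \<le> w v" by linarith
      then show ?thesis by simp
    qed
  qed
qed

text \<open>The good times form a set closed downwards and open to the right: empty,
  \<open>[0, Sup S)\<close> or the whole half-line. Membership can therefore be read off its length,
  which is \<open>life\<close>.\<close>

lemma positive_upto_iff_less_life: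
  assumes w: "cadlag w" and s: "0 \<le> s"
  shows "positive_upto w s \<longleftrightarrow> ennreal s < life (enc w)"
proof -
  define S where "S = {s. 0 \<le> s \<and> positive_upto w s}"
  have life: "life (enc w) = emeasure lborel S" if "S \<in> sets lborel"
  proof -
    have "{s. 0 \<le> s \<and> alive (enc w) s} = S" by (auto simp: S_def alive_enc[OF w])
    then show ?thesis using that by (simp add: life_def)
  qed
  have down: "u \<in> S" if "v \<in> S" "0 \<le> u" "u \<le> v" for u v
    using that positive_upto_mono[of w v u] by (auto simp: S_def)
  consider "S = {}" | "S \<noteq> {}" "bdd_above S" | "\<not> bdd_above S"
    by metis
  then have "s \<in> S \<longleftrightarrow> ennreal s < life (enc w)"
  proof cases
    case 1
    then show ?thesis using life by simp
  next
    case 2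
    have "S = {0..<Sup S}"
    proof (intro equalityI subsetI)
      fix u assume u: "u \<in> S"
      then obtain u' where "u < u'" "positive_upto w u'"
        using positive_upto_extend[OF w, of u] by (auto simp: S_def)
      then have "u' \<in> S" using u by (simp add: S_def)
      then have "u' \<le> Sup S" using 2 by (intro cSup_upper)
      then show "u \<in> {0..<Sup S}" using u \<open>u < u'\<close> by (simp add: S_def)
    next
      fix u assume u: "u \<in> {0..<Sup S}"
      then obtain v where "v \<in> S" "u < v" using 2 less_cSup_iff[of S u] by auto
      then show "u \<in> S" using u by (intro down[of v u]) auto
    qed
    moreover have "0 \<le> Sup S"
    proof -
      obtain u where "u \<in> S" using 2 by auto
      then show ?thesis using cSup_upper[OF _ 2(2), of u] by (simp add: S_def)
    qed
    moreover have "life (enc w) = emeasure lborel S"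
      by (rule life) (metis \<open>S = {0..<Sup S}\<close> atLeastLessThan_borel sets_lborel)
    ultimately have "life (enc w) = ennreal (Sup S)"
      by (metis diff_zero emeasure_lborel_Ico)
    then show ?thesis using s \<open>S = {0..<Sup S}\<close> \<open>0 \<le> Sup S\<close>
      by (metis atLeastLessThan_iff ennreal_less_iff)
  next
    case 3
    have S: "S = {0..}"
    proof (intro equalityI subsetI)
      fix u :: real assume u: "u \<in> {0..}"
      obtain v where "v \<in> S" "u < v" using 3 by (auto simp: bdd_above_def not_le)
      then show "u \<in> S" using u by (intro down[of v u]) auto
    qed (simp add: S_def)
    have ge: "ennreal (real n) \<le> emeasure lborel S" for n
    proof -
      have "emeasure lborel {0..real n} \<le> emeasure lborel S" unfolding S by (intro emeasure_mono) auto
      then show ?thesis by simp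
    qed
    have "emeasure lborel S = \<infinity>"
    proof (cases "emeasure lborel S")
      case (real r)
      obtain n where "r < real n" using reals_Archimedean2 by blast
      then show ?thesis using ge[of n] real by simp
    qed simp
    moreover have "life (enc w) = emeasure lborel S" by (rule life) (simp add: S)
    ultimately show ?thesis using s by (simp add: S)
  qed
  then show ?thesis using s by (simp add: S_def)
qed

lemma life_eqI:
  assumes w: "cadlag w" and T: "0 \<le> T" and "\<And>u. 0 \<le> u \<Longrightarrow> positive_upto w u \<longleftrightarrow> u < T"
  shows "life (enc w) = ennreal T"
proof (rule antisym)
  have "\<not> positive_upto w T" using assms by simp
  then show "life (enc w) \<le> ennreal T" using positive_upto_iff_less_life[OF w T] by simp
  show "ennreal T \<le> life (enc w)"
  proof (rule ccontr)
    assume "\<not> ?thesis"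
    then have "life (enc w) < ennreal T" by simp
    then obtain u where "life (enc w) = ennreal u" "0 \<le> u" "u < T"
      by (cases "life (enc w)") (auto simp: ennreal_less_iff)
    then show False using assms(3)[of u] positive_upto_iff_less_life[OF w, of u] by simp
  qed
qed

lemma drop_jump_before: "u < s \<Longrightarrow> drop_jump s w u = w u"
  by (simp add: drop_jump_def)

lemma gap_enc: "cadlag w \<Longrightarrow> life (enc w) = ennreal T \<Longrightarrow> 0 < T \<Longrightarrow> gap (enc w) = jump w T"
  by (simp add: gap_def val_enc left_val_enc)

lemma revive_enc:
  assumes "cadlag w" "life (enc w) = ennreal T" "0 < T"
  shows "revive (enc w) = enc (drop_jump T w)"
  using gap_enc[OF assms] assms
  by (intro ext) (simp add: revive_def enc_def drop_jump_def ennreal_less_iff not_less)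

lemma revive_id: "gap z = 0 \<Longrightarrow> revive z = z"
  by (simp add: revive_def fun_eq_iff)

text \<open>With a positive left limit, the path is bounded away from 0 before \<open>T\<close>. A
  positive value at \<open>T\<close> would then prolong the life beyond \<open>T\<close>; after
  removal of the jump the value at \<open>T\<close> is the left limit, so the revived path is good
  at \<open>T\<close>.\<close>

lemma not_positive_at_life:
  assumes w: "cadlag w" and L: "life (enc w) = ennreal T" "0 < T" and l: "0 < w T - jump w T"
  shows "w T \<le> 0" "positive_upto (drop_jump T w) T"
proof -
  have "positive_upto w u" if "0 \<le> u" "u < T" for u
    using positive_upto_iff_less_life[OF w that(1)] L that by (simp add: ennreal_less_iff)
  then obtain e where e: "0 < e" "\<And>u. 0 \<le> u \<Longrightarrow> u < T \<Longrightarrow> e \<le> w u"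
    using positive_before[OF w L(2) _ l] by blast
  \<comment> \<open>Used with \<open>v = w\<close> for a contradiction, and with
    \<open>v = drop_jump T w\<close> for the second claim.\<close>
  have ext: "positive_upto v T" if "0 < v T" "\<And>u. u < T \<Longrightarrow> v u = w u" for v
    unfolding positive_upto_def
  proof (intro exI[of _ "min e (v T)"] conjI allI impI)
    fix u assume u: "0 \<le> u \<and> u \<le> T"
    show "min e (v T) \<le> v u"
    proof (cases "u = T")
      case False
      then show ?thesis using u e(2)[of u] that(2)[of u] by (intro min.coboundedI1) auto
    qed simp
  qed (use e that in auto)
  show "w T \<le> 0"
  proof (rule ccontr)
    assume "\<not> w T \<le> 0"
    then have "positive_upto w T" by (intro ext) auto
    then show False using positive_upto_iff_less_life[OF w, of T] L by simp
  qed
  show "positive_upto (drop_jump T w) T"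
    by (rule ext) (use l in \<open>auto simp: drop_jump_def\<close>)
qed

lemma left_limit_nonneg:
  assumes w: "cadlag w" and L: "life (enc w) = ennreal T" "0 < T"
  shows "0 \<le> w T - jump w T"
proof (rule tendsto_lowerbound[OF cadlag_at_left[OF w L(2)]])
  have "0 \<le> w u" if "0 < u" "u < T" for u
    using positive_upto_iff_less_life[OF w, of u] L that positive_upto_pos[of w u u]
    by (simp add: ennreal_less_iff less_imp_le)
  then show "\<forall>\<^sub>F u in at_left T. 0 \<le> w u"
    unfolding eventually_at_left_field using L(2) by (intro exI[of _ 0]) auto
qed simp

text \<open>Before the end \<open>T\<close> of the life the path is positive. At \<open>T\<close> it
  is not: a positive left limit forces a jump to a nonpositive value, and after a left limit 0
  regularity leaves the value 0.\<close>

lemma first_passage_eq_life: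
  assumes w: "cadlag w" and reg: "regular (enc w)"
  shows "first_passage w = enn2ereal (life (enc w))"
proof (cases "life (enc w)")
  case top
  have "0 < w u" if "0 \<le> u" for u
    using positive_upto_iff_less_life[OF w that] top positive_upto_pos[of w u u] that by simp
  then have none: "{t. 0 \<le> t \<and> w t \<in> {..0}} = {}" by (auto simp: not_less[symmetric])
  show ?thesis unfolding hitting_time_def none top by (simp add: top_ereal_def)
next
  case (real T)
  have "w T \<le> 0"
  proof (cases "T = 0")
    case True
    then have "\<not> positive_upto w 0" using positive_upto_iff_less_life[OF w, of 0] real by simp
    moreover have "positive_upto w 0" if "0 < w 0"
      unfolding positive_upto_def using that by (intro exI[of _ "w 0"]) auto
    ultimately show ?thesis using True by force
  next
    case False
    then have T: "0 < T" using real by simp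
    show ?thesis
    proof (cases "w T - jump w T = 0")
      case True
      then have "jump w T = 0"
        using reg T real gap_enc[OF w real(2) T] left_val_enc[OF w T] by (simp add: regular_def)
      then show ?thesis using True by simp
    next
      case False
      then show ?thesis
        using left_limit_nonneg[OF w real(2) T] not_positive_at_life(1)[OF w real(2) T] by simp
    qed
  qed
  moreover have "T \<le> u" if "0 \<le> u" "w u \<le> 0" for u
  proof (rule ccontr)
    assume "\<not> T \<le> u"
    then have "positive_upto w u" using positive_upto_iff_less_life[OF w that(1)] real that by (simp add: ennreal_less_iff)
    then show False using positive_upto_pos[of w u u] that by simp
  qed
  ultimately have "first_passage w = ereal T"
    unfolding hitting_time_def using real
    by (intro antisym INF_lower INF_greatest) auto
  then show ?thesis using real by simp
qed

lemma positive_upto_iff_first_passage: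
  assumes "cadlag w" "regular (enc w)" "0 \<le> s"
  shows "ereal s < first_passage w \<longleftrightarrow> positive_upto w s"
  unfolding first_passage_eq_life[OF assms(1,2)] positive_upto_iff_less_life[OF assms(1,3)] less_ennreal.rep_eq
  using assms(3) by simp

lemma resurrect_once_enc:
  assumes w: "cadlag w" and reg: "regular (enc w)"
  shows "cadlag (resurrect_once w)" "enc (resurrect_once w) = revive (enc w)"
proof -
  have "cadlag (resurrect_once w) \<and> enc (resurrect_once w) = revive (enc w)"
  proof (cases "life (enc w)")
    case top
    then have "resurrect_once w = w"
      unfolding resurrect_once_def[abs_def] first_passage_eq_life[OF w reg] by simp
    then show ?thesis using w top by (simp add: revive_id gap_def)
  next
    case (real T)
    have r: "resurrect_once w = drop_jump T w"
      unfolding resurrect_once_def[abs_def] first_passage_eq_life[OF w reg] using real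
      by (intro ext) (simp add: drop_jump_def)
    show ?thesis
    proof (cases "T = 0")
      case True
      then have "drop_jump T w = w" by (simp add: drop_jump_def fun_eq_iff jump_def)
      then show ?thesis using w r real True by (simp add: revive_id gap_def)
    next
      case False
      then show ?thesis using r real cadlag_drop_jump[OF w] revive_enc[OF w real(2)] by simp
    qed
  qed
  then show "cadlag (resurrect_once w)" "enc (resurrect_once w) = revive (enc w)" by simp_all
qed

subsection \<open>Iterated integrals\<close>

text \<open>The integral of a product of \<open>k\<close> values of \<open>g\<close> over ordered
  times in \<open>(0, s]\<close>, the largest time outermost. These are the Picard iterates of the
  equation \<open>y' = g y\<close>, and each resurrection contributes one integration.\<close>

primrec picard :: "(real \<Rightarrow> ennreal) \<Rightarrow> nat \<Rightarrow> real \<Rightarrow> ennreal" where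
  "picard g 0 s = 1"
| "picard g (Suc k) s = (\<integral>\<^sup>+u. (if 0 < u \<and> u \<le> s then g u * picard g k u else 0) \<partial>lborel)"

lemma picard_measurable [measurable]:
  assumes [measurable]: "g \<in> borel_measurable borel"
  shows "picard g k \<in> borel_measurable borel"
proof (induction k)
  case (Suc k)
  note Suc[measurable]
  have "(\<lambda>(s, u). if 0 < u \<and> u \<le> s then g u * picard g k u else 0) \<in> borel_measurable (borel \<Otimes>\<^sub>M (lborel :: real measure))"
    by measurable
  from lborel.borel_measurable_nn_integral[OF this] show ?case by simp
qed simp

text \<open>Tonelli on the square, cut along the diagonal, which has measure 0. Infinite values are
  thereby included, where a product rule for derivatives would fail.\<close>

lemma nn_integral_by_parts:
  fixes f g :: "real \<Rightarrow> ennreal" and s :: real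
  assumes [measurable]: "f \<in> borel_measurable borel" "g \<in> borel_measurable borel"
  defines "F \<equiv> \<lambda>t. \<integral>\<^sup>+u. (if 0 < u \<and> u \<le> t then f u else 0) \<partial>lborel"
    and "G \<equiv> \<lambda>t. \<integral>\<^sup>+u. (if 0 < u \<and> u \<le> t then g u else 0) \<partial>lborel"
  shows "F s * G s = (\<integral>\<^sup>+u. (if 0 < u \<and> u \<le> s then f u * G u else 0) \<partial>lborel)
    + (\<integral>\<^sup>+u. (if 0 < u \<and> u \<le> s then g u * F u else 0) \<partial>lborel)"
proof -
  let ?f = "\<lambda>u. if 0 < u \<and> u \<le> s then f u else 0" and ?g = "\<lambda>u. if 0 < u \<and> u \<le> s then g u else 0"
  let ?A = "\<lambda>u v. if v \<le> u then ?f u * ?g v else 0" and ?B = "\<lambda>u v. if u < v then ?f u * ?g v else 0"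
  have "F s * G s = (\<integral>\<^sup>+u. ?f u * G s \<partial>lborel)"
    unfolding F_def by (rule nn_integral_multc[symmetric]) measurable
  also have "\<dots> = (\<integral>\<^sup>+u. \<integral>\<^sup>+v. ?f u * ?g v \<partial>lborel \<partial>lborel)"
    unfolding G_def by (intro nn_integral_cong nn_integral_cmult[symmetric]) measurable
  also have "\<dots> = (\<integral>\<^sup>+u. (\<integral>\<^sup>+v. ?A u v \<partial>lborel)
      + (\<integral>\<^sup>+v. ?B u v \<partial>lborel) \<partial>lborel)"
  proof (rule nn_integral_cong)
    fix u :: real
    have "(\<integral>\<^sup>+v. ?f u * ?g v \<partial>lborel) =
        (\<integral>\<^sup>+v. ?A u v + ?B u v \<partial>lborel)"
      by (rule nn_integral_cong) (simp add: not_less)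
    also have "\<dots> = (\<integral>\<^sup>+v. ?A u v \<partial>lborel)
      + (\<integral>\<^sup>+v. ?B u v \<partial>lborel)"
      by (rule nn_integral_add) measurable
    finally show "(\<integral>\<^sup>+v. ?f u * ?g v \<partial>lborel) = (\<integral>\<^sup>+v. ?A u v \<partial>lborel)
      + (\<integral>\<^sup>+v. ?B u v \<partial>lborel)" .
  qed
  also have "\<dots> = (\<integral>\<^sup>+u. \<integral>\<^sup>+v. ?A u v \<partial>lborel \<partial>lborel)
      + (\<integral>\<^sup>+u. \<integral>\<^sup>+v. ?B u v \<partial>lborel \<partial>lborel)"
    by (rule nn_integral_add) measurable
  also have "(\<integral>\<^sup>+u. \<integral>\<^sup>+v. ?B u v \<partial>lborel \<partial>lborel)
      = (\<integral>\<^sup>+v. \<integral>\<^sup>+u. ?B u v \<partial>lborel \<partial>lborel)"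
    by (rule lborel_pair.Fubini'[symmetric]) measurable
  also have "\<dots> = (\<integral>\<^sup>+v. (if 0 < v \<and> v \<le> s then g v * F v else 0) \<partial>lborel)"
  proof (rule nn_integral_cong)
    fix v :: real
    have "(\<integral>\<^sup>+u. ?B u v \<partial>lborel)
        = (\<integral>\<^sup>+u. ?g v * (if 0 < u \<and> u \<le> v then f u else 0) \<partial>lborel)"
      by (rule nn_integral_cong_AE, use AE_lborel_singleton[of v] in eventually_elim) (auto simp: mult.commute)
    also have "\<dots> = ?g v * F v" unfolding F_def by (rule nn_integral_cmult) measurable
    finally show "(\<integral>\<^sup>+u. ?B u v \<partial>lborel) = (if 0 < v \<and> v \<le> s then g v * F v else 0)"
      by simp
  qed
  also have "(\<integral>\<^sup>+u. \<integral>\<^sup>+v. ?A u v \<partial>lborel \<partial>lborel)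
     = (\<integral>\<^sup>+u. (if 0 < u \<and> u \<le> s then f u * G u else 0) \<partial>lborel)"
  proof (rule nn_integral_cong)
    fix u :: real
    have "(\<integral>\<^sup>+v. ?A u v \<partial>lborel)
        = (\<integral>\<^sup>+v. ?f u * (if 0 < v \<and> v \<le> u then g v else 0) \<partial>lborel)"
      by (rule nn_integral_cong) auto
    also have "\<dots> = ?f u * G u" unfolding G_def by (rule nn_integral_cmult) measurable
    finally show "(\<integral>\<^sup>+v. ?A u v \<partial>lborel) = (if 0 < u \<and> u \<le> s then f u * G u else 0)"
      by simp
  qed
  finally show ?thesis .
qed

text \<open>The factorial stands on the left because division is delicate at infinity. Integration
  by parts of \<open>?G * ?G ^ k\<close> gives an integral \<open>?I\<close> plus \<open>k\<close>
  times the same integral. Two smaller exponents enter, hence the strong induction.\<close>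

lemma picard_eq_power:
  assumes [measurable]: "g \<in> borel_measurable borel"
  shows "of_nat (fact k) * picard g k s = picard g 1 s ^ k"
proof (induction k arbitrary: s rule: less_induct)
  case (less n)
  let ?G = "picard g 1"
  consider "n = 0" | "n = 1" | j where "n = Suc (Suc j)"
    by (metis One_nat_def not0_implies_Suc)
  then show ?case
  proof cases
    case (3 j)
    define k where "k = Suc j"
    have n: "n = Suc k" using 3 by (simp add: k_def)
    have IHk: "of_nat (fact k) * picard g k t = ?G t ^ k" for t by (rule less.IH) (simp add: n)
    have IHj: "of_nat (fact j) * picard g j t = ?G t ^ j" for t by (rule less.IH) (simp add: n k_def)
    \<comment> \<open>\<open>?h\<close> is a density of \<open>?G ^ k\<close>, by the hypothesis for
      \<open>k\<close>; by that for \<open>j\<close> it equals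
      \<open>k * g * ?G ^ j\<close>.\<close>
    let ?h = "\<lambda>u. of_nat (fact k) * (g u * picard g j u)"
    have Gk: "?G t ^ k = (\<integral>\<^sup>+u. (if 0 < u \<and> u \<le> t then ?h u else 0) \<partial>lborel)" for t
    proof -
      have "?G t ^ k = of_nat (fact k) * (\<integral>\<^sup>+u. (if 0 < u \<and> u \<le> t then g u * picard g j u else 0) \<partial>lborel)"
        using IHk[of t] by (simp add: k_def)
      also have "\<dots> = (\<integral>\<^sup>+u. of_nat (fact k) * (if 0 < u \<and> u \<le> t then g u * picard g j u else 0) \<partial>lborel)"
        by (rule nn_integral_cmult[symmetric]) measurable
      also have "\<dots> = (\<integral>\<^sup>+u. (if 0 < u \<and> u \<le> t then ?h u else 0) \<partial>lborel)"
        by (intro nn_integral_cong) auto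
      finally show ?thesis .
    qed
    have G1: "?G t = (\<integral>\<^sup>+u. (if 0 < u \<and> u \<le> t then g u else 0) \<partial>lborel)" for t
      by (simp cong: if_cong)
    let ?I = "\<integral>\<^sup>+u. (if 0 < u \<and> u \<le> s then g u * ?G u ^ k else 0) \<partial>lborel"
    have "?G s ^ Suc k = ?G s * ?G s ^ k" by simp
    also have "\<dots> = ?I + (\<integral>\<^sup>+u. (if 0 < u \<and> u \<le> s then ?h u * ?G u else 0) \<partial>lborel)"
      unfolding Gk unfolding G1 by (rule nn_integral_by_parts) measurable
    also have "(\<integral>\<^sup>+u. (if 0 < u \<and> u \<le> s then ?h u * ?G u else 0) \<partial>lborel)
        = (\<integral>\<^sup>+u. of_nat k * (if 0 < u \<and> u \<le> s then g u * ?G u ^ k else 0) \<partial>lborel)"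
    proof (intro nn_integral_cong)
      fix u
      have "?h u * ?G u = of_nat k * (g u * (?G u * (of_nat (fact j) * picard g j u)))"
        unfolding k_def fact_Suc of_nat_mult of_nat_id by (simp only: mult_ac)
      then have "?h u * ?G u = of_nat k * (g u * ?G u ^ k)"
        unfolding IHj by (simp add: k_def del: picard.simps)
      then show "(if 0 < u \<and> u \<le> s then ?h u * ?G u else 0) = of_nat k * (if 0 < u \<and> u \<le> s then g u * ?G u ^ k else 0)"
        by simp
    qed
    also have "\<dots> = of_nat k * ?I" by (rule nn_integral_cmult) measurable
    also have "?I + of_nat k * ?I = of_nat (Suc k) * ?I" by (simp add: distrib_right)
    also have "?I = (\<integral>\<^sup>+u. of_nat (fact k) * (if 0 < u \<and> u \<le> s then g u * picard g k u else 0) \<partial>lborel)"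
      unfolding IHk[symmetric] by (intro nn_integral_cong) (simp add: mult_ac del: picard.simps)
    also have "\<dots> = of_nat (fact k) * picard g (Suc k) s"
      unfolding picard.simps(2)[of g k] by (rule nn_integral_cmult) measurable
    finally show ?thesis unfolding n fact_Suc of_nat_mult of_nat_id by (simp only: mult_ac)
  qed simp_all
qed

lemma suminf_picard:
  assumes [measurable]: "g \<in> borel_measurable borel"
  shows "(\<Sum>k. picard g k s) = exp_ennreal (picard g 1 s)"
proof (cases "picard g 1 s")
  case (real r)
  have "picard g k s = ennreal (r ^ k / fact k)" for k
  proof -
    have "ennreal (fact k) * picard g k s = ennreal (r ^ k)"
      using picard_eq_power[OF assms, of k s] real by (simp add: ennreal_of_nat_eq_real_of_nat ennreal_power del: picard.simps)
    then show ?thesis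
    proof (cases "picard g k s")
      case (real p)
      then have "fact k * p = r ^ k"
        using \<open>ennreal (fact k) * picard g k s = ennreal (r ^ k)\<close> \<open>0 \<le> r\<close>
        by (simp add: ennreal_mult[symmetric])
      then have "p = r ^ k / fact k" by (simp add: field_simps)
      then show ?thesis using real by simp
    qed (simp add: ennreal_mult_top)
  qed
  moreover have "(\<lambda>k. r ^ k / fact k) sums exp r"
    using exp_converges[of r] by (simp add: divide_inverse mult.commute)
  then have "(\<Sum>k. ennreal (r ^ k / fact k)) = ennreal (exp r)"
    by (intro suminf_ennreal_eq) (use real in auto)
  ultimately have "(\<Sum>k. picard g k s) = ennreal (exp r)" by (simp only:)
  then show ?thesis using real by (simp add: exp_ennreal_def del: picard.simps)
next
  \<comment> \<open>The term of index 1 is already infinite, in accordance with the value of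
    \<open>exp_ennreal\<close> at infinity.\<close>
  case top
  have "picard g 1 s \<le> (\<Sum>k. picard g k s)"
    using sum_le_suminf[OF summableI, of "{1}" "\<lambda>k. picard g k s"] by (simp del: picard.simps)
  then show ?thesis using top by (simp add: exp_ennreal_def top_unique del: picard.simps)
qed

text \<open>Agreement is required only before \<open>s\<close>. At the end \<open>s\<close> of a
  life the rates of the path and of the revived path may differ.\<close>

lemma picard_cong:
  "(\<And>u. 0 < u \<Longrightarrow> u < s \<Longrightarrow> g u = h u) \<Longrightarrow> picard g k s = picard h k s"
proof (induction k arbitrary: s)
  case (Suc k)
  have "picard g k u = picard h k u" if "u < s" for u using Suc that by (meson order.strict_trans)
  then have "AE u in lborel. (if 0 < u \<and> u \<le> s then g u * picard g k u else 0) = (if 0 < u \<and> u \<le> s then h u * picard h k u else 0)"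
    using AE_lborel_singleton[of s] Suc.prems by (auto elim!: eventually_mono)
  then show ?case by (auto intro: nn_integral_cong_AE)
qed simp

lemma picard_stop:
  assumes "s \<le> t" "\<And>u. s \<le> u \<Longrightarrow> g u = 0"
  shows "picard g k t = picard g k s"
proof (cases k)
  case (Suc j)
  then show ?thesis using assms by (auto intro!: nn_integral_cong)
qed simp

subsection \<open>The two sides of the formula\<close>

text \<open>The rate vanishes once the path is dead, so that iterated integrals up to
  \<open>t\<close> stop by themselves at the end of the life.\<close>

definition kill_rate :: "real measure \<Rightarrow> code \<Rightarrow> real \<Rightarrow> ennreal" where
  "kill_rate \<pi> z u = (if alive z u then lower_tail \<pi> (- val z u) else 0)"

text \<open>The integrand of \<open>A\<^sub>n\<close>: paths alive at \<open>t\<close> contribute 0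
  to all later terms, so \<open>n\<close> is the exact number of resurrections.\<close>

primrec survival :: "(real \<Rightarrow> ennreal) \<Rightarrow> real \<Rightarrow> nat \<Rightarrow> code \<Rightarrow> ennreal" where
  "survival f t 0 z = (if alive z t then f (val z t) else 0)"
| "survival f t (Suc n) z = (if alive z t then 0 else survival f t n (revive z))"

lemma lower_tail_measurable [measurable]:
  assumes "sets \<pi> = sets borel"
  shows "lower_tail \<pi> \<in> borel_measurable borel"
proof (rule borel_measurableI_greater)
  fix a
  have "lower_tail \<pi> x \<le> lower_tail \<pi> y" if "x \<le> y" for x y
    unfolding lower_tail_def using that assms by (intro emeasure_mono) auto
  then have "is_interval {x. a < lower_tail \<pi> x}"
    unfolding is_interval_1 by (auto intro: less_le_trans)
  then show "{x \<in> space borel. a < lower_tail \<pi> x} \<in> sets borel"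
    by (simp add: real_interval_borel_measurable)
qed

lemma kill_rate_measurable:
  assumes "sets \<pi> = sets borel"
  shows "(\<lambda>p. kill_rate \<pi> (snd p) (fst p)) \<in> borel_measurable time_path"
proof -
  have [measurable]: "lower_tail \<pi> \<in> borel_measurable borel" using assms by (rule lower_tail_measurable)
  show ?thesis unfolding kill_rate_def by measurable
qed

lemma kill_rate_measurable1 [measurable]:
  assumes "sets \<pi> = sets borel"
  shows "kill_rate \<pi> z \<in> borel_measurable borel"
  using measurable_compose[OF measurable_Pair2'[of z path_space] kill_rate_measurable[OF assms]]
  by (simp add: space_PiM)

lemma picard_kill_rate_measurable:
  assumes "sets \<pi> = sets borel"
  shows "(\<lambda>p. picard (kill_rate \<pi> (snd p)) k (fst p)) \<in> borel_measurable time_path"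
proof (induction k)
  case (Suc k)
  let ?N = "time_path \<Otimes>\<^sub>M (lborel :: real measure)"
  have swap[measurable]: "(\<lambda>q. (snd q, snd (fst q))) \<in> measurable ?N time_path"
    by measurable
  have [measurable]: "(\<lambda>q. picard (kill_rate \<pi> (snd (fst q))) k (snd q)) \<in> borel_measurable ?N"
    "(\<lambda>q. kill_rate \<pi> (snd (fst q)) (snd q)) \<in> borel_measurable ?N"
    using measurable_compose[OF swap Suc] measurable_compose[OF swap kill_rate_measurable[OF assms]] by simp_all
  have "(\<lambda>q. if 0 < snd q \<and> snd q \<le> fst (fst q)
      then kill_rate \<pi> (snd (fst q)) (snd q) * picard (kill_rate \<pi> (snd (fst q))) k (snd q) else 0) \<in> borel_measurable ?N"
    by measurable
  from lborel.borel_measurable_nn_integral_fst[OF this] show ?case by simp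
qed simp

lemma survival_measurable [measurable]:
  assumes [measurable]: "f \<in> borel_measurable borel"
  shows "survival f t n \<in> borel_measurable path_space"
proof (induction n)
  case 0
  have "(\<lambda>z. if alive z t then f (val z t) else 0) \<in> borel_measurable path_space" by measurable
  then show ?case by (simp cong: measurable_cong)
next
  case (Suc n)
  note Suc[measurable]
  have "(\<lambda>z. if alive z t then 0 else survival f t n (revive z)) \<in> borel_measurable path_space" by measurable
  then show ?case by (simp cong: measurable_cong)
qed

lemma survival_stuck: "\<not> alive z t \<Longrightarrow> revive z = z \<Longrightarrow> survival f t n z = 0"
  by (induction n) auto

lemma survival_eq:
  "survival f t n z = (if (\<forall>i<n. \<not> alive ((revive ^^ i) z) t) \<and> alive ((revive ^^ n) z) t
     then f (val ((revive ^^ n) z) t) else 0)"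
proof (induction n arbitrary: z)
  case (Suc n)
  have "(\<forall>i<Suc n. \<not> alive ((revive ^^ i) z) t) \<longleftrightarrow> \<not> alive z t \<and> (\<forall>i<n. \<not> alive ((revive ^^ i) (revive z)) t)"
    by (auto simp: less_Suc_eq_0_disj funpow_swap1)
  then show ?case by (auto simp add: Suc funpow_swap1)
qed simp

text \<open>The part of the summand that depends only on \<open>s\<close> and the path without its
  jump at \<open>s\<close>; the condition on the jump is added by \<open>mecke_kill\<close>.\<close>

definition kill_term :: "(real \<Rightarrow> ennreal) \<Rightarrow> real \<Rightarrow> nat \<Rightarrow> real measure \<Rightarrow> nat \<Rightarrow> real \<times> code \<Rightarrow> ennreal" where
  "kill_term f t n \<pi> k p = (if 0 < fst p \<and> fst p \<le> t \<and> alive (snd p) (fst p)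
     then survival f t n (snd p) * picard (kill_rate \<pi> (snd p)) k (fst p) else 0)"

text \<open>The only jump which contributes to the sum is the one at the end of the life of \<open>w\<close>.\<close>

lemma survival_Suc_eq_jump_sum:
  assumes w: "cadlag w" and reg: "regular (enc w)" and t: "0 \<le> t"
  shows "survival f t (Suc n) (enc w) * picard (kill_rate \<pi> (enc w)) k t =
    (\<integral>\<^sup>+s. kill_term f t n \<pi> k (s, enc (drop_jump s w)) *
      indicator {s. 0 < s \<and> jump w s \<le> - val (enc (drop_jump s w)) s} s \<partial>count_space UNIV)"
proof -
  let ?F = "\<lambda>s. kill_term f t n \<pi> k (s, enc (drop_jump s w)) *
      indicator {s. 0 < s \<and> jump w s \<le> - val (enc (drop_jump s w)) s} s"
  let ?c = "\<lambda>s. survival f t n (enc (drop_jump s w)) * picard (kill_rate \<pi> (enc (drop_jump s w))) k s"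
  let ?P = "\<lambda>s. 0 < s \<and> s \<le> t \<and> positive_upto (drop_jump s w) s \<and> jump w s \<le> - drop_jump s w s"
  have val_drop: "val (enc (drop_jump s w)) s = drop_jump s w s" if "0 < s" for s
    using val_enc[OF cadlag_drop_jump[OF w], of s s] that by simp
  have alive_drop: "alive (enc (drop_jump s w)) u = positive_upto (drop_jump s w) u" if "0 < u" for s u
    using alive_enc[OF cadlag_drop_jump[OF w], of u s] that by simp
  have summand: "?F s
    = (if ?P s then ?c s else 0)" for s
    by (cases "0 < s") (auto simp: kill_term_def val_drop alive_drop indicator_def)
  \<comment> \<open>The condition \<open>?P s\<close> makes the path positive before
    \<open>s\<close> and nonpositive at \<open>s\<close>. It determines \<open>s\<close> as the end
    of the life, so at most one summand is nonzero.\<close>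
  have life: "life (enc w) = ennreal s" "w s \<le> 0" if "?P s" for s
  proof -
    show ws: "w s \<le> 0" using that by (simp add: drop_jump_def)
    have "positive_upto w u \<longleftrightarrow> u < s" if "0 \<le> u" for u
    proof
      assume "positive_upto w u"
      then show "u < s" using positive_upto_pos[of w u s] ws \<open>?P s\<close> by (meson not_le less_imp_le)
    next
      assume "u < s"
      then have "positive_upto (drop_jump s w) u" using positive_upto_mono \<open>?P s\<close> by (meson less_imp_le)
      then show "positive_upto w u"
        using positive_upto_cong[of u "drop_jump s w" w] \<open>u < s\<close> by (simp add: drop_jump_before)
    qed
    then show "life (enc w) = ennreal s" using that by (intro life_eqI[OF w]) auto
  qed
  show ?thesis
  proof (cases "\<exists>s. ?P s")
    case True
    then obtain s where s: "?P s" by blast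
    have uniq: "s' = s" if "?P s'" for s'
      using life(1)[OF that] life(1)[OF s] that s by simp

    have pos: "positive_upto w u \<longleftrightarrow> u < s" if "0 \<le> u" for u
      using positive_upto_iff_less_life[OF w that] life(1)[OF s] that by (simp add: ennreal_less_iff)
    have dead: "\<not> alive (enc w) u" if "s \<le> u" for u
      using pos[of u] alive_enc[OF w, of u] s that by simp
    have rv: "revive (enc w) = enc (drop_jump s w)" using revive_enc[OF w life(1)[OF s]] s by simp
    have rate: "kill_rate \<pi> (enc w) u = kill_rate \<pi> (enc (drop_jump s w)) u" if "0 < u" "u < s" for u
    proof -
      have "positive_upto w u = positive_upto (drop_jump s w) u"
        by (rule positive_upto_cong) (use that in \<open>simp add: drop_jump_before\<close>)
      moreover have "val (enc w) u = val (enc (drop_jump s w)) u"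
        using val_enc[OF w, of u] val_enc[OF cadlag_drop_jump[OF w], of u s] that by (simp add: drop_jump_before)
      ultimately show ?thesis
        using alive_enc[OF w, of u] alive_drop[of u s] that by (simp add: kill_rate_def)
    qed
    \<comment> \<open>The original path has rate 0 from \<open>s\<close> on, and before
      \<open>s\<close> it agrees with the path without the jump.\<close>
    have "picard (kill_rate \<pi> (enc w)) k t = picard (kill_rate \<pi> (enc w)) k s"
      by (rule picard_stop) (use s dead in \<open>auto simp: kill_rate_def\<close>)
    also have "\<dots> = picard (kill_rate \<pi> (enc (drop_jump s w))) k s"
      by (rule picard_cong) (rule rate)
    finally have pic: "picard (kill_rate \<pi> (enc w)) k t = picard (kill_rate \<pi> (enc (drop_jump s w))) k s" .
    have "(\<integral>\<^sup>+s. ?F s \<partial>count_space UNIV)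
      = (\<Sum>s'\<in>{s}. if ?P s' then ?c s' else 0)"
      unfolding summand by (rule nn_integral_count_space') (use uniq in auto)
    also have "\<dots> = ?c s"
      using s by simp
    finally show ?thesis using dead[of t] s by (simp add: rv pic)
  next
    case False
    \<comment> \<open>If the path is dead at \<open>t\<close> although no \<open>?P s\<close> holds,
      its life did not end by a jump from a positive left limit. Regularity then leaves no gap,
      \<open>revive\<close> fixes the code, and the path stays dead.\<close>
    have "survival f t (Suc n) (enc w) = 0"
    proof (cases "alive (enc w) t")
      case dead: False
      have "life (enc w) \<le> ennreal t"
        using dead alive_enc[OF w t] positive_upto_iff_less_life[OF w t] by simp
      then obtain T where T: "life (enc w) = ennreal T" "0 \<le> T" "T \<le> t"
        using t by (cases "life (enc w)") (auto simp: top_unique)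
      have "gap (enc w) = 0"
      proof (cases "T = 0")
        case False
        then have T0: "0 < T" using T by simp
        have "w T - jump w T = 0"
        proof (rule ccontr)
          assume "w T - jump w T \<noteq> 0"
          then have l: "0 < w T - jump w T" using left_limit_nonneg[OF w T(1) T0] by simp
          have "?P T"
            using not_positive_at_life[OF w T(1) T0 l] T T0 by (simp add: drop_jump_def)
          with \<open>\<nexists>s. ?P s\<close> show False by blast
        qed
        then show ?thesis using reg T T0 left_val_enc[OF w T0] by (simp add: regular_def)
      qed (use T in \<open>simp add: gap_def\<close>)
      then show ?thesis using survival_stuck[OF dead revive_id] by blast
    qed simp
    moreover have "(\<integral>\<^sup>+s. ?F s \<partial>count_space UNIV) = 0"
    proof -
      have "?F s = 0" for s
        unfolding summand using False by auto
      then show ?thesis by (simp only: nn_integral_const) simp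
    qed
    ultimately show ?thesis by simp
  qed
qed

text \<open>The resurrected path is the path of the first life that lasts beyond \<open>t\<close>.\<close>

lemma resurrected_eq_suminf:
  assumes w: "cadlag w" and reg: "\<And>n. regular ((revive ^^ n) (enc w))" and t: "0 \<le> t"
  shows "f (resurrected w t) * (if ereal t < absorption_time w then 1 else 0) = (\<Sum>n. survival f t n (enc w))"
proof -
  define W where "W n = (resurrect_once ^^ n) w" for n
  have W: "cadlag (W n) \<and> enc (W n) = (revive ^^ n) (enc w)" for n
  proof (induction n)
    case 0
    then show ?case using w by (simp add: W_def)
  next
    case (Suc n)
    then show ?case
      using resurrect_once_enc[of "W n"] reg[of n] by (simp add: W_def)
  qed
  have reg': "regular (enc (W n))" for n using W reg by simp
  let ?D = "\<lambda>n. positive_upto (W n)"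
  have fp: "ereal s < first_passage (W n) \<longleftrightarrow> ?D n s" if "0 \<le> s" for s n
    using positive_upto_iff_first_passage[of "W n" s] W reg' that by blast
  have step: "W (Suc n) u = W n u" if "?D n s" "0 \<le> u" "u \<le> s" for n s u
    using fp[OF that(2), of n] positive_upto_mono[OF that(1,3)] by (simp add: W_def resurrect_once_def)
  have D_Suc: "?D (Suc n) s" if "?D n s" for n s
    using positive_upto_cong[of s "W (Suc n)" "W n"] step[OF that] that by simp
  \<comment> \<open>Once a stage survives beyond \<open>s\<close>, all further removals happen after
    \<open>s\<close>.\<close>
  have later: "?D m s \<and> W m s = W n s" if "?D n s" "n \<le> m" "0 \<le> s" for n m s
    using that(2)
  proof (induction m rule: dec_induct)
    case (step m)
    then show ?case using D_Suc[of m s] \<open>\<And>n s u. ?D n s \<Longrightarrow> 0 \<le> u \<Longrightarrow> u \<le> s \<Longrightarrow> W (Suc n) u = W n u\<close>[of m s s] that by simp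
  qed (use that in simp)
  have res: "resurrected w s = lim (\<lambda>n. if ?D n s then W n s else 0)" if "0 \<le> s" for s
    unfolding resurrected_def W_def[symmetric] indicator_def using fp[OF that]
    by (intro arg_cong[where f=lim] ext) simp
  have res_D: "resurrected w s = W n s" if "?D n s" "0 \<le> s" for n s
    unfolding res[OF that(2)]
  proof (intro limI tendsto_eventually eventually_sequentiallyI[of n])
    fix m assume "n \<le> m"
    from later[OF that(1) this that(2)] show "(if ?D m s then W m s else 0) = W n s" by argo
  qed
  have res_0: "resurrected w s = 0" if "\<nexists>n. ?D n s" "0 \<le> s" for s
    unfolding res[OF that(2)] using that by (intro limI) simp
  have abs: "ereal t < absorption_time w \<longleftrightarrow> (\<exists>n. ?D n t)"
  proof
    assume "ereal t < absorption_time w"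
    show "\<exists>n. ?D n t"
    proof (rule ccontr)
      assume "\<nexists>n. ?D n t"
      then have "absorption_time w \<le> ereal t"
        unfolding absorption_time_def hitting_time_def using t res_0 by (intro INF_lower) auto
      with \<open>ereal t < absorption_time w\<close> show False by simp
    qed
  next
    assume "\<exists>n. ?D n t"
    then obtain n where "?D n t" ..
    \<comment> \<open>The absorption time is an infimum; positivity slightly beyond \<open>t\<close>
      is what makes the inequality strict.\<close>
    then obtain t' where t': "t < t'" "?D n t'" using positive_upto_extend[of "W n" t] W t by blast
    have "resurrected w s \<noteq> 0" if "0 \<le> s" "s \<le> t'" for s
      using res_D[OF positive_upto_mono[OF t'(2) that(2)] that(1)] positive_upto_pos[OF t'(2) that] by simp
    then have "ereal t' \<le> absorption_time w"
      unfolding absorption_time_def hitting_time_def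
      by (intro INF_greatest) (auto simp: not_less[symmetric] intro: less_imp_le dest: less_imp_le)
    then show "ereal t < absorption_time w" using t'(1) less_le_trans[of "ereal t" "ereal t'"] by simp
  qed
  have surv: "survival f t n (enc w) = (if (\<forall>i<n. \<not> ?D i t) \<and> ?D n t then f (W n t) else 0)" for n
  proof -
    have "alive ((revive ^^ i) (enc w)) t \<longleftrightarrow> ?D i t" for i
      using alive_enc[of "W i" t] W t by metis
    moreover have "val ((revive ^^ n) (enc w)) t = W n t"
      using val_enc[of "W n" t] W t by metis
    ultimately show ?thesis by (auto simp: survival_eq)
  qed
  show ?thesis
  proof (cases "\<exists>n. ?D n t")
    case True
    define n where "n = (LEAST n. ?D n t)"
    have n: "?D n t" "\<And>i. i < n \<Longrightarrow> \<not> ?D i t"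
      unfolding n_def using True by (auto intro: LeastI_ex dest: not_less_Least)
    have "(\<Sum>n. survival f t n (enc w)) = (\<Sum>m\<in>{n}. survival f t m (enc w))"
    proof (rule suminf_finite)
      show "survival f t m (enc w) = 0" if "m \<notin> {n}" for m
      proof (cases "m < n")
        case True
        then show ?thesis using n(2) by (simp add: surv)
      next
        case False
        then have "n < m" using that by simp
        then show ?thesis using n(1) by (auto simp: surv)
      qed
    qed simp
    also have "\<dots> = f (W n t)" using n by (simp add: surv)
    finally show ?thesis using True abs res_D[OF n(1) t] by simp
  next
    case False
    then show ?thesis using abs by (simp add: surv)
  qed
qed

section \<open>Reflection and almost sure regularity\<close>

lemma (in levy_paths) levy_paths_uminus: "levy_paths M (\<lambda>t \<omega>. - X t \<omega>) (- x)"
proof (intro levy_paths.intro levy_paths_axioms.intro prob_space_axioms)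
  show "(\<lambda>\<omega>. - X t \<omega>) \<in> borel_measurable M" if "0 \<le> t" for t
    using rv[OF that] by measurable
  show "- X 0 \<omega> = - x" for \<omega> by (simp add: start)
  show "cadlag (\<lambda>t. - X t \<omega>)" for \<omega> by (rule cadlag_uminus[OF paths])
  show "distr M borel (\<lambda>\<omega>. - X (s + h) \<omega> - - X s \<omega>) = distr M borel (\<lambda>\<omega>. - X h \<omega> - - X 0 \<omega>)"
    if "0 \<le> s" "0 \<le> h" for s h
  proof -
    have [measurable]: "X (s + h) \<in> borel_measurable M" "X s \<in> borel_measurable M" "X h \<in> borel_measurable M" "X 0 \<in> borel_measurable M"
      using that by (auto intro: rv)
    have "distr M borel (\<lambda>\<omega>. - X (s + h) \<omega> - - X s \<omega>)
        = distr (distr M borel (\<lambda>\<omega>. X (s + h) \<omega> - X s \<omega>)) borel uminus"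
      by (subst distr_distr) (auto simp: comp_def)
    also have "\<dots> = distr (distr M borel (\<lambda>\<omega>. X h \<omega> - X 0 \<omega>)) borel uminus"
      by (simp only: stationary[OF that])
    also have "\<dots> = distr M borel (\<lambda>\<omega>. - X h \<omega> - - X 0 \<omega>)"
      by (subst distr_distr) (auto simp: comp_def)
    finally show ?thesis .
  qed
  show "indep_vars (\<lambda>_. borel) (\<lambda>i \<omega>. - X (t (Suc i)) \<omega> - - X (t i) \<omega>) {..<n}"
    if "0 \<le> t 0" "\<And>i. i < n \<Longrightarrow> t i \<le> t (Suc i)" for n t
    using indep_vars_compose2[OF independent[OF that], where Y="\<lambda>_ y. - y" and N="\<lambda>_. borel"] by simp
qed

context levy_jumps
begin

text \<open>The Mecke formula above sums over downward jumps; reflection transfers its consequences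
  to upward ones.\<close>

lemma levy_jumps_uminus: "levy_jumps M (\<lambda>t \<omega>. - X t \<omega>) (- x) (distr \<pi> borel uminus)"
proof (intro levy_jumps.intro levy_jumps_axioms.intro levy_paths_uminus)
  show "is_levy_measure M (\<lambda>t \<omega>. - X t \<omega>) (distr \<pi> borel uminus)"
    unfolding is_levy_measure_def
  proof (intro conjI ballI)
    fix A :: "real set" assume [measurable]: "A \<in> sets borel"
    have um: "uminus \<in> measurable \<pi> borel" by (simp cong: measurable_cong_sets)
    have B: "uminus -` A \<in> sets borel"
      using measurable_sets[of uminus borel borel A] by simp
    have "emeasure (distr \<pi> borel uminus) A = emeasure \<pi> (uminus -` A)"
      using sets_eq_imp_space_eq[OF sets_pi] by (simp add: emeasure_distr[OF um])
    also have "\<dots> = (\<integral>\<^sup>+\<omega>. emeasure (count_space UNIV)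
        {t\<in>{0<..1}. jump (\<lambda>s. X s \<omega>) t \<noteq> 0 \<and> jump (\<lambda>s. X s \<omega>) t \<in> uminus -` A} \<partial>M)"
      using levy_measure B by (simp add: is_levy_measure_def)
    finally show "emeasure (distr \<pi> borel uminus) A = (\<integral>\<^sup>+\<omega>. emeasure (count_space UNIV)
        {t\<in>{0<..1}. jump (\<lambda>s. - X s \<omega>) t \<noteq> 0 \<and> jump (\<lambda>s. - X s \<omega>) t \<in> A} \<partial>M)"
      by (simp add: jump_uminus[OF paths])
  qed simp
qed

text \<open>For each path at most one time \<open>s\<close> satisfies the equation, and Fubini
  exchanges the two quantifiers.\<close>

lemma null_set_at_fixed_time:
  assumes [measurable]: "L \<in> borel_measurable path_space"
  shows "AE s in lborel. AE \<omega> in M. (s, coded \<omega>) \<notin> {p. 0 < fst p \<and> L (snd p) = ennreal (fst p)}"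
proof -
  interpret P: pair_sigma_finite lborel M ..
  have "{p \<in> space (lborel \<Otimes>\<^sub>M M). \<not> (0 < fst p \<and> L (coded (snd p)) = ennreal (fst p))} \<in> sets (lborel \<Otimes>\<^sub>M M)"
    by measurable
  moreover have "AE \<omega> in M. AE s in lborel. \<not> (0 < s \<and> L (coded \<omega>) = ennreal s)"
  proof (rule AE_I2)
    fix \<omega>
    show "AE s in lborel. \<not> (0 < s \<and> L (coded \<omega>) = ennreal s)"
      using AE_lborel_singleton[of "enn2real (L (coded \<omega>))"] by eventually_elim auto
  qed
  ultimately have "AE s in lborel. AE \<omega> in M. \<not> (0 < s \<and> L (coded \<omega>) = ennreal s)"
    by (subst P.AE_commute) auto
  then show ?thesis by simp
qed

text \<open>The functional \<open>L\<close> is arbitrary because reflection turns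
  \<open>life\<close> into the life of the negated code.\<close>

lemma life_dropped_neq:
  assumes [measurable]: "L \<in> borel_measurable path_space"
  shows "AE \<omega> in M. \<forall>s>0. jumpX s \<omega> < 0 \<longrightarrow> L (dropped s \<omega>) \<noteq> ennreal s"
proof -
  have "{p \<in> space time_path. 0 < fst p \<and> L (snd p) = ennreal (fst p)} \<in> sets time_path"
    by measurable
  then have "{p. 0 < fst p \<and> L (snd p) = ennreal (fst p)} \<in> sets time_path"
    by (simp add: space_pair_measure space_PiM)
  from mecke_null[OF this null_set_at_fixed_time[OF assms]] show ?thesis by auto
qed

text \<open>This is quasi-left-continuity. An irregular path jumps at the end \<open>s\<close> of its life; after removal of that jump
  the life still ends at \<open>s\<close>, and by the Mecke formula, applied to \<^term>\<open>X\<close> for the downward jumps and to \<open>-X\<close> for the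
  upward ones, no jump time has this property.\<close>

lemma AE_regular: "AE \<omega> in M. regular (coded \<omega>)"
proof -
  interpret Y: levy_jumps M "\<lambda>t \<omega>. - X t \<omega>" "- x" "distr \<pi> borel uminus" by (rule levy_jumps_uminus)
  have "(\<lambda>z q. - z q) \<in> measurable path_space path_space"
    by (rule measurable_PiM_single') auto
  from measurable_compose[OF this life_measurable]
  have "(\<lambda>z. life (\<lambda>q. - z q)) \<in> borel_measurable path_space" .
  from Y.life_dropped_neq[OF this]
  have "AE \<omega> in M. \<forall>s>0. Y.jumpX s \<omega> < 0 \<longrightarrow> life (\<lambda>q. - Y.dropped s \<omega> q) \<noteq> ennreal s" .
  moreover have "(\<lambda>q. - Y.dropped s \<omega> q) = dropped s \<omega>" "Y.jumpX s \<omega> = - jumpX s \<omega>" for s \<omega>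
    by (auto simp: Y.dropped_def dropped_def Y.jumpX_def jumpX_def enc_def drop_jump_def jump_uminus[OF paths])
  ultimately have up: "AE \<omega> in M. \<forall>s>0. 0 < jumpX s \<omega> \<longrightarrow> life (dropped s \<omega>) \<noteq> ennreal s"
    by simp
  show ?thesis
    using up life_dropped_neq[OF life_measurable]
  proof eventually_elim
    fix \<omega> assume no: "\<forall>s>0. 0 < jumpX s \<omega> \<longrightarrow> life (dropped s \<omega>) \<noteq> ennreal s"
      "\<forall>s>0. jumpX s \<omega> < 0 \<longrightarrow> life (dropped s \<omega>) \<noteq> ennreal s"
    let ?w = "\<lambda>t. X t \<omega>"
    have w: "cadlag ?w" by (rule paths)
    show "regular (coded \<omega>)"
    proof (rule ccontr)
      assume "\<not> regular (coded \<omega>)"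
      then have L: "0 < life (enc ?w)" "life (enc ?w) < \<infinity>" and lv: "left_val (enc ?w) (enn2real (life (enc ?w))) = 0"
        and g: "gap (enc ?w) \<noteq> 0" by (auto simp: regular_def coded_def)
      obtain T where T: "life (enc ?w) = ennreal T" "0 < T"
        using L by (cases "life (enc ?w)") auto
      have j: "jump ?w T \<noteq> 0" using g gap_enc[OF w T] by simp
      have l: "?w T - jump ?w T = 0" using lv T left_val_enc[OF w T(2)] by simp
      have "positive_upto (drop_jump T ?w) u \<longleftrightarrow> u < T" if "0 \<le> u" for u
      proof (cases "u < T")
        case True
        then have "positive_upto (drop_jump T ?w) u \<longleftrightarrow> positive_upto ?w u"
          by (intro positive_upto_cong) (simp add: drop_jump_before)
        then show ?thesis
          using True positive_upto_iff_less_life[OF w that] T that by (simp add: ennreal_less_iff)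
      next
        case False
        have "drop_jump T ?w T = 0" using l by (simp add: drop_jump_def)
        then have "\<not> positive_upto (drop_jump T ?w) u"
          using positive_upto_pos[of "drop_jump T ?w" u T] False T(2) by auto
        then show ?thesis using False by simp
      qed
      then have "life (dropped T \<omega>) = ennreal T"
        unfolding dropped_def using T(2) by (intro life_eqI cadlag_drop_jump[OF w]) auto
      moreover have "0 < jumpX T \<omega> \<or> jumpX T \<omega> < 0" using j by (auto simp: jumpX_def)
      ultimately show False using no T(2) by blast
    qed
  qed
qed

text \<open>The law of the revived path is absolutely continuous with respect to the law of the
  path: the revived path is either the path itself or the path without one of its downward jumps,
  and \<open>mecke_null\<close> keeps all of the latter out of a null set at once.\<close>

lemma AE_revive:
  assumes N[measurable]: "N \<in> sets path_space" and null: "AE \<omega> in M. coded \<omega> \<notin> N"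
  shows "AE \<omega> in M. revive (coded \<omega>) \<notin> N"
proof -
  have B: "UNIV \<times> N \<in> sets time_path" by measurable
  have "AE \<omega> in M. \<forall>s>0. jumpX s \<omega> < 0 \<longrightarrow> (s, dropped s \<omega>) \<notin> UNIV \<times> N"
    by (rule mecke_null[OF B]) (use null in simp)
  then show ?thesis
    using null AE_regular
  proof eventually_elim
    fix \<omega> assume dr: "\<forall>s>0. jumpX s \<omega> < 0 \<longrightarrow> (s, dropped s \<omega>) \<notin> UNIV \<times> N"
      and c: "coded \<omega> \<notin> N" and reg: "regular (coded \<omega>)"
    let ?w = "\<lambda>t. X t \<omega>"
    have w: "cadlag ?w" by (rule paths)
    show "revive (coded \<omega>) \<notin> N"
    proof (cases "gap (coded \<omega>) = 0")
      case True
      then show ?thesis using c by (simp add: revive_id)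
    next
      case False
      then have "life (enc ?w) \<noteq> 0" "life (enc ?w) \<noteq> \<infinity>" by (auto simp: gap_def coded_def)
      then obtain T where T: "life (enc ?w) = ennreal T" "0 < T"
        by (cases "life (enc ?w)") auto
      \<comment> \<open>Regularity excludes the left limit 0, so the removed jump leads from a
        positive to a nonpositive value and is downward.\<close>
      have "?w T - jump ?w T \<noteq> 0"
        using reg False T left_val_enc[OF w T(2)] by (auto simp: regular_def coded_def)
      then have l: "0 < ?w T - jump ?w T" using left_limit_nonneg[OF w T] by simp
      then have "jump ?w T < 0" using not_positive_at_life(1)[OF w T l] by simp
      then have "dropped T \<omega> \<notin> N" using dr T(2) by (auto simp: jumpX_def)
      then show ?thesis using revive_enc[OF w T] by (simp add: coded_def dropped_def)
    qed
  qed
qed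

text \<open>The null set is pulled back along \<open>revive\<close>, so each step again concerns the
  law of the original path.\<close>

lemma AE_regular_iterates: "AE \<omega> in M. \<forall>n. regular ((revive ^^ n) (coded \<omega>))"
proof -
  have *: "AE \<omega> in M. (revive ^^ n) (coded \<omega>) \<notin> N"
    if "N \<in> sets path_space" "AE \<omega> in M. coded \<omega> \<notin> N" for n N
    using that
  proof (induction n arbitrary: N)
    case (Suc n)
    have "AE \<omega> in M. coded \<omega> \<notin> revive -` N"
      using AE_revive[OF Suc.prems] by simp
    moreover have "revive -` N \<in> sets path_space"
      using measurable_sets[OF revive_measurable Suc.prems(1)] by (simp add: space_PiM)
    ultimately show ?case using Suc.IH[of "revive -` N"] by simp
  qed simp
  have "{z \<in> space path_space. \<not> regular z} \<in> sets path_space" by measurable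
  then have "{z. \<not> regular z} \<in> sets path_space" by (simp add: space_PiM)
  from *[OF this] AE_regular show ?thesis by (subst AE_all_countable) simp
qed

text \<open>One resurrection is traded for one integration. The left-hand side is a sum over jumps
  whose expectation \<open>mecke_kill\<close> turns into an integral over \<open>s\<close>; after
  Tonelli this integral is the outermost one of \<open>picard\<close> at
  \<open>Suc k\<close>.\<close>

lemma survival_picard_step:
  assumes f[measurable]: "f \<in> borel_measurable borel" and t: "0 \<le> t"
  shows "(\<integral>\<^sup>+\<omega>. survival f t (Suc n) (coded \<omega>) * picard (kill_rate \<pi> (coded \<omega>)) k t \<partial>M)
    = (\<integral>\<^sup>+\<omega>. survival f t n (coded \<omega>) * picard (kill_rate \<pi> (coded \<omega>)) (Suc k) t \<partial>M)"
proof -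
  let ?l = "\<lambda>\<omega>. survival f t (Suc n) (coded \<omega>) * picard (kill_rate \<pi> (coded \<omega>)) k t"
  let ?k = "\<lambda>s \<omega>. if 0 < s \<and> s \<le> t then kill_rate \<pi> (coded \<omega>) s * picard (kill_rate \<pi> (coded \<omega>)) k s else 0"
  let ?F = "\<lambda>s \<omega>. kill_term f t n \<pi> k (s, dropped s \<omega>) *
      indicator {s. 0 < s \<and> jumpX s \<omega> \<le> - val (snd (s, dropped s \<omega>)) (fst (s, dropped s \<omega>))} s"
  have surv[measurable]: "(\<lambda>p. survival f t n (snd p)) \<in> borel_measurable (N \<Otimes>\<^sub>M path_space)" for N :: "real measure"
    by (rule measurable_compose[OF measurable_snd]) measurable
  have [measurable]: "(\<lambda>p. picard (kill_rate \<pi> (snd p)) k (fst p)) \<in> borel_measurable time_path"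
    by (rule picard_kill_rate_measurable) simp
  have kt[measurable]: "kill_term f t n \<pi> k \<in> borel_measurable time_path"
    unfolding kill_term_def[abs_def] by measurable
  have val[measurable]: "(\<lambda>p. val (snd p) (fst p)) \<in> borel_measurable time_path" by measurable
  have pos: "0 < val (snd p) (fst p)" if "kill_term f t n \<pi> k p \<noteq> 0" for p
  proof -
    have "alive (snd p) (fst p)" using that by (simp add: kill_term_def split: if_splits)
    then obtain m where "1 / real (Suc m) \<le> val (snd p) (fst p)" unfolding alive_def by blast
    moreover have "0 < 1 / real (Suc m)" by simp
    ultimately show ?thesis by (rule less_le_trans[rotated])
  qed
  have "(\<integral>\<^sup>+\<omega>. ?l \<omega> \<partial>M)
    = (\<integral>\<^sup>+\<omega>. (\<integral>\<^sup>+s. ?F s \<omega> \<partial>count_space UNIV) \<partial>M)"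
  proof (rule nn_integral_cong_AE, use AE_regular in eventually_elim)
    fix \<omega> assume "regular (coded \<omega>)"
    then show "?l \<omega>
      = (\<integral>\<^sup>+s. ?F s \<omega> \<partial>count_space UNIV)"
      unfolding coded_def dropped_def jumpX_def fst_conv snd_conv
      by (rule survival_Suc_eq_jump_sum[OF paths _ t])
  qed
  also have "\<dots> = (\<integral>\<^sup>+s. \<integral>\<^sup>+\<omega>. kill_term f t n \<pi> k (s, coded \<omega>) *
      lower_tail \<pi> (- val (snd (s, coded \<omega>)) (fst (s, coded \<omega>))) * indicator {0<..} s \<partial>M \<partial>lborel)"
    by (rule mecke_kill[OF kt val pos])
  also have "\<dots> = (\<integral>\<^sup>+s. \<integral>\<^sup>+\<omega>. survival f t n (coded \<omega>) *
      ?k s \<omega> \<partial>M \<partial>lborel)"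
    by (intro nn_integral_cong) (auto simp: kill_term_def kill_rate_def mult_ac)
  also have "\<dots> = (\<integral>\<^sup>+\<omega>. \<integral>\<^sup>+s. survival f t n (coded \<omega>) *
      ?k s \<omega> \<partial>lborel \<partial>M)"
  proof -
    interpret P: pair_sigma_finite "lborel :: real measure" M ..
    have map[measurable]: "(\<lambda>p. (fst p, coded (snd p))) \<in> measurable (lborel \<Otimes>\<^sub>M M) time_path"
      by measurable
    have [measurable]: "(\<lambda>p. kill_rate \<pi> (coded (snd p)) (fst p)) \<in> borel_measurable (lborel \<Otimes>\<^sub>M M)"
      "(\<lambda>p. picard (kill_rate \<pi> (coded (snd p))) k (fst p)) \<in> borel_measurable (lborel \<Otimes>\<^sub>M M)"
      using measurable_compose[OF map kill_rate_measurable[OF sets_pi]]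
        measurable_compose[OF map picard_kill_rate_measurable[OF sets_pi]] by simp_all
    have [measurable]: "(\<lambda>\<omega>. survival f t n (coded \<omega>)) \<in> borel_measurable M" by measurable
    have "(\<lambda>p. survival f t n (coded (snd p)) *
      (if 0 < fst p \<and> fst p \<le> t then kill_rate \<pi> (coded (snd p)) (fst p) * picard (kill_rate \<pi> (coded (snd p))) k (fst p) else 0))
       \<in> borel_measurable (lborel \<Otimes>\<^sub>M M)"
      by measurable
    from P.Fubini[OF this] show ?thesis unfolding fst_conv snd_conv by (rule sym)
  qed
  also have "\<dots> = (\<integral>\<^sup>+\<omega>. survival f t n (coded \<omega>) * picard (kill_rate \<pi> (coded \<omega>)) (Suc k) t \<partial>M)"
  proof (rule nn_integral_cong)
    fix \<omega>
    have [measurable]: "kill_rate \<pi> (coded \<omega>) \<in> borel_measurable borel" by (rule kill_rate_measurable1) simp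
    show "(\<integral>\<^sup>+s. survival f t n (coded \<omega>) *
      ?k s \<omega> \<partial>lborel)
      = survival f t n (coded \<omega>) * picard (kill_rate \<pi> (coded \<omega>)) (Suc k) t"
      unfolding picard.simps(2) by (rule nn_integral_cmult) measurable
  qed
  finally show ?thesis .
qed

lemma survival_picard:
  assumes f: "f \<in> borel_measurable borel" and t: "0 \<le> t"
  shows "(\<integral>\<^sup>+\<omega>. survival f t n (coded \<omega>) * picard (kill_rate \<pi> (coded \<omega>)) k t \<partial>M)
    = (\<integral>\<^sup>+\<omega>. survival f t 0 (coded \<omega>) * picard (kill_rate \<pi> (coded \<omega>)) (n + k) t \<partial>M)"
  by (induction n arbitrary: k)
     (simp_all only: survival_picard_step[OF assms] add_0 add_Suc add_Suc_right)

text \<open>Both sides are sums over the number of resurrections. They agree term by term through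
  \<open>survival_picard\<close> with \<open>k = 0\<close>, and the second sum is the exponential
  series.\<close>

theorem resurrection_formula:
  assumes f[measurable]: "f \<in> borel_measurable borel" and t: "0 \<le> t"
  shows "(\<integral>\<^sup>+\<omega>. f (resurrected (\<lambda>s. X s \<omega>) t) *
                indicator {\<omega>. ereal t < absorption_time (\<lambda>s. X s \<omega>)} \<omega> \<partial>M)
       = (\<integral>\<^sup>+\<omega>. f (X t \<omega>) *
                exp_ennreal (\<integral>\<^sup>+s. lower_tail \<pi> (- X s \<omega>) * indicator {0..t} s \<partial>lborel) *
                indicator {\<omega>. ereal t < first_passage (\<lambda>s. X s \<omega>)} \<omega> \<partial>M)"
proof -
  let ?l = "\<lambda>\<omega>. f (resurrected (\<lambda>s. X s \<omega>) t) *
                indicator {\<omega>. ereal t < absorption_time (\<lambda>s. X s \<omega>)} \<omega>"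
  let ?r = "\<lambda>\<omega>. f (X t \<omega>) *
                exp_ennreal (\<integral>\<^sup>+s. lower_tail \<pi> (- X s \<omega>) * indicator {0..t} s \<partial>lborel) *
                indicator {\<omega>. ereal t < first_passage (\<lambda>s. X s \<omega>)} \<omega>"
  let ?g = "\<lambda>\<omega>. kill_rate \<pi> (coded \<omega>)"
  have g[measurable]: "?g \<omega> \<in> borel_measurable borel" for \<omega> by (rule kill_rate_measurable1) simp
  have pic[measurable]: "(\<lambda>\<omega>. picard (?g \<omega>) n t) \<in> borel_measurable M" for n
  proof -
    have "(\<lambda>\<omega>. (t, coded \<omega>)) \<in> measurable M time_path" by measurable
    from measurable_compose[OF this picard_kill_rate_measurable[OF sets_pi]] show ?thesis by simp
  qed
  have "(\<integral>\<^sup>+\<omega>. ?l \<omega> \<partial>M)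
      = (\<integral>\<^sup>+\<omega>. (\<Sum>n. survival f t n (coded \<omega>)) \<partial>M)"
  proof (rule nn_integral_cong_AE, use AE_regular_iterates in eventually_elim)
    fix \<omega> assume "\<forall>n. regular ((revive ^^ n) (coded \<omega>))"
    then show "?l \<omega>
        = (\<Sum>n. survival f t n (coded \<omega>))"
      using resurrected_eq_suminf[OF paths _ t, of \<omega> f]
      by (cases "ereal t < absorption_time (\<lambda>s. X s \<omega>)") (simp_all add: coded_def)
  qed
  also have "\<dots> = (\<Sum>n. \<integral>\<^sup>+\<omega>. survival f t n (coded \<omega>) \<partial>M)"
    by (rule nn_integral_suminf) measurable
  also have "\<dots> = (\<Sum>n. \<integral>\<^sup>+\<omega>. survival f t 0 (coded \<omega>) * picard (?g \<omega>) n t \<partial>M)"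
    using survival_picard[OF f t, where k=0] by simp
  also have "\<dots> = (\<integral>\<^sup>+\<omega>. (\<Sum>n. survival f t 0 (coded \<omega>) * picard (?g \<omega>) n t) \<partial>M)"
    by (rule nn_integral_suminf[symmetric]) measurable
  also have "\<dots> = (\<integral>\<^sup>+\<omega>. ?r \<omega> \<partial>M)"
  proof (rule nn_integral_cong_AE, use AE_regular in eventually_elim)
    fix \<omega> assume reg: "regular (coded \<omega>)"
    let ?w = "\<lambda>s. X s \<omega>"
    have w: "cadlag ?w" by (rule paths)
    have fp: "ereal t < first_passage ?w \<longleftrightarrow> positive_upto ?w t"
      using positive_upto_iff_first_passage[OF w _ t] reg by (simp add: coded_def)
    have al: "alive (coded \<omega>) u \<longleftrightarrow> positive_upto ?w u" if "0 \<le> u" for u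
      using alive_enc[OF w that] by (simp add: coded_def)
    have va: "val (coded \<omega>) u = X u \<omega>" if "0 \<le> u" for u
      using val_enc[OF w that] by (simp add: coded_def)
    show "(\<Sum>n. survival f t 0 (coded \<omega>) * picard (?g \<omega>) n t) = ?r \<omega>"
    proof (cases "positive_upto ?w t")
      case True
      \<comment> \<open>The path is alive on all of \<open>[0, t]\<close>, so the rate is the tail
        of \<pi> throughout; the integrands can differ only at time 0.\<close>
      have "picard (?g \<omega>) 1 t = (\<integral>\<^sup>+u. (if 0 < u \<and> u \<le> t then ?g \<omega> u else 0) \<partial>lborel)"
        by (simp cong: if_cong)
      also have "\<dots> = (\<integral>\<^sup>+s. lower_tail \<pi> (- X s \<omega>) * indicator {0..t} s \<partial>lborel)"
      proof (rule nn_integral_cong_AE, use AE_lborel_singleton[of 0] in eventually_elim)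
        fix u :: real assume "u \<noteq> 0"
        then show "(if 0 < u \<and> u \<le> t then ?g \<omega> u else 0) = lower_tail \<pi> (- X u \<omega>) * indicator {0..t} u"
          using positive_upto_mono[OF True, of u] al[of u] va[of u] by (auto simp: kill_rate_def indicator_def)
      qed
      finally have "picard (?g \<omega>) 1 t = (\<integral>\<^sup>+s. lower_tail \<pi> (- X s \<omega>) * indicator {0..t} s \<partial>lborel)" .
      then show ?thesis
        using True al[OF t] va[OF t] fp suminf_picard[OF g, of \<omega> t]
        by (simp add: ennreal_suminf_cmult del: picard.simps)
    next
      case False
      then show ?thesis using al[OF t] fp by simp
    qed
  qed
  finally show ?thesis .
qed

end

section \<open>Reduction to processes all of whose paths are cadlag\<close>

lemma (in prob_space) indep_vars_cong_AE:
  assumes ind: "indep_vars M' U I" and I: "finite I" and V: "\<And>i. i \<in> I \<Longrightarrow> V i \<in> measurable M (M' i)"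
    and eq: "AE \<omega> in M. \<forall>i\<in>I. U i \<omega> = V i \<omega>"
  shows "indep_vars M' V I"
proof (cases "I = {}")
  case True
  then show ?thesis by (simp add: indep_vars_def indep_sets_def)
next
  case False
  have U: "U i \<in> measurable M (M' i)" if "i \<in> I" for i using ind that by (simp add: indep_vars_def)
  have "distr M (PiM I M') (\<lambda>\<omega>. \<lambda>i\<in>I. V i \<omega>) = distr M (PiM I M') (\<lambda>\<omega>. \<lambda>i\<in>I. U i \<omega>)"
    by (rule distr_cong_AE) (use eq U V in \<open>auto intro!: measurable_restrict elim!: eventually_mono\<close>)
  also have "\<dots> = PiM I (\<lambda>i. distr M (M' i) (U i))"
    using indep_vars_iff_distr_eq_PiM'[OF False U] ind by simp
  also have "\<dots> = PiM I (\<lambda>i. distr M (M' i) (V i))"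
    by (rule PiM_cong[OF refl], rule distr_cong_AE) (use eq U V in \<open>auto elim!: eventually_mono\<close>)
  finally show ?thesis using indep_vars_iff_distr_eq_PiM'[OF False V] by simp
qed

text \<open>On an exceptional null set the path is replaced by the constant \<open>x\<close>. Laws
  of increments and their independence are unaffected, and adding a constant leaves all jumps, hence
  \<pi>, unchanged.\<close>

lemma (in levy_process) regular_version:
  assumes \<pi>: "is_levy_measure M X \<pi>"
  obtains Y where "levy_jumps M Y x \<pi>" "AE \<omega> in M. \<forall>t. Y t \<omega> = x + X t \<omega>"
proof -
  have "AE \<omega> in M. X 0 \<omega> = 0 \<and> cadlag (\<lambda>t. X t \<omega>)"
    using starts_at_0 cadlag_paths by eventually_elim simp
  \<comment> \<open>The set of bad paths may fail to be measurable; it is enlarged to a measurable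
    null set.\<close>
  then obtain N where N: "{\<omega>\<in>space M. \<not> (X 0 \<omega> = 0 \<and> cadlag (\<lambda>t. X t \<omega>))} \<subseteq> N" "emeasure M N = 0" "N \<in> sets M"
    by (rule AE_E)
  define \<Omega> where "\<Omega> = space M - N"
  have \<Omega>[measurable]: "\<Omega> \<in> sets M" using N by (simp add: \<Omega>_def)
  have good: "X 0 \<omega> = 0" "cadlag (\<lambda>t. X t \<omega>)" if "\<omega> \<in> \<Omega>" for \<omega>
    using N that by (auto simp: \<Omega>_def)
  have AE\<Omega>: "AE \<omega> in M. \<omega> \<in> \<Omega>"
  proof -
    have "N \<in> null_sets M" using N by (simp add: null_sets_def)
    from AE_not_in[OF this] show ?thesis by (rule eventually_elim2[OF _ AE_space]) (simp add: \<Omega>_def)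
  qed
  define Y where "Y t \<omega> = (if \<omega> \<in> \<Omega> then x + X t \<omega> else x)" for t \<omega>
  have YX: "AE \<omega> in M. \<forall>t. Y t \<omega> = x + X t \<omega>"
    using AE\<Omega> by eventually_elim (simp add: Y_def)
  have Yrv: "Y t \<in> borel_measurable M" if "0 \<le> t" for t
    unfolding Y_def using random_variable_X[OF that] by measurable
  have X0: "distr M borel (\<lambda>\<omega>. Y h \<omega> - Y 0 \<omega>) = distr M borel (X h)" if "0 \<le> h" for h
    by (rule distr_cong_AE)
       (use YX starts_at_0 Yrv random_variable_X that in \<open>auto elim!: eventually_elim2\<close>)
  have "levy_jumps M Y x \<pi>"
  proof (intro levy_jumps.intro levy_paths.intro levy_paths_axioms.intro levy_jumps_axioms.intro prob_space_axioms)
    show "Y t \<in> borel_measurable M" if "0 \<le> t" for t by (rule Yrv[OF that])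
    show "Y 0 \<omega> = x" for \<omega> using good(1)[of \<omega>] by (simp add: Y_def)
    show "cadlag (\<lambda>t. Y t \<omega>)" for \<omega>
    proof (cases "\<omega> \<in> \<Omega>")
      case True
      then show ?thesis using cadlag_add_const[OF good(2)] by (simp add: Y_def)
    next
      case False
      then show ?thesis by (auto simp: Y_def cadlag_def intro: exI[of _ x])
    qed
    show "distr M borel (\<lambda>\<omega>. Y (s + h) \<omega> - Y s \<omega>) = distr M borel (\<lambda>\<omega>. Y h \<omega> - Y 0 \<omega>)"
      if "0 \<le> s" "0 \<le> h" for s h
    proof -
      have "distr M borel (\<lambda>\<omega>. Y (s + h) \<omega> - Y s \<omega>) = distr M borel (\<lambda>\<omega>. X (s + h) \<omega> - X s \<omega>)"
        by (rule distr_cong_AE)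
           (use YX Yrv random_variable_X that in \<open>auto elim!: eventually_mono intro!: borel_measurable_diff\<close>)
      then show ?thesis using stationary_increments[OF that] X0[OF that(2)] by simp
    qed
    show "indep_vars (\<lambda>_. borel) (\<lambda>i \<omega>. Y (t (Suc i)) \<omega> - Y (t i) \<omega>) {..<n}"
      if t: "0 \<le> t 0" "\<And>i. i < n \<Longrightarrow> t i \<le> t (Suc i)" for n t
    proof (rule indep_vars_cong_AE[OF independent_increments[OF t]])
      have t0: "0 \<le> t i" if "i \<le> n" for i
        using that by (induction i) (use t in \<open>auto intro: order_trans\<close>)
      show "(\<lambda>\<omega>. Y (t (Suc i)) \<omega> - Y (t i) \<omega>) \<in> borel_measurable M" if "i \<in> {..<n}" for i
        using that by (intro borel_measurable_diff Yrv t0) auto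
      show "AE \<omega> in M. \<forall>i\<in>{..<n}. X (t (Suc i)) \<omega> - X (t i) \<omega> = Y (t (Suc i)) \<omega> - Y (t i) \<omega>"
        using YX by eventually_elim simp
    qed auto
    show "is_levy_measure M Y \<pi>"
      unfolding is_levy_measure_def
    proof (intro conjI ballI)
      show "sets \<pi> = sets borel" using \<pi> by (simp add: is_levy_measure_def)
      fix A :: "real set"
      let ?C = "\<lambda>X \<omega>. emeasure (count_space UNIV) {t\<in>{0<..1}. jump (\<lambda>s. X s \<omega>) t \<noteq> 0 \<and> jump (\<lambda>s. X s \<omega>) t \<in> A}"
      assume "A \<in> sets borel"
      then have "emeasure \<pi> A = (\<integral>\<^sup>+\<omega>. ?C X \<omega> \<partial>M)"
        using \<pi> by (simp add: is_levy_measure_def)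
      also have "\<dots> = (\<integral>\<^sup>+\<omega>. ?C Y \<omega> \<partial>M)"
      proof (rule nn_integral_cong_AE, use AE\<Omega> in eventually_elim)
        fix \<omega> assume \<omega>: "\<omega> \<in> \<Omega>"
        then have "jump (\<lambda>s. Y s \<omega>) t = jump (\<lambda>s. X s \<omega>) t" for t
          using jump_add_const[OF good(2)[OF \<omega>], of x t] by (simp add: Y_def)
        then show "?C X \<omega>
          = ?C Y \<omega>" by simp
      qed
      finally show "emeasure \<pi> A = (\<integral>\<^sup>+\<omega>. ?C Y \<omega> \<partial>M)" .
    qed
  qed
  then show ?thesis using that YX by blast
qed

theorem theorem1:
  fixes M :: "'a measure" and X :: "real \<Rightarrow> 'a \<Rightarrow> real" and \<pi> :: "real measure"
    and f :: "real \<Rightarrow> ennreal" and x t :: real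
  assumes "levy_process M X"
    and "is_levy_measure M X \<pi>"
    and "x \<ge> 0" and "t \<ge> 0"
    and "f \<in> borel_measurable borel"
  shows "(\<integral>\<^sup>+\<omega>. f (resurrected (\<lambda>s. x + X s \<omega>) t) *
                indicator {\<omega>. ereal t < absorption_time (\<lambda>s. x + X s \<omega>)} \<omega> \<partial>M)
       = (\<integral>\<^sup>+\<omega>. f (x + X t \<omega>) *
                exp_ennreal (\<integral>\<^sup>+s. lower_tail \<pi> (- (x + X s \<omega>)) * indicator {0..t} s \<partial>lborel) *
                indicator {\<omega>. ereal t < first_passage (\<lambda>s. x + X s \<omega>)} \<omega> \<partial>M)"
proof -
  interpret levy_process M X by fact
  obtain Y where Y: "levy_jumps M Y x \<pi>" and eq: "AE \<omega> in M. \<forall>t. Y t \<omega> = x + X t \<omega>"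
    using regular_version[OF assms(2)] by blast
  show ?thesis
    \<comment> \<open>The integrands are functionals of the whole path, so the two paths have to
      coincide at all times simultaneously, as \<open>eq\<close> provides.\<close>
    by (rule trans[OF _ trans[OF levy_jumps.resurrection_formula[OF Y assms(5,4)]]];
        rule nn_integral_cong_AE, use eq in eventually_elim, simp add: indicator_def)
qed

end
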